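(* Consider any allocation process satisfying both $\mathcal{P}_2$ and $\mathcal{W}_1$, or both $\mathcal{P}_1$ and $\mathcal{W}_2$, and which also satisfies condition $\mathcal{P}_3$. Then there exists a constant $\kappa>0$ (independent of $n$) such that for all sufficiently large $n$, $$\Pr\big[\mathrm{Gap}(\kappa n\log n)\ge\kappa\log n\big]\ge 1-n^{-1/2},$$ where the round index $\kappa n\log n$ is rounded down to an integer.
   Context: Allocation processes. For each $n$, balls are sequentially allocated into $n$ bins. $x^t\in\mathbb{Z}_{\ge 0}^n$ is the load vector after $t$ allocations (round $t=0,1,2,\dots$), with $x^0=(0,\dots,0)$. In the $(t+1)$-th allocation exactly one bin is chosen and it receives one or more balls. $W^t=\sum_i x_i^t$, normalized loads are $y_i^t=x_i^t-W^t/n$, and $\mathrm{Gap}(t)=\max_{i\in[n]}x_i^t-W^t/n$. $\mathfrak{F}^t$ is the filtration of the first $t$ allocations. At each round $t$ bins are relabelled so that $x_1^t\ge\dots\ge x_n^t$, and $p_i^t$ (which may depend on $\mathfrak F^t$) is the conditional probability, given $\mathfrak{F}^t$, that the bin chosen in the $(t+1)$-th allocation is the $i$-th heaviest. $B_+^t=\{i: y_i^t\ge 0\}$ (overloaded bins), $B_-^t=[n]\setminus B_+^t$ (underloaded bins), $\delta^t=|B_+^t|/n$, $P_-^t=\sum_{i\in B_-^t}p_i^t$. For vectors of equal length, $p\succeq q$ (equivalently $q\preceq p$) means $\sum_{i=1}^k p_i\ge\sum_{i=1}^k q_i$ for every $k$. Conditions on an empty set of bins are vacuous. "Constant" means independent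 of $t$ and $n$. Condition $\mathcal{P}_1$: there are an integer constant $k_1\ge1$ and a constant $k_2\in(0,1]$ such that for each round $t\ge0$: $\max_{i\in B_+^t}p_i^t\le k_1/n$ and $(p_1^t,\dots,p_{\delta^tn}^t)\preceq(\frac1n,\dots,\frac1n)$; and $\min_{i\in B_-^t}p_i^t\ge k_2/n$ and $(p_n^t,p_{n-1}^t,\dots,p_{\delta^tn+1}^t)\succeq(\frac1n,\dots,\frac1n)$. Condition $\mathcal{P}_2$: there are an integer constant $k_1\ge1$ and constants $k_2,k_3,k_4\in(0,1]$ such that for each round $t\ge0$: $\max_{i\in B_+^t}p_i^t\le k_1/n$ and $(p_1^t,\dots,p_{\delta^tn}^t)\preceq(\frac1n-\frac{k_3(1-\delta^t)}{n},\dots,\frac1n-\frac{k_3(1-\delta^t)}{n})$; and $\min_{i\in B_-^t}p_i^t\ge k_2/n$ and $(p_n^t,\dots,p_{\delta^tn+1}^t)\succeq(\frac1n+\frac{k_4\delta^t}{n},\dots,\frac1n+\frac{k_4\delta^t}{n})$. Condition $\mathcal{P}_3$: for any $\varepsilon\in(0,\frac12)$ there is a constant $k_5=k_5(\varepsilon)\in(0,1]$ such that for each round $t\ge0$ with $\delta^t\in[\varepsilon,1-\varepsilon]$, $\min_{i\in[n]}p_i^t\ge k_5/n$. Condition $\mathcal{W}_1$: for each round $t\ge0$, when bin $i$ is chosen for allocation, $w_-$ balls are allocated to $i$ if $y_i^t<0$ and $w_+$ balls are allocated to $i$ if $y_i^t\ge0$, where $1\le w_+\le w_-$ are constant integers.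 Condition $\mathcal{W}_2$: as $\mathcal{W}_1$, but with $w_+<w_-$, and additionally for each round $t\ge0$, $(p_n^t,\dots,p_{\delta^tn+1}^t)\succeq(\frac{P_-^t}{|B_-^t|},\dots,\frac{P_-^t}{|B_-^t|})$. *)

theory Defs
  imports "HOL-Probability.Probability"
begin

text \<open>
  An allocation process into \<open>n\<close> bins. Bins carry fixed names \<open>0, \<dots>, n - 1\<close>.
  Index \<open>t\<close> of \<open>chosen\<close> and \<open>balls\<close> refers to the allocation that leads from round \<open>t\<close> to
  round \<open>t + 1\<close>; \<open>ranking A t i\<close> is the name of the bin that is relabelled \<open>i\<close> at round \<open>t\<close>.
  Ranks start at 0, so the \<open>i\<close>-th heaviest bin of the informal text has rank \<open>i - 1\<close>.
\<close>

record 'a process =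
  sample :: "'a measure"
  chosen :: "nat \<Rightarrow> 'a \<Rightarrow> nat"
  balls :: "nat \<Rightarrow> 'a \<Rightarrow> nat"
  ranking :: "nat \<Rightarrow> nat \<Rightarrow> 'a \<Rightarrow> nat"

primrec load :: "'a process \<Rightarrow> nat \<Rightarrow> nat \<Rightarrow> 'a \<Rightarrow> nat" where
  "load A 0 i \<omega> = 0"
| "load A (Suc t) i \<omega> = load A t i \<omega> + (if chosen A t \<omega> = i then balls A t \<omega> else 0)"

definition total_load :: "nat \<Rightarrow> 'a process \<Rightarrow> nat \<Rightarrow> 'a \<Rightarrow> nat" where
  "total_load n A t \<omega> = (\<Sum>i<n. load A t i \<omega>)"

definition norm_load :: "nat \<Rightarrow> 'a process \<Rightarrow> nat \<Rightarrow> nat \<Rightarrow> 'a \<Rightarrow> real" where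
  "norm_load n A t i \<omega> = real (load A t i \<omega>) - real (total_load n A t \<omega>) / real n"

definition gap :: "nat \<Rightarrow> 'a process \<Rightarrow> nat \<Rightarrow> 'a \<Rightarrow> real" where
  "gap n A t \<omega> =
     real (Max ((\<lambda>i. load A t i \<omega>) ` {..<n})) - real (total_load n A t \<omega>) / real n"

text \<open>How ties are broken in \<open>ranking\<close> is left open.\<close>

definition allocation_process :: "nat \<Rightarrow> 'a process \<Rightarrow> bool" where
  "allocation_process n A \<longleftrightarrow>
     prob_space (sample A) \<and>
     (\<forall>t. chosen A t \<in> measurable (sample A) (count_space {..<n})) \<and>
     (\<forall>t. balls A t \<in> measurable (sample A) (count_space {1..})) \<and>
     (\<forall>t. \<forall>i<n. ranking A t i \<in> measurable (sample A) (count_space {..<n})) \<and>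
     (\<forall>t. \<forall>\<omega>\<in>space (sample A).
        bij_betw (\<lambda>i. ranking A t i \<omega>) {..<n} {..<n} \<and>
        (\<forall>i j. i \<le> j \<longrightarrow> j < n \<longrightarrow>
           load A t (ranking A t j \<omega>) \<omega> \<le> load A t (ranking A t i \<omega>) \<omega>))"

text \<open>
  The sigma-algebra of the first \<open>t\<close> allocations. The relabellings up to round \<open>t\<close> are included
  so that ties may also be broken with the help of additional randomness; if the relabelling is
  determined by the past allocations, the third family of generators adds nothing.
\<close>

definition history :: "nat \<Rightarrow> 'a process \<Rightarrow> nat \<Rightarrow> 'a measure" where
  "history n A t = sigma (space (sample A))
     ({{\<omega> \<in> space (sample A). chosen A s \<omega> = k} | s k. s < t} \<union>
      {{\<omega> \<in> space (sample A). balls A s \<omega> = k} | s k. s < t} \<union>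
      {{\<omega> \<in> space (sample A). ranking A s i \<omega> = k} | s i k. s \<le> t \<and> i < n})"

definition alloc_prob :: "nat \<Rightarrow> 'a process \<Rightarrow> nat \<Rightarrow> nat \<Rightarrow> 'a \<Rightarrow> real" where
  "alloc_prob n A t i = real_cond_exp (sample A) (history n A t)
     (indicator {\<omega> \<in> space (sample A). chosen A t \<omega> = ranking A t i \<omega>})"

text \<open>The sets of overloaded and of underloaded bins, as sets of ranks.\<close>

definition over_bins :: "nat \<Rightarrow> 'a process \<Rightarrow> nat \<Rightarrow> 'a \<Rightarrow> nat set" where
  "over_bins n A t \<omega> = {i. i < n \<and> norm_load n A t (ranking A t i \<omega>) \<omega> \<ge> 0}"

definition under_bins :: "nat \<Rightarrow> 'a process \<Rightarrow> nat \<Rightarrow> 'a \<Rightarrow> nat set" where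
  "under_bins n A t \<omega> = {..<n} - over_bins n A t \<omega>"

definition over_frac :: "nat \<Rightarrow> 'a process \<Rightarrow> nat \<Rightarrow> 'a \<Rightarrow> real" where
  "over_frac n A t \<omega> = real (card (over_bins n A t \<omega>)) / real n"

definition under_prob :: "nat \<Rightarrow> 'a process \<Rightarrow> nat \<Rightarrow> 'a \<Rightarrow> real" where
  "under_prob n A t \<omega> = (\<Sum>i\<in>under_bins n A t \<omega>. alloc_prob n A t i \<omega>)"

text \<open>\<open>majorizes p q\<close> is \<open>p \<succeq> q\<close>; the entries are not rearranged.\<close>

definition majorizes :: "real list \<Rightarrow> real list \<Rightarrow> bool" where
  "majorizes p q \<longleftrightarrow>
     length p = length q \<and> (\<forall>k. sum_list (take k p) \<ge> sum_list (take k q))"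

text \<open>
  The probabilities of the overloaded bins from the heaviest one on, and those of the underloaded
  bins from the lightest one on: since the ranking sorts the loads, the overloaded bins are those
  with rank below the cardinality of \<open>over_bins\<close>.
\<close>

definition over_vec :: "nat \<Rightarrow> 'a process \<Rightarrow> nat \<Rightarrow> 'a \<Rightarrow> real list" where
  "over_vec n A t \<omega> =
     map (\<lambda>i. alloc_prob n A t i \<omega>) [0..<card (over_bins n A t \<omega>)]"

definition under_vec :: "nat \<Rightarrow> 'a process \<Rightarrow> nat \<Rightarrow> 'a \<Rightarrow> real list" where
  "under_vec n A t \<omega> =
     map (\<lambda>i. alloc_prob n A t i \<omega>) (rev [card (over_bins n A t \<omega>)..<n])"

text \<open>
  The conditions are about a family with one process for each \<open>n\<close>, and the constants are chosen
  before \<open>n\<close> and \<open>t\<close>.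
\<close>

definition cond_P1 :: "(nat \<Rightarrow> 'a process) \<Rightarrow> bool" where
  "cond_P1 A \<longleftrightarrow> (\<exists>(k1::nat) (k2::real). k1 \<ge> 1 \<and> 0 < k2 \<and> k2 \<le> 1 \<and>
     (\<forall>n\<ge>1. \<forall>t. AE \<omega> in sample (A n).
        (\<forall>i\<in>over_bins n (A n) t \<omega>. alloc_prob n (A n) t i \<omega> \<le> real k1 / real n) \<and>
        majorizes (replicate (card (over_bins n (A n) t \<omega>)) (1 / real n))
          (over_vec n (A n) t \<omega>) \<and>
        (\<forall>i\<in>under_bins n (A n) t \<omega>. alloc_prob n (A n) t i \<omega> \<ge> k2 / real n) \<and>
        majorizes (under_vec n (A n) t \<omega>)
          (replicate (card (under_bins n (A n) t \<omega>)) (1 / real n))))"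

definition cond_P2 :: "(nat \<Rightarrow> 'a process) \<Rightarrow> bool" where
  "cond_P2 A \<longleftrightarrow> (\<exists>(k1::nat) (k2::real) (k3::real) (k4::real). k1 \<ge> 1 \<and>
     0 < k2 \<and> k2 \<le> 1 \<and> 0 < k3 \<and> k3 \<le> 1 \<and> 0 < k4 \<and> k4 \<le> 1 \<and>
     (\<forall>n\<ge>1. \<forall>t. AE \<omega> in sample (A n).
        (\<forall>i\<in>over_bins n (A n) t \<omega>. alloc_prob n (A n) t i \<omega> \<le> real k1 / real n) \<and>
        majorizes
          (replicate (card (over_bins n (A n) t \<omega>))
             (1 / real n - k3 * (1 - over_frac n (A n) t \<omega>) / real n))
          (over_vec n (A n) t \<omega>) \<and>
        (\<forall>i\<in>under_bins n (A n) t \<omega>. alloc_prob n (A n) t i \<omega> \<ge> k2 / real n) \<and>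
        majorizes (under_vec n (A n) t \<omega>)
          (replicate (card (under_bins n (A n) t \<omega>))
             (1 / real n + k4 * over_frac n (A n) t \<omega> / real n))))"

definition cond_P3 :: "(nat \<Rightarrow> 'a process) \<Rightarrow> bool" where
  "cond_P3 A \<longleftrightarrow> (\<forall>\<epsilon>::real. 0 < \<epsilon> \<longrightarrow> \<epsilon> < 1 / 2 \<longrightarrow>
     (\<exists>k5::real. 0 < k5 \<and> k5 \<le> 1 \<and>
       (\<forall>n\<ge>1. \<forall>t. AE \<omega> in sample (A n).
          over_frac n (A n) t \<omega> \<in> {\<epsilon>..1 - \<epsilon>} \<longrightarrow>
          (\<forall>i<n. alloc_prob n (A n) t i \<omega> \<ge> k5 / real n))))"

definition weights :: "nat \<Rightarrow> nat \<Rightarrow> (nat \<Rightarrow> 'a process) \<Rightarrow> bool" where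
  "weights w_over w_under A \<longleftrightarrow> (\<forall>n\<ge>1. \<forall>t. AE \<omega> in sample (A n).
     balls (A n) t \<omega> =
       (if norm_load n (A n) t (chosen (A n) t \<omega>) \<omega> < 0 then w_under else w_over))"

definition cond_W1 :: "(nat \<Rightarrow> 'a process) \<Rightarrow> bool" where
  "cond_W1 A \<longleftrightarrow> (\<exists>w_over w_under. 1 \<le> w_over \<and> w_over \<le> w_under \<and> weights w_over w_under A)"

definition cond_W2 :: "(nat \<Rightarrow> 'a process) \<Rightarrow> bool" where
  "cond_W2 A \<longleftrightarrow>
     (\<exists>w_over w_under. 1 \<le> w_over \<and> w_over < w_under \<and> weights w_over w_under A) \<and>
     (\<forall>n\<ge>1. \<forall>t. AE \<omega> in sample (A n).
        majorizes (under_vec n (A n) t \<omega>)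
          (replicate (card (under_bins n (A n) t \<omega>))
             (under_prob n (A n) t \<omega> / real (card (under_bins n (A n) t \<omega>)))))"

end

theory Submission
  imports Defs "HOL-Real_Asymp.Real_Asymp"
begin

text \<open>
  Fixing the sequence of chosen bins fixes all loads almost surely, and the hypotheses are linear in the
  allocation probabilities. Hence they survive averaging over everything else, and the process may be
  replaced by a probability distribution on the finite tree of sequences of bins.

  The sum of squared normalized loads has drift at most \<open>C - c \<Delta> / n\<close>, where \<open>\<Delta>\<close> is the sum of the absolute
  normalized loads. As no overloaded bin is chosen with probability above \<open>k1 / n\<close>, normalized loads
  are small enough for this to concentrate, so \<open>\<Delta> = O(n)\<close> in at least half of the rounds. From such a
  round, many overloaded bins of small load are not hit while overloaded for \<open>O(n)\<close> rounds, so they become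
  underloaded, and since loads are integers this happens only when the average load passes an integer;
  on the other hand, the underloaded bins cannot all stay so, because each of them is chosen with probability
  at least \<open>k2 / n\<close>. As \<open>\<delta>\<close> grows by at most \<open>1 / n\<close> per round and drops only at integer crossings, it
  spends a constant fraction \<open>\<gamma>\<close> of the rounds in \<open>[\<epsilon>, 1 - \<epsilon>]\<close>. In these rounds \<open>P3\<close> makes every bin
  at least as likely as \<open>k5 / n\<close>, and some bin collects much more than the average load \<open>O(\<kappa> ln n)\<close>
  once \<open>\<kappa>\<close> is small, because \<open>\<gamma>\<close> does not depend on \<open>\<kappa>\<close>.

  Most failure probabilities are bounded by applying Markov's inequality to a supermartingale of the form
  \<open>Z powr (- s)\<close>, with \<open>Z\<close> a bounded potential whose drift is bounded below by a multiple of \<open>Z / n\<close>, and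
  \<open>s\<close> a power of \<open>n\<close>, up to constant factors.
\<close>

section \<open>The tree of choices\<close>

text \<open>The last step is a race in which \<open>\<kappa>\<close> cancels. As long as no load
  reaches H = \<open>\<kappa> * (1 + real wm) * ln (real n)\<close>, the sum of
  \<open>B2 powr load\<close> stays below \<open>n * B2 powr H\<close>. A balanced round multiplies
  it on average by at least \<open>1 + k5 * (B2 - 1) / n\<close>, and at least
  \<open>\<gamma> * \<kappa> * n * ln n\<close> rounds are balanced. Both logarithms are
  proportional to \<open>\<kappa> * ln n\<close>, but the first grows like \<open>ln B2\<close> and
  the second like \<open>B2 - 1\<close>, so a large \<open>B2\<close> decides the race. What limits
  \<open>\<kappa>\<close> is concentration: one hit must change the sum by a small fraction only,
  and \<open>\<kappa>\<close> is chosen so that \<open>B2 powr H\<close> is the fourth root of n.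
  This works because \<open>\<epsilon>\<close>, hence \<open>k5\<close> and \<open>\<gamma>\<close>,
  is fixed before \<open>B2\<close>.

  The obstacle before that step is one-sided information. Outside balanced rounds, single
  probabilities are bounded only from above for overloaded bins and only from below for underloaded
  bins. Each potential is therefore built so that the hits without a usable bound cannot harm
  it.\<close>

text \<open>Sequences of chosen bins are stored with the latest choice first.\<close>

definition paths :: "nat \<Rightarrow> nat \<Rightarrow> nat list set" where
  "paths n t = {\<pi>. set \<pi> \<subseteq> {..<n} \<and> length \<pi> = t}"

lemma finite_paths [simp, intro]: "finite (paths n t)"
  unfolding paths_def by (rule finite_lists_length_eq) simp

lemma paths_0 [simp]: "paths n 0 = {[]}"
  by (auto simp: paths_def)

lemma Cons_paths [simp]: "j # \<pi> \<in> paths n (Suc t) \<longleftrightarrow> j < n \<and> \<pi> \<in> paths n t"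
  by (auto simp: paths_def)

lemma length_paths: "\<pi> \<in> paths n t \<Longrightarrow> length \<pi> = t"
  by (simp add: paths_def)

lemma paths_Suc: "paths n (Suc t) = (\<lambda>(\<pi>, j). j # \<pi>) ` (paths n t \<times> {..<n})"
proof -
  have "\<pi> \<in> (\<lambda>(\<pi>, j). j # \<pi>) ` (paths n t \<times> {..<n})" if "\<pi> \<in> paths n (Suc t)" for \<pi>
    using that by (cases \<pi>) (auto simp: paths_def)
  then show ?thesis
    by (auto simp: paths_def)
qed

lemma sum_paths_Suc: "(\<Sum>\<pi>\<in>paths n (Suc t). f \<pi>) = (\<Sum>\<pi>\<in>paths n t. \<Sum>j<n. f (j # \<pi>))"
proof -
  have "inj_on (\<lambda>(\<pi>, j). j # \<pi>) (paths n t \<times> {..<n})"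
    by (auto simp: inj_on_def)
  then show ?thesis
    by (simp add: paths_Suc sum.reindex sum.cartesian_product)
      (simp add: case_prod_beta)
qed

text \<open>The state of a longer path at round \<open>t\<close> is a suffix, because the latest
  choice comes first. Events of round \<open>t\<close> are pulled back along \<open>stage\<close>,
  which takes the place of a filtration on the tree.\<close>

definition stage :: "nat list \<Rightarrow> nat \<Rightarrow> nat list" where
  "stage \<pi> t = drop (length \<pi> - t) \<pi>"

lemma stage_Cons [simp]: "t \<le> length \<pi> \<Longrightarrow> stage (j # \<pi>) t = stage \<pi> t"
  by (simp add: stage_def Suc_diff_le)

lemma stage_length [simp]: "stage \<pi> (length \<pi>) = \<pi>"
  by (simp add: stage_def)

lemma length_stage: "t \<le> length \<pi> \<Longrightarrow> length (stage \<pi> t) = t"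
  by (simp add: stage_def)

lemma stage_stage: "s \<le> t \<Longrightarrow> t \<le> length \<pi> \<Longrightarrow> stage (stage \<pi> t) s = stage \<pi> s"
  by (simp add: stage_def)

lemma stage_paths: "\<pi> \<in> paths n T \<Longrightarrow> t \<le> T \<Longrightarrow> stage \<pi> t \<in> paths n t"
  by (auto simp: stage_def paths_def dest: in_set_dropD)

lemma stage_Suc:
  assumes "\<pi> \<in> paths n T" "t < T"
  obtains j where "j < n" "stage \<pi> (Suc t) = j # stage \<pi> t"
proof -
  have l: "length \<pi> = T" "set \<pi> \<subseteq> {..<n}" using assms by (auto simp: paths_def)
  let ?k = "T - Suc t"
  have "?k < length \<pi>" using assms l by simp
  then have "drop ?k \<pi> = \<pi> ! ?k # drop (Suc ?k) \<pi>" by (rule Cons_nth_drop_Suc[symmetric])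
  moreover have "Suc ?k = T - t" using assms by simp
  moreover have "\<pi> ! ?k < n" using l \<open>?k < length \<pi>\<close> nth_mem by blast
  ultimately show ?thesis using that[of "\<pi> ! ?k"] l by (simp add: stage_def)
qed

section \<open>Loads, deviations and overloaded bins as functions of the path\<close>

locale bins =
  fixes n wp wm :: nat
  assumes n_pos: "n \<ge> 1" and wp_pos: "1 \<le> wp" and wp_le_wm: "wp \<le> wm"
begin

text \<open>The recursion for \<open>ld\<close> needs the sign of a normalized load before
  \<open>y\<close> can be defined, so the formula is stated for an arbitrary load vector;
  \<open>dev_ld\<close> identifies it with \<open>y\<close> afterwards.\<close>

definition dev :: "(nat \<Rightarrow> nat) \<Rightarrow> nat \<Rightarrow> real" where
  "dev v j = real (v j) - real (\<Sum>i<n. v i) / real n"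

primrec ld :: "nat list \<Rightarrow> nat \<Rightarrow> nat" where
  "ld [] = (\<lambda>_. 0)"
| "ld (j # \<pi>) = (ld \<pi>)(j := ld \<pi> j + (if dev (ld \<pi>) j < 0 then wm else wp))"

definition tot :: "nat list \<Rightarrow> nat" where "tot \<pi> = (\<Sum>i<n. ld \<pi> i)"

definition y :: "nat list \<Rightarrow> nat \<Rightarrow> real" where
  "y \<pi> j = real (ld \<pi> j) - real (tot \<pi>) / real n"

definition wgt :: "nat list \<Rightarrow> nat \<Rightarrow> nat" where
  "wgt \<pi> j = (if y \<pi> j < 0 then wm else wp)"

definition over :: "nat list \<Rightarrow> nat set" where "over \<pi> = {j. j < n \<and> 0 \<le> y \<pi> j}"

definition delta :: "nat list \<Rightarrow> real" where "delta \<pi> = real (card (over \<pi>)) / real n"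

definition absdev :: "nat list \<Rightarrow> real" where "absdev \<pi> = (\<Sum>j<n. \<bar>y \<pi> j\<bar>)"

definition sqdev :: "nat list \<Rightarrow> real" where "sqdev \<pi> = (\<Sum>j<n. (y \<pi> j)\<^sup>2)"

lemma n0 [simp]: "real n > 0" "n > 0" "n \<noteq> 0" using n_pos by auto

lemma dev_ld: "dev (ld \<pi>) j = y \<pi> j"
  by (simp add: dev_def y_def tot_def)

lemma ld_Cons: "ld (j # \<pi>) i = ld \<pi> i + (if i = j then wgt \<pi> j else 0)"
  by (simp add: dev_ld wgt_def)

declare ld.simps(2) [simp del]

lemma wgt_bounds: "1 \<le> wgt \<pi> j" "wgt \<pi> j \<le> wm"
  using wp_pos wp_le_wm by (auto simp: wgt_def)

lemma wm_pos: "1 \<le> wm" using wp_pos wp_le_wm by simp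

lemma tot_Nil [simp]: "tot [] = 0" by (simp add: tot_def)

lemma tot_Cons: "j < n \<Longrightarrow> tot (j # \<pi>) = tot \<pi> + wgt \<pi> j"
  by (simp add: tot_def ld_Cons sum.distrib sum.delta)

lemma y_Cons:
  "j < n \<Longrightarrow> y (j # \<pi>) i = y \<pi> i + (if i = j then real (wgt \<pi> j) else 0) - real (wgt \<pi> j) / real n"
  by (simp add: y_def ld_Cons tot_Cons add_divide_distrib)

lemma y_Nil [simp]: "y [] i = 0" by (simp add: y_def)

lemma sum_y: "(\<Sum>j<n. y \<pi> j) = 0"
  by (simp add: y_def sum_subtractf tot_def)

lemma tot_bounds:
  "\<pi> \<in> paths n t \<Longrightarrow> t \<le> tot \<pi>" "\<pi> \<in> paths n t \<Longrightarrow> tot \<pi> \<le> wm * t"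
proof (induction t arbitrary: \<pi>)
  case (Suc t)
  {
    case 1
    then obtain j \<sigma> where "\<pi> = j # \<sigma>" "j < n" "\<sigma> \<in> paths n t"
      by (cases \<pi>) (auto simp: paths_def)
    then show ?case using Suc.IH(1)[of \<sigma>] wgt_bounds(1)[of \<sigma> j] by (simp add: tot_Cons)
  next
    case 2
    then obtain j \<sigma> where "\<pi> = j # \<sigma>" "j < n" "\<sigma> \<in> paths n t"
      by (cases \<pi>) (auto simp: paths_def)
    then show ?case using Suc.IH(2)[of \<sigma>] wgt_bounds(2)[of \<sigma> j] by (simp add: tot_Cons)
  }
qed auto

lemma tot_stage_diff:
  assumes "\<pi> \<in> paths n T" "s \<le> t" "t \<le> T"
  shows "tot (stage \<pi> s) + (t - s) \<le> tot (stage \<pi> t)"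
    "tot (stage \<pi> t) \<le> tot (stage \<pi> s) + wm * (t - s)"
  using assms(2,3)
proof (induction t rule: dec_induct)
  case (step t)
  {
    case 1
    from stage_Suc[OF assms(1), of t] 1 obtain j where "j < n" "stage \<pi> (Suc t) = j # stage \<pi> t"
      by auto
    then show ?case using step.IH(1) 1 step.hyps wgt_bounds(1)[of "stage \<pi> t" j] by (simp add: tot_Cons)
  next
    case 2
    from stage_Suc[OF assms(1), of t] 2 obtain j where "j < n" "stage \<pi> (Suc t) = j # stage \<pi> t"
      by auto
    then show ?case using step.IH(2) 2 step.hyps wgt_bounds(2)[of "stage \<pi> t" j]
      by (simp add: tot_Cons Suc_diff_le)
  }
qed auto

lemma over_subset: "over \<pi> \<subseteq> {..<n}" by (auto simp: over_def)

lemma finite_over [simp]: "finite (over \<pi>)" using over_subset finite_subset by blast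

lemma delta_bounds: "0 \<le> delta \<pi>" "delta \<pi> \<le> 1"
  using card_mono[OF _ over_subset, of \<pi>] by (auto simp: delta_def)

lemma wgt_over: "j \<in> over \<pi> \<Longrightarrow> wgt \<pi> j = wp" by (auto simp: over_def wgt_def)

lemma wgt_under: "j < n \<Longrightarrow> j \<notin> over \<pi> \<Longrightarrow> wgt \<pi> j = wm" by (auto simp: over_def wgt_def)

lemma absdev_nonneg: "0 \<le> absdev \<pi>" by (simp add: absdev_def sum_nonneg)

lemma absdev_Cons:
  assumes "j < n" shows "absdev (j # \<pi>) \<le> absdev \<pi> + 2 * real wm"
proof -
  have "absdev (j # \<pi>) \<le> (\<Sum>i<n. \<bar>y \<pi> i\<bar> + ((if i = j then real (wgt \<pi> j) else 0) + real (wgt \<pi> j) / real n))"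
    unfolding absdev_def
  proof (rule sum_mono)
    fix i
    have "0 \<le> real (wgt \<pi> j) / real n" by simp
    then show "\<bar>y (j # \<pi>) i\<bar>
      \<le> \<bar>y \<pi> i\<bar> + ((if i = j then real (wgt \<pi> j) else 0) + real (wgt \<pi> j) / real n)"
      using assms by (auto simp only: y_Cons split: if_splits)
  qed
  also have "\<dots> = absdev \<pi> + 2 * real (wgt \<pi> j)"
    using assms by (simp add: sum.distrib absdev_def)
  finally show ?thesis using wgt_bounds[of \<pi> j] by simp
qed

text \<open>The rise of the average shifts all entries equally, and its first-order effect vanishes
  because normalized loads sum to 0. Only the chosen bin contributes a linear term; the remaining
  terms add up to w^2 - w^2 / n, where w is the number of balls.\<close>

lemma sqdev_Cons:
  assumes "j < n"
  shows "sqdev (j # \<pi>) \<le> sqdev \<pi> + 2 * real (wgt \<pi> j) * y \<pi> j + (real wm)\<^sup>2"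
proof -
  let ?w = "real (wgt \<pi> j)"
  have "sqdev (j # \<pi>) = (\<Sum>i<n. (y \<pi> i)\<^sup>2 + (if i = j then 2 * ?w * y \<pi> i + ?w\<^sup>2 - 2 * ?w\<^sup>2 / n else 0)
      - (2 * ?w / n) * y \<pi> i + (?w / n)\<^sup>2)"
    unfolding sqdev_def
    by (rule sum.cong) (use assms in \<open>auto simp: y_Cons power2_eq_square algebra_simps\<close>)
  also have "\<dots> = sqdev \<pi> + (2 * ?w * y \<pi> j + ?w\<^sup>2 - 2 * ?w\<^sup>2 / n) - (2 * ?w / n) * (\<Sum>i<n. y \<pi> i) + ?w\<^sup>2 / n"
    using assms
    by (simp add: sum.distrib sum_subtractf sqdev_def sum_distrib_left power2_eq_square)
  also have "\<dots> \<le> sqdev \<pi> + 2 * ?w * y \<pi> j + ?w\<^sup>2"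
    by (simp add: sum_y)
  also have "?w\<^sup>2 \<le> (real wm)\<^sup>2" using wgt_bounds[of \<pi> j] by simp
  finally show ?thesis by simp
qed

text \<open>Loads are integers, so the overloaded bins change only slowly between the rounds in which the
  average load passes an integer.\<close>

definition lev :: "nat list \<Rightarrow> int" where "lev \<pi> = \<lceil>real (tot \<pi>) / real n\<rceil>"

lemma over_lev: "over \<pi> = {j. j < n \<and> lev \<pi> \<le> int (ld \<pi> j)}"
  by (auto simp: over_def lev_def y_def ceiling_le_iff)

lemma lev_mono: "j < n \<Longrightarrow> lev \<pi> \<le> lev (j # \<pi>)"
  unfolding lev_def by (intro ceiling_mono divide_right_mono) (auto simp: tot_Cons)

lemma over_Cons: "j < n \<Longrightarrow> over (j # \<pi>) \<subseteq> insert j (over \<pi>)"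
  using lev_mono[of j \<pi>] by (auto simp: over_lev ld_Cons)

lemma over_Cons_same: "j < n \<Longrightarrow> lev (j # \<pi>) = lev \<pi> \<Longrightarrow> over \<pi> \<subseteq> over (j # \<pi>)"
  by (auto simp: over_lev ld_Cons)

lemma delta_Cons: "j < n \<Longrightarrow> delta (j # \<pi>) \<le> delta \<pi> + 1 / real n"
proof -
  assume "j < n"
  then have "card (over (j # \<pi>)) \<le> card (insert j (over \<pi>))"
    by (intro card_mono over_Cons) auto
  also have "\<dots> \<le> Suc (card (over \<pi>))" by (simp add: card_insert_if)
  finally have "real (card (over (j # \<pi>))) \<le> real (card (over \<pi>)) + 1" by linarith
  then show ?thesis by (simp add: delta_def add_divide_distrib[symmetric] divide_right_mono)
qed

lemma delta_Cons_same: "j < n \<Longrightarrow> lev (j # \<pi>) = lev \<pi> \<Longrightarrow> delta \<pi> \<le> delta (j # \<pi>)"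
  unfolding delta_def by (intro divide_right_mono) (simp_all add: card_mono over_Cons_same)

end

text \<open>\<open>P \<pi>\<close> is the probability that the choices follow \<open>\<pi>\<close>.
  Conditional statements appear multiplied by \<open>P \<pi>\<close>, so paths of probability 0 need
  no separate treatment. Majorization enters the tree only through \<open>P_drift\<close>.\<close>

locale alloc_tree = bins +
  fixes P :: "nat list \<Rightarrow> real" and k1 k2 c0 :: real
  assumes P_Nil: "P [] = 1"
    and P_nonneg: "P \<pi> \<ge> 0"
    and P_sum: "\<pi> \<in> paths n t \<Longrightarrow> (\<Sum>j<n. P (j # \<pi>)) = P \<pi>"
    and P_over: "\<pi> \<in> paths n t \<Longrightarrow> j \<in> over \<pi> \<Longrightarrow> P (j # \<pi>) \<le> k1 / real n * P \<pi>"
    and P_under: "\<pi> \<in> paths n t \<Longrightarrow> j < n \<Longrightarrow> j \<notin> over \<pi> \<Longrightarrow> P (j # \<pi>) \<ge> k2 / real n * P \<pi>"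
    and P_drift: "\<pi> \<in> paths n t \<Longrightarrow>
      (\<Sum>j<n. P (j # \<pi>) * (real (wgt \<pi> j) * y \<pi> j)) \<le> - (c0 * absdev \<pi> / real n) * P \<pi>"
    and k1: "k1 \<ge> 1" and k2: "0 < k2" "k2 \<le> 1" and c0: "0 < c0" "c0 \<le> 1"
begin

section \<open>Expectations and probabilities on the tree\<close>

definition Ex :: "nat \<Rightarrow> (nat list \<Rightarrow> real) \<Rightarrow> real" where
  "Ex t f = (\<Sum>\<pi>\<in>paths n t. P \<pi> * f \<pi>)"

definition pr :: "nat \<Rightarrow> (nat list \<Rightarrow> bool) \<Rightarrow> real" where
  "pr t Q = Ex t (\<lambda>\<pi>. of_bool (Q \<pi>))"

lemma Ex_0 [simp]: "Ex 0 f = f []" by (simp add: Ex_def P_Nil)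

lemma Ex_mono: "(\<And>\<pi>. \<pi> \<in> paths n t \<Longrightarrow> f \<pi> \<le> g \<pi>) \<Longrightarrow> Ex t f \<le> Ex t g"
  unfolding Ex_def by (intro sum_mono mult_left_mono P_nonneg)

lemma Ex_Suc: "Ex (Suc t) f = (\<Sum>\<pi>\<in>paths n t. \<Sum>j<n. P (j # \<pi>) * f (j # \<pi>))"
  by (simp add: Ex_def sum_paths_Suc)

text \<open>Consistency of the path weights: \<open>P_sum\<close> sums out the later choices one at
  a time. An event of round \<open>t\<close> can thus be estimated at round \<open>t\<close> and
  used at the final round.\<close>

lemma Ex_stage: "t \<le> t' \<Longrightarrow> Ex t' (\<lambda>\<pi>. f (stage \<pi> t)) = Ex t f"
proof (induction t' rule: dec_induct)
  case base
  show ?case unfolding Ex_def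
    by (intro sum.cong refl) (metis length_paths stage_length)
next
  case (step t')
  have "Ex (Suc t') (\<lambda>\<pi>. f (stage \<pi> t)) = (\<Sum>\<pi>\<in>paths n t'. \<Sum>j<n. P (j # \<pi>) * f (stage \<pi> t))"
    unfolding Ex_Suc using step by (intro sum.cong) (auto simp: length_paths)
  also have "\<dots> = Ex t' (\<lambda>\<pi>. f (stage \<pi> t))"
    unfolding Ex_def sum_distrib_right[symmetric] by (intro sum.cong) (auto simp: P_sum)
  finally show ?case using step by simp
qed

lemma Ex_const: "Ex t (\<lambda>_. c) = c"
  using Ex_stage[of 0 t "\<lambda>_. c"] by simp

lemma Ex_cmult: "Ex t (\<lambda>\<pi>. c * f \<pi>) = c * Ex t f"
  by (simp add: Ex_def sum_distrib_left mult.left_commute)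

text \<open>The assumption bounds the conditional expectation of \<open>f\<close> at the next round
  by \<open>a * f\<close>, multiplied by the path weight. Every concentration bound below is this
  lemma followed by \<open>pr_markov\<close>; the factor \<open>a\<close> may exceed 1.\<close>

lemma Ex_decay:
  assumes step: "\<And>t \<pi>. t0 \<le> t \<Longrightarrow> t < t1 \<Longrightarrow> \<pi> \<in> paths n t \<Longrightarrow>
      (\<Sum>j<n. P (j # \<pi>) * f (j # \<pi>)) \<le> P \<pi> * (a * f \<pi>)"
    and "a \<ge> 0" "t0 \<le> t1"
  shows "Ex t1 f \<le> a ^ (t1 - t0) * Ex t0 f"
  using assms(3) step
proof (induction t1 rule: dec_induct)
  case (step t)
  have "Ex (Suc t) f \<le> (\<Sum>\<pi>\<in>paths n t. P \<pi> * (a * f \<pi>))"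
    unfolding Ex_Suc by (intro sum_mono step.prems) (use step.hyps in auto)
  also have "\<dots> = a * Ex t f"
    by (simp add: Ex_def sum_distrib_left algebra_simps)
  also have "\<dots> \<le> a * (a ^ (t - t0) * Ex t0 f)"
    using step \<open>a \<ge> 0\<close> by (intro mult_left_mono step.IH) auto
  finally show ?case using step.hyps by (simp add: Suc_diff_le mult.assoc)
qed auto

lemma pr_mono: "(\<And>\<pi>. \<pi> \<in> paths n t \<Longrightarrow> Q \<pi> \<Longrightarrow> Q' \<pi>) \<Longrightarrow> pr t Q \<le> pr t Q'"
  unfolding pr_def by (intro Ex_mono) auto

lemma pr_stage: "t \<le> t' \<Longrightarrow> pr t' (\<lambda>\<pi>. Q (stage \<pi> t)) = pr t Q"
  unfolding pr_def by (rule Ex_stage)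

lemma pr_disj: "pr t (\<lambda>\<pi>. Q \<pi> \<or> Q' \<pi>) \<le> pr t Q + pr t Q'"
  unfolding pr_def Ex_def sum.distrib[symmetric]
  by (intro sum_mono) (auto simp: P_nonneg)

lemma pr_Bex:
  assumes "finite I" "\<And>i. i \<in> I \<Longrightarrow> pr t (Q i) \<le> b"
  shows "pr t (\<lambda>\<pi>. \<exists>i\<in>I. Q i \<pi>) \<le> real (card I) * b"
  using assms
proof (induction I rule: finite_induct)
  case empty
  then show ?case by (simp add: pr_def Ex_const)
next
  case (insert i I)
  have "pr t (\<lambda>\<pi>. \<exists>i\<in>insert i I. Q i \<pi>) \<le> pr t (Q i) + pr t (\<lambda>\<pi>. \<exists>i\<in>I. Q i \<pi>)"
    by (rule order_trans[OF _ pr_disj]) (auto intro: pr_mono)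
  also have "\<dots> \<le> b + real (card I) * b"
    by (intro add_mono insert) (use insert in auto)
  finally show ?case using insert.hyps by (simp add: algebra_simps)
qed

lemma pr_markov:
  assumes "\<And>\<pi>. \<pi> \<in> paths n t \<Longrightarrow> 0 \<le> f \<pi>" "\<And>\<pi>. \<pi> \<in> paths n t \<Longrightarrow> Q \<pi> \<Longrightarrow> c \<le> f \<pi>"
  shows "c * pr t Q \<le> Ex t f"
  unfolding pr_def Ex_cmult[symmetric] using assms by (intro Ex_mono) auto

end

section \<open>Concentration\<close>

text \<open>For x = - z < 0 the Taylor lower bound for \<open>exp z\<close> is inverted, and it
  remains to see that (1 - z + z^2) * (1 + z + z^2 / 2) is at least 1.\<close>

lemma exp_le_quadratic:
  fixes x :: real
  assumes "\<bar>x\<bar> \<le> 1"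
  shows "exp x \<le> 1 + x + x\<^sup>2"
proof (cases "x \<ge> 0")
  case True
  then show ?thesis using assms by (simp add: exp_bound)
next
  case False
  define z where "z = - x"
  have z: "0 \<le> z" "z \<le> 1" using False assms by (auto simp: z_def)
  have "1 + z + z\<^sup>2 / 2 \<le> exp z" using exp_lower_Taylor_quadratic[OF z(1)] by simp
  moreover have pos: "1 + z + z\<^sup>2 / 2 > 0" using z by (intro add_pos_nonneg) auto
  ultimately have "exp (- z) \<le> 1 / (1 + z + z\<^sup>2 / 2)"
    by (simp add: exp_minus inverse_eq_divide frac_le)
  also have "\<dots> \<le> 1 - z + z\<^sup>2"
  proof -
    have "(1 - z + z\<^sup>2) * (1 + z + z\<^sup>2 / 2) = 1 + z\<^sup>2 / 2 + z ^ 3 / 2 + z ^ 4 / 2"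
      by (simp add: field_simps power2_eq_square power3_eq_cube power4_eq_xxxx)
    also have "\<dots> \<ge> 1" using z by simp
    finally show ?thesis using pos by (simp add: divide_le_eq)
  qed
  finally show ?thesis by (simp add: z_def)
qed

section \<open>Size of the normalized loads and sum of the absolute deviations\<close>

context alloc_tree
begin

text \<open>Measuring in units of \<open>wm\<close> makes a hit at most double \<open>f\<close>. The
  shift by 1 makes \<open>f\<close> equal to 1 right after a hit of an underloaded bin, so hits
  whose probability has no upper bound cannot increase it. Only hits of bin \<open>i\<close> while
  overloaded count, and these cost a factor \<open>1 + k1 / n\<close> per round in
  expectation.\<close>

lemma pr_load_high:
  assumes i: "i < n" and M: "M \<ge> 0"
  shows "pr t (\<lambda>\<pi>. y \<pi> i \<ge> real wm * (1 + M)) \<le> exp (k1 * real t / real n) * 2 powr (- M)"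
proof -
  define f where "f \<pi> = (2::real) powr max 0 (y \<pi> i / real wm - 1)" for \<pi>
  have wm: "real wm \<ge> 1" using wm_pos by simp
  have f_step: "f (j # \<pi>) \<le> f \<pi> * (1 + of_bool (j = i \<and> i \<in> over \<pi>))" if "j < n" for j \<pi>
  proof (cases "j = i \<and> i \<in> over \<pi>")
    case True
    have "real (wgt \<pi> i) / real n \<ge> 0" by simp
    moreover have "y (j # \<pi>) i = y \<pi> i + real (wgt \<pi> i) - real (wgt \<pi> i) / real n"
      using True that by (simp add: y_Cons)
    moreover have "real (wgt \<pi> i) \<le> real wm" using wgt_bounds(2) by simp
    ultimately have "y (j # \<pi>) i \<le> y \<pi> i + real wm" by linarith
    then have "y (j # \<pi>) i / real wm \<le> y \<pi> i / real wm + 1"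
      using wm by (simp add: field_simps)
    then have "f (j # \<pi>) \<le> 2 powr (max 0 (y \<pi> i / real wm - 1) + 1)"
      unfolding f_def by (intro powr_mono) auto
    then show ?thesis using True by (simp add: f_def powr_add)
  next
    case False
    have "max 0 (y (j # \<pi>) i / real wm - 1) \<le> max 0 (y \<pi> i / real wm - 1)"
    proof (cases "j = i")
      case True
      then have "y \<pi> i < 0" using False i by (auto simp: over_def)
      moreover have "real (wgt \<pi> i) / real n \<ge> 0" by simp
      moreover have "y (j # \<pi>) i = y \<pi> i + real (wgt \<pi> i) - real (wgt \<pi> i) / real n"
        using True that by (simp add: y_Cons)
      moreover have "real (wgt \<pi> i) \<le> real wm" using wgt_bounds(2) by simp
      ultimately have "y (j # \<pi>) i \<le> real wm" by linarith
      then show ?thesis using wm by (simp add: max_def)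
    next
      case False
      have "real (wgt \<pi> j) / real n \<ge> 0" by simp
      with False have "y (j # \<pi>) i \<le> y \<pi> i"
        using that by (auto simp: y_Cons)
      then have "y (j # \<pi>) i / real wm \<le> y \<pi> i / real wm" by (simp add: divide_right_mono)
      then show ?thesis by linarith
    qed
    then have "f (j # \<pi>) \<le> f \<pi>" unfolding f_def by (intro powr_mono) auto
    then show ?thesis using False by auto
  qed
  have "Ex t f \<le> (1 + k1 / real n) ^ (t - 0) * Ex 0 f"
  proof (rule Ex_decay)
    fix s \<pi> assume \<pi>: "\<pi> \<in> paths n s"
    have "(\<Sum>j<n. P (j # \<pi>) * f (j # \<pi>))
        \<le> (\<Sum>j<n. P (j # \<pi>) * (f \<pi> * (1 + of_bool (j = i \<and> i \<in> over \<pi>))))"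
      by (intro sum_mono mult_left_mono f_step P_nonneg) auto
    also have "\<dots> = f \<pi> * ((\<Sum>j<n. P (j # \<pi>)) + (\<Sum>j<n. if j = i then P (i # \<pi>) * of_bool (i \<in> over \<pi>) else 0))"
      unfolding sum.distrib[symmetric] sum_distrib_left
      by (intro sum.cong) (auto simp: algebra_simps)
    also have "\<dots> = f \<pi> * (P \<pi> + P (i # \<pi>) * of_bool (i \<in> over \<pi>))"
      using i by (simp add: P_sum[OF \<pi>])
    also have "\<dots> \<le> f \<pi> * (P \<pi> + k1 / real n * P \<pi>)"
      using P_over[OF \<pi>, of i] k1 P_nonneg[of \<pi>]
      by (intro mult_left_mono add_left_mono) (auto simp: f_def)
    finally show "(\<Sum>j<n. P (j # \<pi>) * f (j # \<pi>)) \<le> P \<pi> * ((1 + k1 / real n) * f \<pi>)"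
      by (simp add: algebra_simps)
  qed (use k1 in auto)
  also have "\<dots> = (1 + k1 / real n) ^ t"
    by (simp add: f_def)
  also have "\<dots> \<le> exp (k1 / real n) ^ t"
    using k1 by (intro power_mono exp_ge_add_one_self) auto
  also have "\<dots> = exp (k1 * real t / real n)"
    by (simp add: exp_of_nat_mult[symmetric] mult.commute)
  finally have E: "Ex t f \<le> exp (k1 * real t / real n)" .
  have "2 powr M * pr t (\<lambda>\<pi>. y \<pi> i \<ge> real wm * (1 + M)) \<le> Ex t f"
  proof (rule pr_markov)
    fix \<pi> assume "real wm * (1 + M) \<le> y \<pi> i"
    then have "M \<le> y \<pi> i / real wm - 1" using wm by (simp add: field_simps)
    then show "2 powr M \<le> f \<pi>" unfolding f_def by (intro powr_mono) auto
  qed (simp add: f_def)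
  with E have "2 powr M * pr t (\<lambda>\<pi>. y \<pi> i \<ge> real wm * (1 + M)) \<le> exp (k1 * real t / real n)"
    by linarith
  then show ?thesis by (simp add: powr_minus field_simps)
qed

lemma y_lower: "\<pi> \<in> paths n t \<Longrightarrow> y \<pi> i \<ge> - (real wm * real t / real n)"
proof -
  assume "\<pi> \<in> paths n t"
  then have "real (tot \<pi>) \<le> real wm * real t"
    using tot_bounds(2) by (metis of_nat_mono of_nat_mult)
  then have "real (tot \<pi>) / real n \<le> real wm * real t / real n"
    by (intro divide_right_mono) auto
  moreover have "y \<pi> i \<ge> - (real (tot \<pi>) / real n)" by (simp add: y_def)
  ultimately show ?thesis by linarith
qed

text \<open>The bound is required strictly before \<open>T\<close>: it then controls the increments
  of all \<open>T\<close> allocations, and whether the next allocation is controlled is known before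
  it is made.\<close>

definition bounded_until :: "real \<Rightarrow> nat \<Rightarrow> nat list \<Rightarrow> bool" where
  "bounded_until R T \<pi> \<longleftrightarrow> (\<forall>t<T. \<forall>i<n. \<bar>y (stage \<pi> t) i\<bar> \<le> R)"

text \<open>The lower side is deterministic, as the average load is at most
  \<open>wm * T / n\<close>. Only the upper side is random and needs a union bound over rounds and
  bins.\<close>

lemma pr_unbounded:
  assumes M: "M \<ge> 0" and R: "R \<ge> real wm * (1 + M)" "R \<ge> real wm * real T / real n"
  shows "pr T (\<lambda>\<pi>. \<not> bounded_until R T \<pi>)
    \<le> real T * real n * (exp (k1 * real T / real n) * 2 powr (- M))"
proof -
  have "pr T (\<lambda>\<pi>. \<not> bounded_until R T \<pi>)
      \<le> pr T (\<lambda>\<pi>. \<exists>(t,i)\<in>{..<T}\<times>{..<n}. y (stage \<pi> t) i \<ge> real wm * (1 + M))"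
  proof (rule pr_mono)
    fix \<pi> assume \<pi>: "\<pi> \<in> paths n T" "\<not> bounded_until R T \<pi>"
    then obtain t i where ti: "t < T" "i < n" "\<bar>y (stage \<pi> t) i\<bar> > R"
      by (auto simp: bounded_until_def not_le)
    have "y (stage \<pi> t) i \<ge> - (real wm * real t / real n)"
      using \<pi> ti by (intro y_lower stage_paths) auto
    moreover have "real wm * real t / real n \<le> real wm * real T / real n"
      using ti by (intro divide_right_mono mult_left_mono) auto
    ultimately have "y (stage \<pi> t) i \<ge> real wm * (1 + M)" using R ti by linarith
    with ti show "\<exists>(t,i)\<in>{..<T}\<times>{..<n}. y (stage \<pi> t) i \<ge> real wm * (1 + M)" by auto
  qed
  also have "\<dots> \<le> real (card ({..<T}\<times>{..<n})) * (exp (k1 * real T / real n) * 2 powr (- M))"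
    unfolding case_prod_beta
  proof (rule pr_Bex)
    fix x assume "x \<in> {..<T}\<times>{..<n}"
    then have x: "fst x < T" "snd x < n" by auto
    have "pr T (\<lambda>\<pi>. y (stage \<pi> (fst x)) (snd x) \<ge> real wm * (1 + M))
        = pr (fst x) (\<lambda>\<pi>. y \<pi> (snd x) \<ge> real wm * (1 + M))"
      using x by (intro pr_stage) auto
    also have "\<dots> \<le> exp (k1 * real (fst x) / real n) * 2 powr (- M)"
      using x M by (intro pr_load_high) auto
    also have "\<dots> \<le> exp (k1 * real T / real n) * 2 powr (- M)"
      using x k1 by (intro mult_right_mono) (auto intro!: divide_right_mono)
    finally show "pr T (\<lambda>\<pi>. y (stage \<pi> (fst x)) (snd x) \<ge> real wm * (1 + M))
      \<le> exp (k1 * real T / real n) * 2 powr (- M)" .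
  qed auto
  finally show ?thesis by simp
qed

text \<open>The quadratic potential drops by about \<open>absdev / n\<close> in expectation; with bounded
  increments its exponential moment gives a bound for the sum of all \<open>absdev\<close>.\<close>

lemma pr_absdev_sum:
  assumes R: "R \<ge> real wm"
  shows "pr T (\<lambda>\<pi>. bounded_until R T \<pi> \<and>
      (\<Sum>t<T. absdev (stage \<pi> t)) \<ge> 3 * (real wm)\<^sup>2 / (2 * c0) * real n * real T)
    \<le> exp (- (real wm)\<^sup>2 * real T / (16 * R\<^sup>2))"
proof -
  define C where "C = (real wm)\<^sup>2"
  \<comment> \<open>Bound for \<open>\<bar>V j\<bar>\<close> below: the linear term of the quadratic
    potential and the compensating term contribute at most \<open>2 * wm * R\<close> each.\<close>
  define R2 where "R2 = 4 * real wm * R"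
  \<comment> \<open>Makes the second-order loss \<open>(lam * R2)\<^sup>2\<close> equal to
    \<open>lam * C\<close>.\<close>
  define lam where "lam = C / R2\<^sup>2"
  define S where "S \<pi> = (\<Sum>t<length \<pi>. absdev (stage \<pi> t))" for \<pi>
  \<comment> \<open>The compensated potential drifts by at most \<open>C\<close> per round;
    subtracting \<open>2 * C\<close> leaves another \<open>C\<close> to pay for the second-order
    term of the exponential. A sum of deviations worth \<open>3 * C * T\<close> then still leaves
    \<open>C * T\<close> in the exponent. The indicator kills paths whose increments are not under
    control.\<close>
  define X where "X \<pi> = of_bool (bounded_until R (length \<pi>) \<pi>) *
    exp (lam * (sqdev \<pi> + 2 * c0 / real n * S \<pi> - 2 * C * real (length \<pi>)))" for \<pi>
  have wm: "real wm \<ge> 1" using wm_pos by simp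
  have R0: "R > 0" "R2 > 0" using R wm by (auto simp: R2_def)
  have C1: "C \<ge> 1" using wm by (simp add: C_def)
  have lam0: "lam > 0" using R0 C1 by (simp add: lam_def)
  have CR: "C \<le> R2"
  proof -
    have "real wm * real wm \<le> real wm * R" using R wm by (intro mult_left_mono) auto
    also have "\<dots> \<le> R2" using R0 wm by (simp add: R2_def)
    finally show ?thesis by (simp add: C_def power2_eq_square)
  qed
  have lamR: "lam * R2 \<le> 1" using R0 CR by (simp add: lam_def power2_eq_square)
  have step: "(\<Sum>j<n. P (j # \<pi>) * X (j # \<pi>)) \<le> P \<pi> * (1 * X \<pi>)" if \<pi>: "\<pi> \<in> paths n t" for t \<pi>
  proof (cases "bounded_until R (Suc (length \<pi>)) \<pi>")
    case False
    have "X (j # \<pi>) = 0" for j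
      using False by (auto simp: X_def bounded_until_def less_Suc_eq)
    moreover have "X \<pi> \<ge> 0" by (simp add: X_def)
    ultimately show ?thesis using P_nonneg by simp
  next
    case True
    define V where "V j = 2 * (real (wgt \<pi> j) * y \<pi> j) + 2 * c0 * absdev \<pi> / real n" for j
    have bd: "\<bar>y \<pi> i\<bar> \<le> R" if "i < n" for i
      using True that unfolding bounded_until_def by (metis lessI stage_length)
    have bd': "bounded_until R (length \<pi>) \<pi>"
      using True by (auto simp: bounded_until_def)
    have Xpi: "X \<pi> = exp (lam * (sqdev \<pi> + 2 * c0 / real n * S \<pi> - 2 * C * real (length \<pi>)))"
      using bd' by (simp add: X_def)
    have "absdev \<pi> \<le> (\<Sum>i<n. R)" unfolding absdev_def by (intro sum_mono bd) auto
    then have ad: "absdev \<pi> / real n \<le> R" by (simp add: divide_le_eq mult.commute)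
    have Vb: "\<bar>V j\<bar> \<le> R2" if "j < n" for j
    proof -
      have "\<bar>real (wgt \<pi> j) * y \<pi> j\<bar> \<le> real wm * R"
        unfolding abs_mult using wgt_bounds[of \<pi> j] bd[OF that] by (intro mult_mono) auto
      moreover have "0 \<le> c0 * (absdev \<pi> / real n)"
        using c0 absdev_nonneg by simp
      moreover have "c0 * (absdev \<pi> / real n) \<le> real wm * R"
        using c0 ad wm absdev_nonneg[of \<pi>] by (intro mult_mono) auto
      ultimately have "\<bar>real (wgt \<pi> j) * y \<pi> j\<bar> \<le> real wm * R"
        "\<bar>c0 * (absdev \<pi> / real n)\<bar> \<le> real wm * R" by auto
      moreover have "V j = 2 * (real (wgt \<pi> j) * y \<pi> j) + 2 * (c0 * (absdev \<pi> / real n))"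
        by (simp add: V_def)
      moreover have "R2 = 4 * (real wm * R)" by (simp add: R2_def)
      ultimately show ?thesis by linarith
    qed
    have Xj: "X (j # \<pi>) \<le> X \<pi> * exp (- lam * C) * (1 + lam * V j + (lam * R2)\<^sup>2)" if j: "j < n" for j
    proof -
      have "bounded_until R (length (j # \<pi>)) (j # \<pi>)"
        using True by (auto simp: bounded_until_def)
      moreover have "S (j # \<pi>) = S \<pi> + absdev \<pi>" by (simp add: S_def)
      ultimately have "X (j # \<pi>) = exp (lam * (sqdev (j # \<pi>) + 2 * c0 / real n * (S \<pi> + absdev \<pi>)
          - 2 * C * (real (length \<pi>) + 1)))" by (simp add: X_def add.commute)
      also have "\<dots> \<le> exp (lam * ((sqdev \<pi> + 2 * c0 / real n * S \<pi> - 2 * C * real (length \<pi>)) + V j - C))"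
      proof -
        have "sqdev (j # \<pi>) + 2 * c0 / real n * (S \<pi> + absdev \<pi>) - 2 * C * (real (length \<pi>) + 1)
            \<le> (sqdev \<pi> + 2 * c0 / real n * S \<pi> - 2 * C * real (length \<pi>)) + V j - C"
          using sqdev_Cons[OF j, of \<pi>] by (simp add: V_def C_def algebra_simps add_divide_distrib)
        then show ?thesis using lam0 by simp
      qed
      also have "\<dots> = X \<pi> * exp (- lam * C) * exp (lam * V j)"
        by (simp add: Xpi exp_add[symmetric] algebra_simps)
      also have "\<dots> \<le> X \<pi> * exp (- lam * C) * (1 + lam * V j + (lam * R2)\<^sup>2)"
      proof (rule mult_left_mono)
        have lv: "\<bar>lam * V j\<bar> \<le> lam * R2" using Vb[OF j] lam0 by (simp add: abs_mult)
        then have "exp (lam * V j) \<le> 1 + lam * V j + (lam * V j)\<^sup>2"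
          using lamR by (intro exp_le_quadratic) auto
        moreover have "(lam * V j)\<^sup>2 \<le> (lam * R2)\<^sup>2"
          using lv by (metis power2_abs power_mono abs_ge_zero)
        ultimately show "exp (lam * V j) \<le> 1 + lam * V j + (lam * R2)\<^sup>2" by linarith
      qed (simp add: Xpi)
      finally show ?thesis .
    qed
    have "(\<Sum>j<n. P (j # \<pi>) * X (j # \<pi>))
        \<le> (\<Sum>j<n. P (j # \<pi>) * (X \<pi> * exp (- lam * C) * (1 + lam * V j + (lam * R2)\<^sup>2)))"
      by (intro sum_mono mult_left_mono Xj P_nonneg) auto
    also have "\<dots> = X \<pi> * exp (- lam * C) * (\<Sum>j<n. P (j # \<pi>) * (1 + (lam * R2)\<^sup>2) + lam * (P (j # \<pi>) * V j))"
      unfolding sum_distrib_left by (intro sum.cong) (auto simp: algebra_simps)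
    also have "\<dots> = X \<pi> * exp (- lam * C) *
        (P \<pi> * (1 + (lam * R2)\<^sup>2) + lam * (\<Sum>j<n. P (j # \<pi>) * V j))"
      by (simp add: sum.distrib sum_distrib_left[symmetric] sum_distrib_right[symmetric] P_sum[OF \<pi>])
    also have "(\<Sum>j<n. P (j # \<pi>) * V j) = 2 * (\<Sum>j<n. P (j # \<pi>) * (real (wgt \<pi> j) * y \<pi> j))
        + P \<pi> * (2 * c0 * absdev \<pi> / real n)"
      unfolding V_def distrib_left sum.distrib sum_distrib_right[symmetric] P_sum[OF \<pi>] sum_distrib_left
      by (intro arg_cong2[where f = "(+)"] sum.cong) auto
    also have "\<dots> = 2 * ((\<Sum>j<n. P (j # \<pi>) * (real (wgt \<pi> j) * y \<pi> j)) + c0 * absdev \<pi> / real n * P \<pi>)"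
      by (simp add: algebra_simps)
    also have "\<dots> \<le> 0" using P_drift[OF \<pi>] by (simp add: algebra_simps)
    finally have "(\<Sum>j<n. P (j # \<pi>) * X (j # \<pi>))
        \<le> X \<pi> * exp (- lam * C) * (P \<pi> * (1 + (lam * R2)\<^sup>2))"
      using lam0 by (simp add: Xpi mult_left_mono)
    also have "\<dots> \<le> X \<pi> * exp (- lam * C) * (P \<pi> * exp ((lam * R2)\<^sup>2))"
      using P_nonneg by (intro mult_left_mono exp_ge_add_one_self) (auto simp: Xpi)
    also have "(lam * R2)\<^sup>2 = lam * C" using R0 by (simp add: lam_def power2_eq_square)
    finally show ?thesis by (simp add: exp_minus field_simps)
  qed
  have "Ex T X \<le> 1 ^ (T - 0) * Ex 0 X"
    by (rule Ex_decay) (use step in auto)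
  also have "\<dots> = 1" by (simp add: X_def S_def sqdev_def bounded_until_def)
  finally have E: "Ex T X \<le> 1" .
  let ?Q = "\<lambda>\<pi>. bounded_until R T \<pi> \<and>
      (\<Sum>t<T. absdev (stage \<pi> t)) \<ge> 3 * (real wm)\<^sup>2 / (2 * c0) * real n * real T"
  have "exp (lam * C * real T) * pr T ?Q \<le> Ex T X"
  proof (rule pr_markov)
    fix \<pi> assume \<pi>: "\<pi> \<in> paths n T" "?Q \<pi>"
    have "S \<pi> \<ge> 3 * C / (2 * c0) * real n * real T"
      using \<pi> length_paths[OF \<pi>(1)] by (auto simp: S_def C_def)
    then have "2 * c0 / real n * S \<pi> \<ge> 2 * c0 / real n * (3 * C / (2 * c0) * real n * real T)"
      using c0 by (intro mult_left_mono) auto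
    also have "2 * c0 / real n * (3 * C / (2 * c0) * real n * real T) = 3 * C * real T"
      using c0 by (simp add: field_simps)
    finally have "2 * c0 / real n * S \<pi> \<ge> 3 * C * real T" .
    moreover have "sqdev \<pi> \<ge> 0" by (simp add: sqdev_def sum_nonneg)
    ultimately have "sqdev \<pi> + 2 * c0 / real n * S \<pi> - 2 * C * real T \<ge> C * real T" by linarith
    then have "lam * (C * real T) \<le> lam * (sqdev \<pi> + 2 * c0 / real n * S \<pi> - 2 * C * real T)"
      using lam0 by (intro mult_left_mono) auto
    then show "exp (lam * C * real T) \<le> X \<pi>"
      using \<pi> length_paths[OF \<pi>(1)] by (simp add: X_def)
  qed (simp add: X_def)
  with E have "exp (lam * C * real T) * pr T ?Q \<le> 1" by linarith
  then have "pr T ?Q \<le> exp (- (lam * C * real T))"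
    by (simp add: exp_minus field_simps)
  also have "lam * C = (real wm)\<^sup>2 / (16 * R\<^sup>2)"
    using wm by (simp add: lam_def C_def R2_def power2_eq_square)
  finally show ?thesis by simp
qed

end

text \<open>Turns a relative gain \<open>d\<close> of a potential into decay of its power
  \<open>- s\<close>. For \<open>d \<le> 1\<close> the logarithm of \<open>1 + d\<close> is at least
  \<open>d / 2\<close>, and half of the resulting linear term is lost to the quadratic one, whence
  the 4.\<close>

lemma powr_minus_le_linear:
  fixes d s :: real
  assumes "0 \<le> d" "d \<le> 1" "0 \<le> s" "s * d \<le> 1"
  shows "(1 + d) powr (- s) \<le> 1 - s * d / 4"
proof -
  have "d / 2 \<le> d / (1 + d)" using assms by (intro divide_left_mono) auto
  also have "\<dots> = 1 - 1 / (1 + d)" using assms by (simp add: field_simps)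
  also have "\<dots> \<le> ln (1 + d)"
    using ln_le_minus_one[of "1 / (1 + d)"] assms by (simp add: ln_div)
  finally have "s * (d / 2) \<le> s * ln (1 + d)" using assms by (intro mult_left_mono) auto
  then have "(1 + d) powr (- s) \<le> exp (- (s * d / 2))"
    using assms by (simp add: powr_def)
  also have "\<dots> \<le> 1 + (- (s * d / 2)) + (- (s * d / 2))\<^sup>2"
    using assms by (intro exp_le_quadratic) auto
  also have "(- (s * d / 2))\<^sup>2 \<le> s * d / 4"
  proof -
    have "(s * d) * (s * d) \<le> (s * d) * 1" using assms by (intro mult_left_mono) auto
    then show ?thesis by (simp add: power2_eq_square)
  qed
  finally show ?thesis by (simp add: algebra_simps)
qed

section \<open>Overloaded bins that are not hit\<close>

context bins
begin

lemma ld_mono_Cons: "ld \<pi> i \<le> ld (j # \<pi>) i" by (simp add: ld_Cons)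

lemma ld_mono_stage:
  assumes "\<pi> \<in> paths n T" "s \<le> t" "t \<le> T"
  shows "ld (stage \<pi> s) i \<le> ld (stage \<pi> t) i"
  using assms(2,3)
proof (induction t rule: dec_induct)
  case (step t)
  from stage_Suc[OF assms(1), of t] step.prems obtain j where "stage \<pi> (Suc t) = j # stage \<pi> t"
    by auto
  then show ?case using step ld_mono_Cons[of "stage \<pi> t" i j] by (simp del: ld.simps)
qed auto

lemma card_deviating:
  assumes "c > 0" "absdev \<pi> \<le> D * real n"
  shows "real (card {j. j < n \<and> \<bar>y \<pi> j\<bar> > c}) \<le> D * real n / c"
proof -
  have "c * real (card {j. j < n \<and> \<bar>y \<pi> j\<bar> > c}) = (\<Sum>j\<in>{j. j < n \<and> \<bar>y \<pi> j\<bar> > c}. c)" by simp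
  also have "\<dots> \<le> (\<Sum>j\<in>{j. j < n \<and> \<bar>y \<pi> j\<bar> > c}. \<bar>y \<pi> j\<bar>)" by (intro sum_mono) auto
  also have "\<dots> \<le> absdev \<pi>" unfolding absdev_def by (intro sum_mono2) auto
  finally show ?thesis using assms by (simp add: field_simps)
qed

lemma sum_over_y: "(\<Sum>j\<in>over \<pi>. y \<pi> j) = absdev \<pi> / 2"
proof -
  let ?a = "\<Sum>j\<in>over \<pi>. y \<pi> j" and ?b = "\<Sum>j\<in>{..<n} - over \<pi>. y \<pi> j"
  have "?b + ?a = (\<Sum>j<n. y \<pi> j)"
    by (intro sum.subset_diff[symmetric] over_subset) auto
  moreover have "absdev \<pi> = (\<Sum>j\<in>{..<n} - over \<pi>. \<bar>y \<pi> j\<bar>) + (\<Sum>j\<in>over \<pi>. \<bar>y \<pi> j\<bar>)"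
    unfolding absdev_def by (intro sum.subset_diff over_subset) auto
  moreover have "(\<Sum>j\<in>{..<n} - over \<pi>. \<bar>y \<pi> j\<bar>) = - ?b"
    unfolding sum_negf[symmetric] by (intro sum.cong) (auto simp: over_def)
  moreover have "(\<Sum>j\<in>over \<pi>. \<bar>y \<pi> j\<bar>) = ?a"
    by (intro sum.cong) (auto simp: over_def)
  ultimately show ?thesis using sum_y[of \<pi>] by simp
qed

text \<open>Only hits while overloaded remove a bin: their probability is bounded by
  \<open>P_over\<close>, and a bin that has become underloaded has already served its
  purpose.\<close>

definition spared :: "nat \<Rightarrow> real \<Rightarrow> nat list \<Rightarrow> nat set" where
  "spared t0 D \<pi> = {j \<in> over (stage \<pi> t0). y (stage \<pi> t0) j \<le> 2 * D \<and>
     (\<forall>t\<in>{t0..<length \<pi>}. stage \<pi> (Suc t) = j # stage \<pi> t \<longrightarrow> j \<notin> over (stage \<pi> t))}"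

lemma finite_spared [simp]: "finite (spared t0 D \<pi>)" by (simp add: spared_def)

lemma spared_Cons:
  assumes "t0 \<le> length \<pi>"
  shows "spared t0 D (j # \<pi>) = spared t0 D \<pi> - ({j} \<inter> over \<pi>)"
proof -
  have "stage (j # \<pi>) (Suc (length \<pi>)) = j # \<pi>" using stage_length[of "j # \<pi>"] by simp
  moreover have "{t0..<length (j # \<pi>)} = insert (length \<pi>) {t0..<length \<pi>}"
    using assms by auto
  moreover have "(\<forall>t\<in>{t0..<length \<pi>}. stage (j # \<pi>) (Suc t) = i # stage (j # \<pi>) t \<longrightarrow> i \<notin> over (stage (j # \<pi>) t))
      \<longleftrightarrow> (\<forall>t\<in>{t0..<length \<pi>}. stage \<pi> (Suc t) = i # stage \<pi> t \<longrightarrow> i \<notin> over (stage \<pi> t))" for i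
    by (intro ball_cong) auto
  ultimately show ?thesis using assms by (auto simp: spared_def)
qed

text \<open>The nonnegative normalized loads add up to half of \<open>absdev\<close>, hence to at
  most \<open>D * n / 2\<close>. So at most n / 4 of the at least n / 2 overloaded bins lie above
  \<open>2 * D\<close>.\<close>

lemma card_spared_start:
  assumes "absdev \<pi> \<le> D * real n" "delta \<pi> \<ge> 1 / 2" "D > 0"
  shows "real n / 4 \<le> real (card (spared (length \<pi>) D \<pi>))"
proof -
  let ?A = "{j \<in> over \<pi>. y \<pi> j > 2 * D}"
  have "2 * D * real (card ?A) = (\<Sum>j\<in>?A. 2 * D)" by simp
  also have "\<dots> \<le> (\<Sum>j\<in>?A. y \<pi> j)" by (intro sum_mono) auto
  also have "\<dots> \<le> (\<Sum>j\<in>over \<pi>. y \<pi> j)" by (intro sum_mono2) (auto simp: over_def)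
  also have "\<dots> \<le> D * real n / 2" using assms by (simp add: sum_over_y)
  finally have "D * (2 * real (card ?A)) \<le> D * (real n / 2)" by simp
  then have A: "real (card ?A) \<le> real n / 4" using assms(3) by (subst (asm) mult_le_cancel_left_pos) auto
  have "over \<pi> = ?A \<union> spared (length \<pi>) D \<pi>" by (auto simp: spared_def)
  then have "card (over \<pi>) \<le> card ?A + card (spared (length \<pi>) D \<pi>)"
    by (metis card_Un_le)
  moreover have "real (card (over \<pi>)) \<ge> real n / 2"
    using assms(2) by (simp add: delta_def field_simps)
  ultimately show ?thesis using A by linarith
qed

end

context alloc_tree
begin

text \<open>Losing one of \<open>R\<close> bins multiplies \<open>R powr (- s)\<close> by at most
  \<open>1 + 4 * s / R\<close>, and at most \<open>R\<close> bins are at risk, each with probability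
  at most \<open>k1 / n\<close>. The count cancels, leaving the factor
  \<open>1 + 4 * s * k1 / n\<close> per round. The start contributes
  \<open>(n / 4) powr (- s)\<close> and the end \<open>(\<rho> * n) powr (- s)\<close>, whence the
  logarithm of \<open>4 * \<rho>\<close>.\<close>

lemma pr_few_spared:
  assumes D: "D > 0" and rho: "0 < \<rho>" "\<rho> * real n \<ge> 2"
  shows "pr (t0 + k) (\<lambda>\<pi>. absdev (stage \<pi> t0) \<le> D * real n \<and> delta (stage \<pi> t0) \<ge> 1 / 2 \<and>
      real (card (spared t0 D \<pi>)) \<le> \<rho> * real n)
    \<le> exp (\<rho> / 4 * (real n * ln (4 * \<rho>) + 4 * k1 * real k))"
proof -
  \<comment> \<open>Proportional to n, for an exponentially small failure probability, yet small
    enough that \<open>s / (R - 1) \<le> 1\<close> as long as more than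
    \<open>\<rho> * n \<ge> 2\<close> bins are left.\<close>
  define s where "s = \<rho> * real n / 4"
  define Q where "Q \<pi> \<longleftrightarrow> absdev (stage \<pi> t0) \<le> D * real n \<and> delta (stage \<pi> t0) \<ge> 1 / 2" for \<pi>
  define R where "R \<pi> = real (card (spared t0 D \<pi>))" for \<pi>
  \<comment> \<open>The truncation also avoids count 0, where \<open>powr\<close> would return 0
    instead of a large value.\<close>
  define X where "X \<pi> = of_bool (Q \<pi>) * max (R \<pi>) (\<rho> * real n) powr (- s)" for \<pi>
  have s0: "s > 0" using rho by (simp add: s_def)
  have "Ex (t0 + k) X \<le> exp (\<rho> * k1) ^ (t0 + k - t0) * Ex t0 X"
  proof (rule Ex_decay)
    fix t \<pi> assume t: "t0 \<le> t" and \<pi>: "\<pi> \<in> paths n t"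
    have len: "t0 \<le> length \<pi>" using t length_paths[OF \<pi>] by simp
    have X0: "X \<pi> \<ge> 0" by (simp add: X_def)
    have Q: "Q (j # \<pi>) = Q \<pi>" for j using len by (simp add: Q_def)
    let ?K = "spared t0 D \<pi> \<inter> over \<pi>"
    have Xj: "X (j # \<pi>) \<le> X \<pi> * (1 + of_bool (j \<in> ?K) * (4 * s / R \<pi>))" for j
    proof (cases "j \<in> ?K")
      case False
      then have "spared t0 D (j # \<pi>) = spared t0 D \<pi>" using len by (auto simp: spared_Cons)
      then have "X (j # \<pi>) = X \<pi>" by (simp add: X_def Q R_def)
      then show ?thesis using False by auto
    next
      case True
      then have "spared t0 D (j # \<pi>) = spared t0 D \<pi> - {j}" using len by (auto simp: spared_Cons)
      moreover have "card (spared t0 D \<pi>) \<ge> 1"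
        using True by (metis IntD1 One_nat_def Suc_leI card_gt_0_iff empty_iff finite_spared)
      ultimately have R: "R (j # \<pi>) = R \<pi> - 1" "R \<pi> \<ge> 1" using True by (auto simp: R_def)
      show ?thesis
      proof (cases "R \<pi> \<le> \<rho> * real n")
        case True
        then have "X (j # \<pi>) = X \<pi>" using R by (simp add: X_def Q max_def)
        then show ?thesis using X0 s0 R by (auto simp: distrib_left)
      next
        case False
        then have Rn: "R \<pi> > \<rho> * real n" "R \<pi> > 2" using rho by auto
        let ?u = "s / (R \<pi> - 1)"
        have u: "0 \<le> ?u" "?u \<le> 1" using Rn rho s0 by (auto simp: s_def divide_le_eq)
        have u2: "?u \<le> 2 * s / R \<pi>" using Rn s0 by (simp add: field_simps)
        have "max (R \<pi> - 1) (\<rho> * real n) powr (- s) \<le> (R \<pi> - 1) powr (- s)"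
          using s0 Rn by (intro powr_mono2') auto
        also have "\<dots> = R \<pi> powr (- s) * exp (s * ln (1 + 1 / (R \<pi> - 1)))"
        proof -
          have "1 + 1 / (R \<pi> - 1) = R \<pi> / (R \<pi> - 1)" using Rn by (simp add: field_simps)
          then have L: "ln (1 + 1 / (R \<pi> - 1)) = ln (R \<pi>) - ln (R \<pi> - 1)" using Rn by (simp add: ln_div)
          show ?thesis
            unfolding L using Rn by (simp add: powr_def exp_add[symmetric] algebra_simps)
        qed
        also have "\<dots> \<le> R \<pi> powr (- s) * exp ?u"
        proof -
          have "s * ln (1 + 1 / (R \<pi> - 1)) \<le> s * (1 / (R \<pi> - 1))"
            using s0 Rn by (intro mult_left_mono ln_add_one_self_le_self) auto
          then show ?thesis by (intro mult_left_mono) auto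
        qed
        also have "\<dots> \<le> R \<pi> powr (- s) * (1 + 4 * s / R \<pi>)"
        proof (rule mult_left_mono)
          have "exp ?u \<le> 1 + ?u + ?u\<^sup>2" using u by (intro exp_le_quadratic) linarith
          also have "?u\<^sup>2 \<le> ?u" using mult_left_le[OF u(2,1)] by (simp only: power2_eq_square)
          finally show "exp ?u \<le> 1 + 4 * s / R \<pi>" using u2 by simp
        qed simp
        finally have "max (R \<pi> - 1) (\<rho> * real n) powr (- s) \<le> R \<pi> powr (- s) * (1 + 4 * s / R \<pi>)" .
        moreover have "X (j # \<pi>) = of_bool (Q \<pi>) * max (R \<pi> - 1) (\<rho> * real n) powr (- s)"
          using R by (simp add: X_def Q)
        moreover have "X \<pi> = of_bool (Q \<pi>) * R \<pi> powr (- s)"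
          using Rn by (simp add: X_def max_def)
        ultimately show ?thesis using True by auto
      qed
    qed
    have "(\<Sum>j<n. P (j # \<pi>) * X (j # \<pi>))
        \<le> (\<Sum>j<n. P (j # \<pi>) * (X \<pi> * (1 + of_bool (j \<in> ?K) * (4 * s / R \<pi>))))"
      by (intro sum_mono mult_left_mono Xj P_nonneg)
    also have "\<dots> = X \<pi> * (\<Sum>j<n. P (j # \<pi>)) + X \<pi> * (4 * s / R \<pi>) * (\<Sum>j<n. P (j # \<pi>) * of_bool (j \<in> ?K))"
      unfolding sum_distrib_left sum.distrib[symmetric]
      by (intro sum.cong) (auto simp: algebra_simps)
    finally have total: "(\<Sum>j<n. P (j # \<pi>) * X (j # \<pi>))
        \<le> X \<pi> * P \<pi> + X \<pi> * (4 * s / R \<pi>) * (\<Sum>j<n. P (j # \<pi>) * of_bool (j \<in> ?K))"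
      by (simp only: P_sum[OF \<pi>])
    have "(\<Sum>j<n. P (j # \<pi>) * of_bool (j \<in> ?K)) = (\<Sum>j\<in>?K. P (j # \<pi>))"
      using over_subset[of \<pi>] by (intro sum.mono_neutral_cong_right) auto
    also have "\<dots> \<le> (\<Sum>j\<in>?K. k1 / real n * P \<pi>)"
      by (intro sum_mono P_over[OF \<pi>]) auto
    also have "\<dots> = real (card ?K) * (k1 / real n * P \<pi>)" by simp
    also have "\<dots> \<le> R \<pi> * (k1 / real n * P \<pi>)"
      using k1 P_nonneg by (intro mult_right_mono) (auto simp: R_def intro!: card_mono)
    finally have "X \<pi> * (4 * s / R \<pi>) * (\<Sum>j<n. P (j # \<pi>) * of_bool (j \<in> ?K))
        \<le> X \<pi> * (4 * s / R \<pi>) * (R \<pi> * (k1 / real n * P \<pi>))"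
      using X0 s0 by (intro mult_left_mono) (auto simp: R_def)
    with total have "(\<Sum>j<n. P (j # \<pi>) * X (j # \<pi>))
        \<le> X \<pi> * P \<pi> + X \<pi> * (4 * s / R \<pi>) * (R \<pi> * (k1 / real n * P \<pi>))" by linarith
    \<comment> \<open>The count \<open>R \<pi>\<close> cancels; if it is 0, the second summand on
      the left is 0.\<close>
    also have "\<dots> \<le> X \<pi> * P \<pi> + X \<pi> * (4 * s * k1 / real n * P \<pi>)"
      using X0 s0 k1 P_nonneg[of \<pi>] by (cases "R \<pi> = 0") auto
    also have "\<dots> = P \<pi> * ((1 + \<rho> * k1) * X \<pi>)"
      by (simp add: s_def field_simps)
    also have "\<dots> \<le> P \<pi> * (exp (\<rho> * k1) * X \<pi>)"
      using X0 P_nonneg by (intro mult_left_mono mult_right_mono exp_ge_add_one_self) auto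
    finally show "(\<Sum>j<n. P (j # \<pi>) * X (j # \<pi>)) \<le> P \<pi> * (exp (\<rho> * k1) * X \<pi>)" .
  qed auto
  also have "exp (\<rho> * k1) ^ (t0 + k - t0) = exp (\<rho> * k1 * real k)"
    by (simp add: exp_of_nat_mult[symmetric] mult.commute)
  also have "Ex t0 X \<le> Ex t0 (\<lambda>_. (real n / 4) powr (- s))"
  proof (rule Ex_mono)
    fix \<pi> assume \<pi>: "\<pi> \<in> paths n t0"
    show "X \<pi> \<le> (real n / 4) powr (- s)"
    proof (cases "Q \<pi>")
      case True
      then have "real n / 4 \<le> R \<pi>"
        using card_spared_start[of \<pi> D] D length_paths[OF \<pi>] by (auto simp: Q_def R_def)
      then show ?thesis using True s0 by (auto simp: X_def intro!: powr_mono2')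
    qed (simp add: X_def)
  qed
  also have "\<dots> = (real n / 4) powr (- s)" by (rule Ex_const)
  finally have E: "Ex (t0 + k) X \<le> exp (\<rho> * k1 * real k) * (real n / 4) powr (- s)" by simp
  let ?Q = "\<lambda>\<pi>. absdev (stage \<pi> t0) \<le> D * real n \<and> delta (stage \<pi> t0) \<ge> 1 / 2 \<and>
      real (card (spared t0 D \<pi>)) \<le> \<rho> * real n"
  have "(\<rho> * real n) powr (- s) * pr (t0 + k) ?Q \<le> Ex (t0 + k) X"
    by (rule pr_markov) (auto simp: X_def Q_def R_def max_def)
  with E have "pr (t0 + k) ?Q \<le> exp (\<rho> * k1 * real k) * (real n / 4) powr (- s) / (\<rho> * real n) powr (- s)"
    using rho by (simp add: pos_le_divide_eq mult.commute)
  also have "\<dots> = exp (\<rho> * k1 * real k + s * (ln (\<rho> * real n) - ln (real n / 4)))"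
    using rho by (simp add: powr_def exp_add[symmetric] exp_diff[symmetric] algebra_simps)
  also have "ln (\<rho> * real n) - ln (real n / 4) = ln (4 * \<rho>)"
    using rho by (simp add: ln_mult ln_div)
  also have "\<rho> * k1 * real k + s * ln (4 * \<rho>) = \<rho> / 4 * (real n * ln (4 * \<rho>) + 4 * k1 * real k)"
    by (simp add: s_def algebra_simps)
  finally show ?thesis .
qed

end

section \<open>Few overloaded bins do not persist\<close>

context alloc_tree
begin

text \<open>The weight \<open>u j\<close> below grows at least by the factor \<open>B\<close> with every hit of an underloaded bin, as the
  average load rises by at most 1/2 during the \<open>k\<close> rounds. If the overloaded bins stayed few, the total
  weight would exceed \<open>n\<close>.\<close>

lemma pr_stay_low:
  assumes B: "B > 1" and D: "D > 0"
    and zeta: "\<zeta> = B powr (- 2 * (2 * D + 1)) / 2" "\<zeta> * real n \<ge> 1"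
    and eps: "\<epsilon> \<le> \<zeta> / 2" and k: "real wm * real k \<le> real n / 2"
  shows "pr (t1 + k) (\<lambda>\<pi>. absdev (stage \<pi> t1) \<le> D * real n \<and>
      (\<forall>t\<in>{t1..<t1 + k}. delta (stage \<pi> t) < \<epsilon>))
    \<le> exp (\<zeta> * (real n * ln (1 / \<zeta>) - k2 * (B - 1) * real k / 8))"
proof -
  \<comment> \<open>This is also the lower bound for \<open>Z\<close> (\<open>Z_ge\<close>); as one
    weight gains at most 1, it makes \<open>s * d j \<le> 1\<close>.\<close>
  define s where "s = \<zeta> * real n"
  define a where "a \<sigma> = real (tot \<sigma>) / real n" for \<sigma>
  \<comment> \<open>The weight is capped at 1 once the load exceeds the initial average by 1, so
    \<open>Z \<le> n\<close>. The factor 2 in the exponent makes a gain of half a unit worth a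
    factor \<open>B\<close>.\<close>
  define u where "u \<pi> j = B powr (- 2 * max 0 (a (stage \<pi> t1) + 1 - real (ld \<pi> j)))" for \<pi> j
  define Z where "Z \<pi> = (\<Sum>j<n. u \<pi> j)" for \<pi>
  define Q where "Q \<pi> \<longleftrightarrow> absdev (stage \<pi> t1) \<le> D * real n \<and>
      (\<forall>t\<in>{t1..<length \<pi>}. delta (stage \<pi> t) < \<epsilon>)" for \<pi>
  define X where "X \<pi> = of_bool (Q \<pi>) * Z \<pi> powr (- s)" for \<pi>
  \<comment> \<open>Probability at least \<open>k2 / n\<close> per underloaded bin, relative gain
    \<open>B - 1\<close>, and half of the total weight on underloaded bins.\<close>
  define r where "r = k2 * (B - 1) / 2"
  have zeta0: "\<zeta> > 0" unfolding zeta(1) using B by simp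
  have s1: "s \<ge> 1" using zeta by (simp add: s_def)
  have u01: "0 < u \<pi> j" "u \<pi> j \<le> 1" for \<pi> j
  proof -
    have "u \<pi> j \<le> B powr 0" unfolding u_def using B by (intro powr_mono) auto
    then show "0 < u \<pi> j" "u \<pi> j \<le> 1" using B by (auto simp: u_def)
  qed
  \<comment> \<open>At least n / 2 bins are at most \<open>2 * D\<close> below the average; each has
    weight at least \<open>2 * \<zeta>\<close>.\<close>
  have Z_start: "Z \<pi> \<ge> s" if \<pi>: "\<pi> \<in> paths n t1" "absdev \<pi> \<le> D * real n" for \<pi>
  proof -
    let ?A = "{j. j < n \<and> \<bar>y \<pi> j\<bar> > 2 * D}"
    have "real (card ?A) \<le> D * real n / (2 * D)"
      using that D by (intro card_deviating) auto
    then have "real (card ?A) \<le> real n / 2" using D by simp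
    moreover have "card ({..<n} - ?A) = n - card ?A" by (subst card_Diff_subset) auto
    moreover have "card ?A \<le> n" using card_mono[of "{..<n}" ?A] by auto
    ultimately have c: "real (card ({..<n} - ?A)) \<ge> real n / 2" by simp
    have "s = real n / 2 * (2 * \<zeta>)" by (simp add: s_def)
    also have "\<dots> \<le> real (card ({..<n} - ?A)) * (2 * \<zeta>)"
      using c zeta0 by (intro mult_right_mono) auto
    also have "\<dots> = (\<Sum>j\<in>{..<n} - ?A. 2 * \<zeta>)" by simp
    also have "\<dots> \<le> (\<Sum>j\<in>{..<n} - ?A. u \<pi> j)"
    proof (rule sum_mono)
      fix j assume "j \<in> {..<n} - ?A"
      then have "y \<pi> j \<ge> - 2 * D" by auto
      then have "max 0 (a \<pi> + 1 - real (ld \<pi> j)) \<le> 2 * D + 1"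
        using D by (simp add: a_def y_def)
      then have "B powr (- 2 * (2 * D + 1)) \<le> u \<pi> j"
        using B mult_left_mono_neg[of "max 0 (a \<pi> + 1 - real (ld \<pi> j))" "2 * D + 1" "- 2"]
        unfolding u_def length_paths[OF \<pi>(1), symmetric] stage_length
        by (intro powr_mono) simp_all
      then show "2 * \<zeta> \<le> u \<pi> j" by (simp add: zeta)
    qed
    also have "\<dots> \<le> Z \<pi>" unfolding Z_def using u01(1) by (intro sum_mono2) (auto intro: less_imp_le)
    finally show ?thesis .
  qed
  have Z_ge: "Z \<pi> \<ge> s" if \<pi>: "\<pi> \<in> paths n t" "t1 \<le> t" "Q \<pi>" for \<pi> t
  proof -
    have st: "stage \<pi> t1 \<in> paths n t1" using \<pi> by (intro stage_paths) auto
    have "s \<le> Z (stage \<pi> t1)" using \<pi> st by (intro Z_start) (auto simp: Q_def)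
    also have "\<dots> \<le> Z \<pi>"
      unfolding Z_def
    proof (rule sum_mono)
      fix j
      have "ld (stage \<pi> t1) j \<le> ld (stage \<pi> t) j" using \<pi> by (intro ld_mono_stage) auto
      then have "ld (stage \<pi> t1) j \<le> ld \<pi> j" using length_paths[OF \<pi>(1)] by auto
      moreover have "stage (stage \<pi> t1) t1 = stage \<pi> t1"
        using \<pi> length_paths[OF \<pi>(1)] by (intro stage_stage) auto
      ultimately show "u (stage \<pi> t1) j \<le> u \<pi> j"
        using B unfolding u_def by (intro powr_mono) auto
    qed
    finally show ?thesis .
  qed
  have "Ex (t1 + k) X \<le> exp (- \<zeta> * r / 4) ^ (t1 + k - t1) * Ex t1 X"
  proof (rule Ex_decay)
    fix t \<pi> assume t: "t1 \<le> t" "t < t1 + k" and \<pi>: "\<pi> \<in> paths n t"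
    have len: "length \<pi> = t" using length_paths[OF \<pi>] .
    show "(\<Sum>j<n. P (j # \<pi>) * X (j # \<pi>)) \<le> P \<pi> * (exp (- \<zeta> * r / 4) * X \<pi>)"
    proof (cases "Q \<pi> \<and> delta \<pi> < \<epsilon>")
      case False
      have "X (j # \<pi>) = 0" for j
      proof -
        have "\<not> Q (j # \<pi>)"
        proof
          assume "Q (j # \<pi>)"
          then have "absdev (stage \<pi> t1) \<le> D * real n" "\<And>t'. t1 \<le> t' \<Longrightarrow> t' \<le> t \<Longrightarrow> delta (stage \<pi> t') < \<epsilon>"
            using t len by (auto simp: Q_def)
          moreover from this(2)[of t] have "delta \<pi> < \<epsilon>" using t len by auto
          ultimately show False using False t len by (auto simp: Q_def)
        qed
        then show ?thesis by (simp add: X_def)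
      qed
      then have "(\<Sum>j<n. P (j # \<pi>) * X (j # \<pi>)) = 0" by simp
      then show ?thesis using P_nonneg[of \<pi>] by (simp add: X_def)
    next
      case True
      have Zs: "Z \<pi> \<ge> s" using True \<pi> t by (intro Z_ge) auto
      then have Z0: "Z \<pi> > 0" using s1 by simp
      define d where "d j = (u (j # \<pi>) j - u \<pi> j) / Z \<pi>" for j
      have u_mono: "u \<pi> i \<le> u (j # \<pi>) i" for i j
        using B t len ld_mono_Cons[of \<pi> i j] unfolding u_def by (intro powr_mono) auto
      have d0: "0 \<le> d j" for j using u_mono[of j j] Z0 by (simp add: d_def)
      have sd: "s * d j \<le> 1" for j
      proof -
        have "u (j # \<pi>) j - u \<pi> j \<le> 1" using u01(2)[of "j # \<pi>" j] u01(1)[of \<pi> j] by linarith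
        then have "s * (u (j # \<pi>) j - u \<pi> j) \<le> Z \<pi> * 1"
          using Zs s1 Z0 u_mono[of j j] by (intro mult_mono) auto
        then show ?thesis using Z0 by (simp add: d_def)
      qed
      have d1: "d j \<le> 1" for j
        using mult_right_mono[OF s1 d0[of j]] sd[of j] by simp
      have Zj: "Z (j # \<pi>) \<ge> Z \<pi> * (1 + d j)" if "j < n" for j
      proof -
        have "Z \<pi> * (1 + d j) = (\<Sum>i<n. u \<pi> i + (if i = j then u (j # \<pi>) j - u \<pi> j else 0))"
          using that Z0 by (simp add: sum.distrib Z_def[symmetric] d_def distrib_left)
        also have "\<dots> \<le> Z (j # \<pi>)"
          unfolding Z_def using u_mono by (intro sum_mono) auto
        finally show ?thesis .
      qed
      have Xj: "X (j # \<pi>) \<le> X \<pi> * (1 - s * d j / 4)" if "j < n" for j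
      proof -
        have "X (j # \<pi>) \<le> Z (j # \<pi>) powr (- s)" by (simp add: X_def)
        also have "\<dots> \<le> (Z \<pi> * (1 + d j)) powr (- s)"
          using Zj[OF that] Z0 d0[of j] s1 by (intro powr_mono2') (auto intro!: mult_pos_pos)
        also have "\<dots> = Z \<pi> powr (- s) * (1 + d j) powr (- s)"
          by (rule powr_mult)
        also have "\<dots> \<le> Z \<pi> powr (- s) * (1 - s * d j / 4)"
          using d0 d1 sd s1 by (intro mult_left_mono powr_minus_le_linear) auto
        finally show ?thesis using True by (simp add: X_def)
      qed
      \<comment> \<open>An underloaded bin lies below the current average, hence below the initial
        one plus 1/2. The distance to the cap thus exceeds 1/2 and drops by at least 1/2 with a hit,
        even if the load jumps past the cap.\<close>
      have gain: "(B - 1) * u \<pi> j / Z \<pi> \<le> d j" if j: "j < n" "j \<notin> over \<pi>" for j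
      proof -
        have "tot (stage \<pi> t) \<le> tot (stage \<pi> t1) + wm * (t - t1)"
          by (rule tot_stage_diff(2)[OF \<pi>]) (use t in auto)
        then have "real (tot \<pi>) \<le> real (tot (stage \<pi> t1)) + real wm * real (t - t1)"
          using len by (metis of_nat_add of_nat_le_iff of_nat_mult stage_length)
        also have "real wm * real (t - t1) \<le> real wm * real k"
          using t by (intro mult_left_mono) auto
        also have "\<dots> \<le> real n / 2" by (rule k)
        finally have "real (tot \<pi>) / real n \<le> (real (tot (stage \<pi> t1)) + real n / 2) / real n"
          by (intro divide_right_mono) auto
        then have "real (tot \<pi>) / real n \<le> a (stage \<pi> t1) + 1 / 2"
          by (simp add: a_def add_divide_distrib)
        moreover have "y \<pi> j < 0" using j by (auto simp: over_def)
        ultimately have x: "real (ld \<pi> j) < a (stage \<pi> t1) + 1 / 2" by (simp add: y_def)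
        moreover have "real (ld (j # \<pi>) j) \<ge> real (ld \<pi> j) + 1"
          using wgt_bounds(1)[of \<pi> j] by (simp add: ld_Cons)
        moreover define m where "m = max 0 (a (stage \<pi> t1) + 1 - real (ld \<pi> j))"
        moreover define m' where "m' = max 0 (a (stage \<pi> t1) + 1 - real (ld (j # \<pi>) j))"
        ultimately have "m' \<le> m - 1 / 2" by (auto simp: max_def)
        then have "B powr (1 + - 2 * m) \<le> B powr (- 2 * m')"
          using B by (intro powr_mono) auto
        moreover have "u (j # \<pi>) j = B powr (- 2 * m')" "u \<pi> j = B powr (- 2 * m)"
          using t len by (simp_all add: u_def m_def m'_def)
        ultimately have "B * u \<pi> j \<le> u (j # \<pi>) j" using B by (simp only: powr_add) simp
        then show ?thesis using Z0 unfolding d_def by (intro divide_right_mono) (auto simp: algebra_simps)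
      qed
      \<comment> \<open>Weights are at most 1, so fewer than \<open>\<epsilon> * n\<close>
        overloaded bins carry at most half of \<open>Z\<close>.\<close>
      have over_small: "real (card (over \<pi>)) \<le> Z \<pi> / 2"
      proof -
        have "real (card (over \<pi>)) \<le> \<epsilon> * real n"
          using True by (simp add: delta_def divide_less_eq)
        also have "\<dots> \<le> \<zeta> / 2 * real n" using eps by (intro mult_right_mono) auto
        finally show ?thesis using Zs by (simp add: s_def)
      qed
      have under: "(\<Sum>j\<in>{..<n} - over \<pi>. u \<pi> j) \<ge> Z \<pi> / 2"
      proof -
        have "(\<Sum>j\<in>over \<pi>. u \<pi> j) \<le> (\<Sum>j\<in>over \<pi>. 1)" by (intro sum_mono u01)
        then have "(\<Sum>j\<in>over \<pi>. u \<pi> j) \<le> Z \<pi> / 2" using over_small by simp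
        moreover have "Z \<pi> = (\<Sum>j\<in>{..<n} - over \<pi>. u \<pi> j) + (\<Sum>j\<in>over \<pi>. u \<pi> j)"
          unfolding Z_def by (intro sum.subset_diff over_subset) auto
        ultimately show ?thesis by linarith
      qed
      have "P \<pi> * (r / real n) = k2 / real n * P \<pi> * ((B - 1) / Z \<pi>) * (Z \<pi> / 2)"
        using Z0 by (simp add: r_def field_simps)
      also have "\<dots> \<le> k2 / real n * P \<pi> * ((B - 1) / Z \<pi>) * (\<Sum>j\<in>{..<n} - over \<pi>. u \<pi> j)"
        using under k2 B Z0 P_nonneg by (intro mult_left_mono) auto
      also have "\<dots> = (\<Sum>j\<in>{..<n} - over \<pi>. k2 / real n * P \<pi> * ((B - 1) * u \<pi> j / Z \<pi>))"
        unfolding sum_distrib_left by (intro sum.cong) auto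
      also have "\<dots> \<le> (\<Sum>j\<in>{..<n} - over \<pi>. P (j # \<pi>) * d j)"
        using P_under[OF \<pi>] gain k2 B Z0 P_nonneg u01(1)
        by (intro sum_mono mult_mono) (auto intro!: divide_nonneg_pos mult_nonneg_nonneg less_imp_le[OF u01(1)])
      also have "\<dots> \<le> (\<Sum>j<n. P (j # \<pi>) * d j)"
        using d0 P_nonneg by (intro sum_mono2) auto
      finally have drift: "P \<pi> * (r / real n) \<le> (\<Sum>j<n. P (j # \<pi>) * d j)" .
      have "(\<Sum>j<n. P (j # \<pi>) * X (j # \<pi>)) \<le> (\<Sum>j<n. P (j # \<pi>) * (X \<pi> * (1 - s * d j / 4)))"
        by (intro sum_mono mult_left_mono Xj P_nonneg) auto
      also have "\<dots> = X \<pi> * ((\<Sum>j<n. P (j # \<pi>)) - s / 4 * (\<Sum>j<n. P (j # \<pi>) * d j))"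
        unfolding sum_distrib_left sum_subtractf[symmetric]
        by (intro sum.cong) (auto simp: algebra_simps)
      also have "\<dots> \<le> X \<pi> * (P \<pi> - s / 4 * (P \<pi> * (r / real n)))"
        unfolding P_sum[OF \<pi>] using drift s1
        by (intro mult_left_mono diff_mono) (auto simp: X_def)
      also have "\<dots> = X \<pi> * P \<pi> * (1 + (- \<zeta> * r / 4))"
        by (simp add: s_def field_simps)
      also have "\<dots> \<le> X \<pi> * P \<pi> * exp (- \<zeta> * r / 4)"
        using P_nonneg by (intro mult_left_mono exp_ge_add_one_self) (auto simp: X_def)
      finally show ?thesis by (simp add: mult.commute mult.left_commute)
    qed
  qed auto
  also have "exp (- \<zeta> * r / 4) ^ (t1 + k - t1) = exp (- \<zeta> * r * real k / 4)"
    by (simp add: exp_of_nat_mult[symmetric] mult.commute)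
  also have "Ex t1 X \<le> Ex t1 (\<lambda>_. s powr (- s))"
  proof (rule Ex_mono)
    fix \<pi> assume \<pi>: "\<pi> \<in> paths n t1"
    have "Z \<pi> \<ge> s" if "Q \<pi>" using \<pi> that by (intro Z_ge) auto
    then show "X \<pi> \<le> s powr (- s)" using s1 by (auto simp: X_def intro!: powr_mono2')
  qed
  also have "\<dots> = s powr (- s)" by (rule Ex_const)
  finally have E: "Ex (t1 + k) X \<le> exp (- \<zeta> * r * real k / 4) * s powr (- s)" by simp
  let ?Q = "\<lambda>\<pi>. absdev (stage \<pi> t1) \<le> D * real n \<and> (\<forall>t\<in>{t1..<t1 + k}. delta (stage \<pi> t) < \<epsilon>)"
  have "real n powr (- s) * pr (t1 + k) ?Q \<le> Ex (t1 + k) X"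
  proof (rule pr_markov)
    fix \<pi> assume \<pi>: "\<pi> \<in> paths n (t1 + k)" "?Q \<pi>"
    then have Q: "Q \<pi>" by (auto simp: Q_def length_paths)
    have "Z \<pi> \<le> (\<Sum>j<n. 1)" unfolding Z_def by (intro sum_mono u01)
    moreover have "Z \<pi> \<ge> s" using \<pi> Q by (intro Z_ge) auto
    ultimately show "real n powr (- s) \<le> X \<pi>"
      using s1 Q by (auto simp: X_def intro!: powr_mono2')
  qed (simp add: X_def)
  with E have "pr (t1 + k) ?Q \<le> exp (- \<zeta> * r * real k / 4) * s powr (- s) / real n powr (- s)"
    by (simp add: pos_le_divide_eq mult.commute)
  also have "\<dots> = exp (- \<zeta> * r * real k / 4 + s * (ln (real n) - ln s))"
    using s1 by (simp add: powr_def exp_add[symmetric] exp_diff[symmetric] algebra_simps)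
  also have "ln (real n) - ln s = ln (1 / \<zeta>)"
    using zeta0 by (simp add: s_def ln_mult ln_div)
  also have "- \<zeta> * r * real k / 4 + s * ln (1 / \<zeta>)
      = \<zeta> * (real n * ln (1 / \<zeta>) - k2 * (B - 1) * real k / 8)"
    by (simp add: s_def r_def field_simps)
  finally show ?thesis .
qed

text \<open>While all loads are below \<open>H\<close>, the sum \<open>Z\<close> of
  \<open>B powr load\<close> lies between n and \<open>n * B powr H\<close>, and a round in
  \<open>G\<close> raises it on average by the factor \<open>1 + k5 * (B - 1) / n\<close> at least.
  In other rounds only monotonicity of \<open>Z\<close> is used. The second assumption on
  \<open>s\<close> keeps relative increments small enough for
  \<open>powr_minus_le_linear\<close>.\<close>

lemma pr_loads_small:
  assumes B: "B > 1" and s: "s \<ge> 1" "s * ((B - 1) * B powr H / real n) \<le> 1" and k5: "0 \<le> k5"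
    and good: "\<And>t \<pi> j. \<pi> \<in> paths n t \<Longrightarrow> G \<pi> \<Longrightarrow> j < n \<Longrightarrow> P (j # \<pi>) \<ge> k5 / real n * P \<pi>"
  shows "pr T (\<lambda>\<pi>. (\<forall>j<n. real (ld \<pi> j) < H) \<and> real (card {t. t < T \<and> G (stage \<pi> t)}) \<ge> g)
    \<le> exp (s * (H * ln B - k5 * (B - 1) * g / (4 * real n)))"
proof -
  define u where "u \<pi> j = B powr real (ld \<pi> j)" for \<pi> j
  define Z where "Z \<pi> = (\<Sum>j<n. u \<pi> j)" for \<pi>
  define Q where "Q \<pi> \<longleftrightarrow> (\<forall>j<n. real (ld \<pi> j) < H)" for \<pi>
  \<comment> \<open>Decay rate of \<open>Z powr (- s)\<close> in a round of \<open>G\<close>.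
    Multiplying by \<open>exp (c * N)\<close> offsets it, so that \<open>X\<close> is a
    supermartingale through all rounds.\<close>
  define c where "c = s * k5 * (B - 1) / (4 * real n)"
  define N where "N \<pi> = real (card {t. t < length \<pi> \<and> G (stage \<pi> t)})" for \<pi>
  define X where "X \<pi> = of_bool (Q \<pi>) * (Z \<pi> powr (- s) * exp (c * N \<pi>))" for \<pi>
  have c0: "c \<ge> 0" using B s k5 by (simp add: c_def)
  have u1: "1 \<le> u \<pi> j" for \<pi> j using B by (simp add: u_def ge_one_powr_ge_zero)
  have Zn: "Z \<pi> \<ge> real n" for \<pi>
  proof -
    have "(\<Sum>j<n. 1) \<le> Z \<pi>" unfolding Z_def by (intro sum_mono u1)
    then show ?thesis by simp
  qed
  have "Ex T X \<le> 1 ^ (T - 0) * Ex 0 X"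
  proof (rule Ex_decay)
    fix t \<pi> assume \<pi>: "\<pi> \<in> paths n t"
    show "(\<Sum>j<n. P (j # \<pi>) * X (j # \<pi>)) \<le> P \<pi> * (1 * X \<pi>)"
    proof (cases "Q \<pi>")
      case False
      have "\<not> Q (j # \<pi>)" for j
      proof -
        obtain i where "i < n" "real (ld \<pi> i) \<ge> H" using False by (auto simp: Q_def not_less)
        moreover have "real (ld \<pi> i) \<le> real (ld (j # \<pi>) i)" using ld_mono_Cons by simp
        ultimately show ?thesis unfolding Q_def by (meson not_less order_trans)
      qed
      then show ?thesis using P_nonneg[of \<pi>] by (simp add: X_def)
    next
      case True
      have Z0: "Z \<pi> > 0" using Zn[of \<pi>] n0(1) by linarith
      define d where "d j = (B - 1) * u \<pi> j / Z \<pi>" for j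
      have d0: "0 \<le> d j" for j using B Z0 u1[of \<pi> j] by (simp add: d_def)
      have sd: "s * d j \<le> 1" if "j < n" for j
      proof -
        have "u \<pi> j \<le> B powr H"
          using True that B unfolding u_def Q_def by (intro powr_mono) (auto intro: less_imp_le)
        then have "d j \<le> (B - 1) * B powr H / real n"
          unfolding d_def using B Zn u1[of \<pi> j] by (intro frac_le mult_left_mono mult_nonneg_nonneg) auto
        then have "s * d j \<le> s * ((B - 1) * B powr H / real n)" using s by (intro mult_left_mono) auto
        then show ?thesis using s by linarith
      qed
      have d1: "d j \<le> 1" if "j < n" for j
        using mult_right_mono[OF s(1) d0[of j]] sd[OF that] by simp
      have Zj: "Z (j # \<pi>) \<ge> Z \<pi> * (1 + d j)" if "j < n" for j
      proof -
        have "Z \<pi> * (1 + d j) = (\<Sum>i<n. u \<pi> i + (if i = j then (B - 1) * u \<pi> j else 0))"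
          using that Z0 by (simp add: sum.distrib Z_def[symmetric] d_def distrib_left)
        also have "\<dots> \<le> Z (j # \<pi>)"
          unfolding Z_def
        proof (rule sum_mono)
          fix i
          have "B * u \<pi> i \<le> u (j # \<pi>) i" if "i = j"
          proof -
            have "B * u \<pi> i = B powr (1 + real (ld \<pi> i))" using B by (simp add: u_def powr_add)
            also have "\<dots> \<le> u (j # \<pi>) i"
              unfolding u_def using B that wgt_bounds(1)[of \<pi> j] by (intro powr_mono) (auto simp: ld_Cons)
            finally show ?thesis .
          qed
          moreover have "u \<pi> i \<le> u (j # \<pi>) i"
            unfolding u_def using B ld_mono_Cons[of \<pi> i j] by (intro powr_mono) auto
          ultimately show "u \<pi> i + (if i = j then (B - 1) * u \<pi> j else 0) \<le> u (j # \<pi>) i"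
            by (auto simp: algebra_simps)
        qed
        finally show ?thesis .
      qed
      define b where "b = (of_bool (G \<pi>) :: real)"
      have N: "N (j # \<pi>) = N \<pi> + b" for j
      proof -
        have "{t. t < length (j # \<pi>) \<and> G (stage (j # \<pi>) t)}
            = {t. t < length \<pi> \<and> G (stage \<pi> t)} \<union> (if G \<pi> then {length \<pi>} else {})"
          by (auto simp: less_Suc_eq)
        then show ?thesis by (auto simp: N_def b_def)
      qed
      have Xpi: "X \<pi> = Z \<pi> powr (- s) * exp (c * N \<pi>)" using True by (simp add: X_def)
      have Xj: "X (j # \<pi>) \<le> X \<pi> * exp (c * b) * (1 - s * d j / 4)" if "j < n" for j
      proof -
        have "X (j # \<pi>) \<le> Z (j # \<pi>) powr (- s) * exp (c * N (j # \<pi>))" by (simp add: X_def)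
        also have "\<dots> \<le> (Z \<pi> * (1 + d j)) powr (- s) * exp (c * N (j # \<pi>))"
          using Zj[OF that] Z0 d0[of j] s
          by (intro mult_right_mono powr_mono2') (auto intro!: mult_pos_pos)
        also have "\<dots> = Z \<pi> powr (- s) * exp (c * N \<pi>) * exp (c * b) * (1 + d j) powr (- s)"
        proof -
          have "(Z \<pi> * (1 + d j)) powr (- s) = Z \<pi> powr (- s) * (1 + d j) powr (- s)"
            by (rule powr_mult)
          then show ?thesis by (simp add: N distrib_left exp_add)
        qed
        also have "\<dots> \<le> Z \<pi> powr (- s) * exp (c * N \<pi>) * exp (c * b) * (1 - s * d j / 4)"
          using d0 d1[OF that] sd[OF that] s by (intro mult_left_mono powr_minus_le_linear) auto
        finally show ?thesis by (simp add: Xpi)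
      qed
      have drift: "P \<pi> * (b * k5 * (B - 1) / real n) \<le> (\<Sum>j<n. P (j # \<pi>) * d j)"
      proof (cases "G \<pi>")
        case True
        have "P \<pi> * (b * k5 * (B - 1) / real n) = k5 / real n * P \<pi> * ((B - 1) * Z \<pi> / Z \<pi>)"
          using Z0 True by (simp add: b_def)
        also have "\<dots> = (\<Sum>j<n. k5 / real n * P \<pi> * d j)"
          unfolding d_def sum_distrib_left[symmetric] sum_divide_distrib[symmetric] Z_def[symmetric] by simp
        also have "\<dots> \<le> (\<Sum>j<n. P (j # \<pi>) * d j)"
          using good[OF \<pi> True] d0 by (intro sum_mono mult_right_mono) auto
        finally show ?thesis .
      qed (use d0 P_nonneg in \<open>auto simp: b_def intro!: sum_nonneg\<close>)
      have "(\<Sum>j<n. P (j # \<pi>) * X (j # \<pi>))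
          \<le> (\<Sum>j<n. P (j # \<pi>) * (X \<pi> * exp (c * b) * (1 - s * d j / 4)))"
        by (intro sum_mono mult_left_mono Xj P_nonneg) auto
      also have "\<dots> = X \<pi> * exp (c * b) * ((\<Sum>j<n. P (j # \<pi>)) - s / 4 * (\<Sum>j<n. P (j # \<pi>) * d j))"
        unfolding sum_distrib_left sum_subtractf[symmetric]
        by (intro sum.cong) (auto simp: algebra_simps)
      also have "\<dots> \<le> X \<pi> * exp (c * b) * (P \<pi> - s / 4 * (P \<pi> * (b * k5 * (B - 1) / real n)))"
        unfolding P_sum[OF \<pi>] using drift s
        by (intro mult_left_mono diff_mono) (auto simp: X_def)
      also have "\<dots> = X \<pi> * exp (c * b) * P \<pi> * (1 + (- (c * b)))"
        by (simp add: c_def field_simps)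
      also have "\<dots> \<le> X \<pi> * exp (c * b) * P \<pi> * exp (- (c * b))"
        using P_nonneg by (intro mult_left_mono exp_ge_add_one_self) (auto simp: X_def)
      finally show ?thesis by (simp add: exp_minus field_simps)
    qed
  qed auto
  also have "\<dots> \<le> real n powr (- s)"
    by (simp add: X_def Z_def N_def u_def)
  finally have E: "Ex T X \<le> real n powr (- s)" .
  let ?Q = "\<lambda>\<pi>. (\<forall>j<n. real (ld \<pi> j) < H) \<and> real (card {t. t < T \<and> G (stage \<pi> t)}) \<ge> g"
  have "((real n * B powr H) powr (- s) * exp (c * g)) * pr T ?Q \<le> Ex T X"
  proof (rule pr_markov)
    fix \<pi> assume \<pi>: "\<pi> \<in> paths n T" "?Q \<pi>"
    have "Z \<pi> \<le> (\<Sum>j<n. B powr H)"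
      unfolding Z_def u_def using \<pi> B by (intro sum_mono powr_mono) (auto intro: less_imp_le)
    then have "(real n * B powr H) powr (- s) \<le> Z \<pi> powr (- s)"
      using s Zn[of \<pi>] n0(1) by (intro powr_mono2') (simp_all del: n0)
    moreover have "exp (c * g) \<le> exp (c * N \<pi>)"
      using \<pi> c0 length_paths[OF \<pi>(1)] by (auto simp: N_def intro!: mult_left_mono)
    ultimately have "(real n * B powr H) powr (- s) * exp (c * g) \<le> Z \<pi> powr (- s) * exp (c * N \<pi>)"
      by (intro mult_mono) auto
    then show "(real n * B powr H) powr (- s) * exp (c * g) \<le> X \<pi>"
      using \<pi> by (simp add: X_def Q_def)
  qed (simp add: X_def)
  with E have "pr T ?Q \<le> real n powr (- s) / ((real n * B powr H) powr (- s) * exp (c * g))"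
    using B by (simp add: pos_le_divide_eq mult.commute)
  also have "\<dots> = exp (s * (H * ln B) - c * g)"
    using B by (simp add: powr_def ln_mult exp_add[symmetric] exp_diff[symmetric] algebra_simps)
  also have "s * (H * ln B) - c * g = s * (H * ln B - k5 * (B - 1) * g / (4 * real n))"
    by (simp add: c_def algebra_simps)
  finally show ?thesis .
qed

end

section \<open>Rounds with a balanced number of overloaded bins\<close>

context bins
begin

lemma absdev_stage:
  assumes "\<pi> \<in> paths n T" "s \<le> t" "t \<le> T"
  shows "absdev (stage \<pi> t) \<le> absdev (stage \<pi> s) + 2 * real wm * real (t - s)"
  using assms(2,3)
proof (induction t rule: dec_induct)
  case (step t)
  from stage_Suc[OF assms(1), of t] step.prems obtain j where "j < n" "stage \<pi> (Suc t) = j # stage \<pi> t"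
    by auto
  then show ?case using step.IH step.prems step.hyps absdev_Cons[of j "stage \<pi> t"]
    by (simp add: Suc_diff_le algebra_simps)
qed auto

lemma delta_stage_le:
  assumes "\<pi> \<in> paths n T" "s \<le> t" "t \<le> T"
  shows "delta (stage \<pi> t) \<le> delta (stage \<pi> s) + real (t - s) / real n"
  using assms(2,3)
proof (induction t rule: dec_induct)
  case (step t)
  from stage_Suc[OF assms(1), of t] step.prems obtain j where "j < n" "stage \<pi> (Suc t) = j # stage \<pi> t"
    by auto
  then show ?case using step.IH step.prems step.hyps delta_Cons[of j "stage \<pi> t"]
    by (simp add: Suc_diff_le add_divide_distrib)
qed auto

lemma lev_stage_mono:
  assumes "\<pi> \<in> paths n T" "s \<le> t" "t \<le> T"
  shows "lev (stage \<pi> s) \<le> lev (stage \<pi> t)"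
  using assms(2,3)
proof (induction t rule: dec_induct)
  case (step t)
  from stage_Suc[OF assms(1), of t] step.prems obtain j where "j < n" "stage \<pi> (Suc t) = j # stage \<pi> t"
    by auto
  then show ?case using step.IH step.prems lev_mono[of j "stage \<pi> t"] by simp
qed auto

text \<open>As \<open>lev\<close> is monotone, equal values at both ends make it constant in
  between, and then no step loses an overloaded bin.\<close>

lemma delta_stage_ge:
  assumes "\<pi> \<in> paths n T" "s \<le> t" "t \<le> T" "lev (stage \<pi> t) = lev (stage \<pi> s)"
  shows "delta (stage \<pi> s) \<le> delta (stage \<pi> t)"
  using assms(2-)
proof (induction t rule: dec_induct)
  case (step t)
  from stage_Suc[OF assms(1), of t] step.prems obtain j where j: "j < n" "stage \<pi> (Suc t) = j # stage \<pi> t"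
    by auto
  have "lev (stage \<pi> s) \<le> lev (stage \<pi> t)"
    by (rule lev_stage_mono[OF assms(1)]) (use step in simp_all)
  moreover have "lev (stage \<pi> t) \<le> lev (stage \<pi> (Suc t))"
    by (rule lev_stage_mono[OF assms(1)]) (use step in simp_all)
  ultimately have "lev (stage \<pi> t) = lev (stage \<pi> s)" using step.prems by simp
  then show ?case using step.IH step.prems j delta_Cons_same[of j "stage \<pi> t"] by simp
qed auto

lemma lev_stage_diff:
  assumes \<pi>: "\<pi> \<in> paths n T" "s \<le> t" "t \<le> T" and k: "wm * (t - s) \<le> m * n"
  shows "lev (stage \<pi> t) \<le> lev (stage \<pi> s) + int m"
proof -
  have "tot (stage \<pi> t) \<le> tot (stage \<pi> s) + m * n"
    using tot_stage_diff(2)[OF \<pi>] k by linarith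
  then have "real (tot (stage \<pi> t)) / real n \<le> (real (tot (stage \<pi> s)) + real m * real n) / real n"
    by (intro divide_right_mono) (auto simp flip: of_nat_add of_nat_mult)
  also have "\<dots> = real (tot (stage \<pi> s)) / real n + real m" by (simp add: add_divide_distrib)
  finally show ?thesis unfolding lev_def by linarith
qed

text \<open>During the \<open>K + 1\<close> rounds from \<open>s\<close> on the average rises by at
  most 1, so its ceiling rises by at most 1. The crossing at \<open>s\<close> has used this
  up.\<close>

lemma lev_after_crossing:
  assumes \<pi>: "\<pi> \<in> paths n T" and s: "lev (stage \<pi> s) < lev (stage \<pi> (Suc s))"
    and K: "wm * (K + 1) \<le> n" "Suc s + K \<le> T"
  shows "lev (stage \<pi> (Suc s + K)) = lev (stage \<pi> (Suc s))"
proof -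
  have "lev (stage \<pi> (Suc s + K)) \<le> lev (stage \<pi> s) + int 1"
    by (rule lev_stage_diff[OF \<pi>]) (use K in auto)
  moreover have "lev (stage \<pi> (Suc s)) \<le> lev (stage \<pi> (Suc s + K))"
    by (rule lev_stage_mono[OF \<pi>]) (use K in auto)
  ultimately show ?thesis using s by simp
qed

definition balanced :: "real \<Rightarrow> nat list \<Rightarrow> bool" where
  "balanced \<epsilon> \<pi> \<longleftrightarrow> delta \<pi> \<in> {\<epsilon>..1 - \<epsilon>}"

text \<open>From the first round with \<open>delta\<close> at least \<open>\<epsilon>\<close>, the
  next \<open>h\<close> rounds are balanced: \<open>delta\<close> does not fall before the next
  crossing, and it rises by at most \<open>h / n \<le> e1 / 2\<close> from a value at most
  \<open>1 - e1\<close>.\<close>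

lemma balanced_from_quiet:
  assumes \<pi>: "\<pi> \<in> paths n T" and K: "t1 + K \<le> T" "lev (stage \<pi> (t1 + K)) = lev (stage \<pi> t1)"
    and start: "delta (stage \<pi> t1) \<le> 1 - e1"
    and t2: "t1 \<le> t2" "t2 < t1 + k" "\<epsilon> \<le> delta (stage \<pi> t2)"
    and h: "h + k \<le> K" "real h \<le> e1 / 2 * real n"
    and eps: "\<epsilon> \<le> e1 / 2" "\<epsilon> + 1 / real n \<le> 1 - e1"
  shows "h \<le> card {t \<in> {t1..<t1 + K}. balanced \<epsilon> (stage \<pi> t)}"
proof -
  define P where "P t \<longleftrightarrow> t1 \<le> t \<and> \<epsilon> \<le> delta (stage \<pi> t)" for t
  \<comment> \<open>Taking the least such round bounds \<open>delta\<close> from above as well: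
    either it is the start, or \<open>delta\<close> was below \<open>\<epsilon>\<close> one round
    earlier and has risen by at most 1 / n.\<close>
  define t3 where "t3 = (LEAST t. P t)"
  have "P t2" using t2 by (simp add: P_def)
  then have P3: "P t3" and le: "t3 \<le> t2" unfolding t3_def by (rule LeastI, rule Least_le)
  have d3: "delta (stage \<pi> t3) \<le> 1 - e1"
  proof (cases "t3 = t1")
    case False
    then obtain t4 where t4: "t3 = Suc t4" "t1 \<le> t4" using P3 by (cases t3) (auto simp: P_def)
    have "\<not> P t4" using not_less_Least[of t4 P] t4 by (simp add: t3_def)
    then have "delta (stage \<pi> t4) < \<epsilon>" using t4 by (simp add: P_def)
    moreover have "delta (stage \<pi> t3) \<le> delta (stage \<pi> t4) + real (t3 - t4) / real n"
      by (rule delta_stage_le[OF \<pi>]) (use t4 le t2 h K in auto)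
    ultimately show ?thesis using t4 eps by simp
  qed (use start in simp)
  have "{t3..<t3 + h} \<subseteq> {t \<in> {t1..<t1 + K}. balanced \<epsilon> (stage \<pi> t)}"
  proof
    fix t assume t: "t \<in> {t3..<t3 + h}"
    then have tK: "t1 \<le> t" "t < t1 + K" using P3 le t2 h by (auto simp: P_def)
    have "lev (stage \<pi> t1) \<le> lev (stage \<pi> t3)"
      by (rule lev_stage_mono[OF \<pi>]) (use P3 t tK K in \<open>simp_all add: P_def\<close>)
    moreover have "lev (stage \<pi> t3) \<le> lev (stage \<pi> t)"
      by (rule lev_stage_mono[OF \<pi>]) (use P3 t tK K in \<open>simp_all add: P_def\<close>)
    moreover have "lev (stage \<pi> t) \<le> lev (stage \<pi> (t1 + K))"
      by (rule lev_stage_mono[OF \<pi>]) (use tK K in simp_all)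
    ultimately have "delta (stage \<pi> t3) \<le> delta (stage \<pi> t)"
      using t tK K by (intro delta_stage_ge[OF \<pi>]) auto
    then have low: "\<epsilon> \<le> delta (stage \<pi> t)" using P3 by (simp add: P_def)
    have "delta (stage \<pi> t) \<le> delta (stage \<pi> t3) + real (t - t3) / real n"
      by (rule delta_stage_le[OF \<pi>]) (use t tK K in auto)
    also have "real (t - t3) / real n \<le> real h / real n"
      using t by (intro divide_right_mono) auto
    also have "\<dots> \<le> e1 / 2" using h by (simp add: divide_le_eq)
    finally have "delta (stage \<pi> t) \<le> 1 - \<epsilon>" using d3 eps by simp
    with low tK show "t \<in> {t \<in> {t1..<t1 + K}. balanced \<epsilon> (stage \<pi> t)}" by (simp add: balanced_def)
  qed
  from card_mono[OF _ this] show ?thesis by simp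
qed

section \<open>Crossings and the bins that become underloaded there\<close>

lemma crossing_exists:
  assumes \<pi>: "\<pi> \<in> paths n T" and "s \<le> t" "t \<le> T" "lev (stage \<pi> s) < lev (stage \<pi> t)"
  shows "\<exists>r\<in>{s..<t}. lev (stage \<pi> r) < lev (stage \<pi> (Suc r))"
  using assms(2-)
proof (induction t rule: dec_induct)
  case (step t)
  show ?case
  proof (cases "lev (stage \<pi> s) < lev (stage \<pi> t)")
    case True
    with step obtain r where "r\<in>{s..<t}" "lev (stage \<pi> r) < lev (stage \<pi> (Suc r))" by auto
    then show ?thesis by (intro bexI[of _ r]) auto
  next
    case False
    with step show ?thesis by (intro bexI[of _ t]) auto
  qed
qed auto

lemma card_crossings:
  assumes \<pi>: "\<pi> \<in> paths n T" and "s \<le> t" "t \<le> T"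
  shows "int (card {r \<in> {s..<t}. lev (stage \<pi> r) < lev (stage \<pi> (Suc r))})
    \<le> lev (stage \<pi> t) - lev (stage \<pi> s)"
  using assms(2-)
proof (induction t rule: dec_induct)
  case (step t)
  let ?c = "\<lambda>r. lev (stage \<pi> r) < lev (stage \<pi> (Suc r))"
  have mono: "lev (stage \<pi> t) \<le> lev (stage \<pi> (Suc t))"
    using step by (intro lev_stage_mono[OF \<pi>]) auto
  have "{r \<in> {s..<Suc t}. ?c r} = {r \<in> {s..<t}. ?c r} \<union> (if ?c t then {t} else {})"
    using step.hyps by (auto simp: less_Suc_eq)
  then have "card {r \<in> {s..<Suc t}. ?c r} = card {r \<in> {s..<t}. ?c r} + (if ?c t then 1 else 0)"
    by auto
  then show ?case using step.IH step.prems mono by (auto split: if_splits)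
qed auto

text \<open>Loads never fall, so the first round in which the bin is underloaded must follow a
  crossing. If no such round existed, the bin would never be hit, for a spared bin is hit only while
  underloaded; but the average rises by at least \<open>L \<ge> 2 * D + 1\<close> and overtakes its
  constant load.\<close>

lemma spared_gets_under:
  assumes \<pi>: "\<pi> \<in> paths n T" and L: "t0 + L * n \<le> T" "real L \<ge> 2 * D + 1"
    and j: "j \<in> spared t0 D (stage \<pi> (t0 + L * n))"
  shows "\<exists>s\<in>{t0..<t0 + L * n}. lev (stage \<pi> s) < lev (stage \<pi> (Suc s)) \<and> j \<in> {..<n} - over (stage \<pi> (Suc s))"
proof -
  let ?e = "t0 + L * n"
  have len: "length (stage \<pi> ?e) = ?e" using length_paths[OF \<pi>] L by (intro length_stage) auto
  have st: "stage (stage \<pi> ?e) t = stage \<pi> t" if "t \<le> ?e" for t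
    using that length_paths[OF \<pi>] L by (intro stage_stage) auto
  have j0: "j \<in> over (stage \<pi> t0)" "y (stage \<pi> t0) j \<le> 2 * D"
    using j by (auto simp: spared_def st)
  have hit: "j \<notin> over (stage \<pi> t)" if "t0 \<le> t" "t < ?e" "stage \<pi> (Suc t) = j # stage \<pi> t" for t
    using j that by (auto simp: spared_def st len)
  have jn: "j < n" using j0 by (auto simp: over_def)
  show ?thesis
  proof (cases "\<exists>t. t0 \<le> t \<and> t \<le> ?e \<and> j \<notin> over (stage \<pi> t)")
    case True
    then obtain t where t: "t0 \<le> t" "t \<le> ?e" "j \<notin> over (stage \<pi> t)" by auto
    define u where "u = (LEAST t. t0 \<le> t \<and> j \<notin> over (stage \<pi> t))"
    have u: "t0 \<le> u \<and> j \<notin> over (stage \<pi> u)" unfolding u_def by (rule LeastI[of _ t]) (use t in auto)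
    have "u \<le> t" unfolding u_def by (rule Least_le) (use t in auto)
    then have "u \<le> ?e" using t by simp
    have "u \<noteq> t0" using j0 u by auto
    then obtain s where s: "u = Suc s" "t0 \<le> s" using u by (cases u) auto
    have "j \<in> over (stage \<pi> s)"
      using not_less_Least[of s "\<lambda>t. t0 \<le> t \<and> j \<notin> over (stage \<pi> t)"] s by (auto simp: u_def)
    then have "lev (stage \<pi> s) \<le> int (ld (stage \<pi> s) j)" by (simp add: over_lev)
    also have "\<dots> \<le> int (ld (stage \<pi> u) j)"
      using ld_mono_stage[OF \<pi>, of s u] s \<open>u \<le> ?e\<close> L by simp
    also have "\<dots> < lev (stage \<pi> u)" using u jn by (auto simp: over_lev)
    finally show ?thesis using s u \<open>u \<le> ?e\<close> jn by (intro bexI[of _ s]) auto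
  next
    case False
    have const: "ld (stage \<pi> t) j = ld (stage \<pi> t0) j" if "t0 \<le> t" "t \<le> ?e" for t
      using that
    proof (induction t rule: dec_induct)
      case (step t)
      from stage_Suc[OF \<pi>, of t] step L obtain i where i: "i < n" "stage \<pi> (Suc t) = i # stage \<pi> t"
        by auto
      have "i \<noteq> j" using hit[of t] False step i by auto
      then show ?case using step i by (simp add: ld_Cons)
    qed auto
    have "ld (stage \<pi> ?e) j = ld (stage \<pi> t0) j" by (rule const) auto
    moreover have "tot (stage \<pi> t0) + L * n \<le> tot (stage \<pi> ?e)"
      using tot_stage_diff(1)[OF \<pi>, of t0 ?e] L by simp
    then have "(real (tot (stage \<pi> t0)) + real L * real n) / real n \<le> real (tot (stage \<pi> ?e)) / real n"
      by (intro divide_right_mono) (auto simp flip: of_nat_add of_nat_mult)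
    then have "real (tot (stage \<pi> t0)) / real n + real L \<le> real (tot (stage \<pi> ?e)) / real n"
      by (simp add: add_divide_distrib)
    ultimately have "y (stage \<pi> ?e) j < 0" using j0 L by (simp add: y_def)
    then have "j \<notin> over (stage \<pi> ?e)" by (simp add: over_def)
    then show ?thesis using False by auto
  qed
qed

text \<open>Pigeonhole principle: the window has at most \<open>wm * L\<close> crossings, and every
  spared bin is underloaded right after one of them. If each crossing left at most
  \<open>e1 * n\<close> underloaded bins, at most \<open>\<rho> * n\<close> bins would be
  spared.\<close>

lemma crossing_with_under:
  assumes \<pi>: "\<pi> \<in> paths n T" and L: "t0 + L * n \<le> T" "real L \<ge> 2 * D + 1"
    and many: "real (card (spared t0 D (stage \<pi> (t0 + L * n)))) > \<rho> * real n" and rho: "\<rho> > 0"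
    and e1: "e1 > 0" "e1 * real (wm * L) \<le> \<rho>"
  shows "\<exists>s\<in>{t0..<t0 + L * n}. lev (stage \<pi> s) < lev (stage \<pi> (Suc s)) \<and> delta (stage \<pi> (Suc s)) \<le> 1 - e1"
proof (rule ccontr)
  assume neg: "\<not> ?thesis"
  let ?S = "spared t0 D (stage \<pi> (t0 + L * n))"
  define C where "C = {r \<in> {t0..<t0 + L * n}. lev (stage \<pi> r) < lev (stage \<pi> (Suc r))}"
  let ?U = "\<lambda>s. {..<n} - over (stage \<pi> (Suc s))"
  have small: "real (card (?U s)) \<le> e1 * real n" if "s \<in> C" for s
  proof -
    have "delta (stage \<pi> (Suc s)) > 1 - e1" using neg that by (auto simp: C_def)
    then have "real (card (over (stage \<pi> (Suc s)))) \<ge> real n - e1 * real n"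
      by (simp add: delta_def less_divide_eq algebra_simps)
    moreover have "card (?U s) = n - card (over (stage \<pi> (Suc s)))"
      by (subst card_Diff_subset) (use over_subset in auto)
    moreover have "card (over (stage \<pi> (Suc s))) \<le> n"
      using card_mono[OF _ over_subset, of "stage \<pi> (Suc s)"] by simp
    ultimately show ?thesis by simp
  qed
  have "?S \<subseteq> (\<Union>s\<in>C. ?U s)"
  proof
    fix j assume "j \<in> ?S"
    from spared_gets_under[OF \<pi> L this] show "j \<in> (\<Union>s\<in>C. ?U s)"
      unfolding C_def by blast
  qed
  then have "card ?S \<le> card (\<Union>s\<in>C. ?U s)" by (intro card_mono) (auto simp: C_def)
  also have "\<dots> \<le> (\<Sum>s\<in>C. card (?U s))" by (intro card_UN_le) (auto simp: C_def)
  finally have "real (card ?S) \<le> (\<Sum>s\<in>C. real (card (?U s)))"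
    by (metis of_nat_le_iff of_nat_sum)
  also have "\<dots> \<le> (\<Sum>s\<in>C. e1 * real n)" by (intro sum_mono small)
  also have "\<dots> = real (card C) * (e1 * real n)" by simp
  also have "real (card C) \<le> real (wm * L)"
  proof -
    have "int (card C) \<le> lev (stage \<pi> (t0 + L * n)) - lev (stage \<pi> t0)"
      unfolding C_def using L by (intro card_crossings[OF \<pi>]) auto
    also have "\<dots> \<le> int (wm * L)"
      using lev_stage_diff[OF \<pi>, of t0 "t0 + L * n" "wm * L"] L by (simp add: mult.assoc)
    finally show ?thesis by (metis of_nat_le_iff)
  qed
  finally have "real (card ?S) \<le> (e1 * real (wm * L)) * real n"
    using e1 by (simp add: mult_right_mono mult.commute mult.left_commute)
  also have "\<dots> \<le> \<rho> * real n" using e1 by (intro mult_right_mono) auto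
  finally show False using many by simp
qed

text \<open>After a round with small deviations there is soon a stretch of rounds without crossing that
  starts with a constant fraction of underloaded bins; along it \<open>delta\<close> is nondecreasing and grows by
  at most \<open>1 / n\<close> per round, hence stays away from 0 and 1 for long.\<close>

lemma balanced_in_window:
  assumes \<pi>: "\<pi> \<in> paths n T" and L: "t0 + (L + 1) * n \<le> T" "real L \<ge> 2 * D + 1" "L \<ge> 1"
    and many: "delta (stage \<pi> t0) \<ge> 1 / 2 \<Longrightarrow> real (card (spared t0 D (stage \<pi> (t0 + L * n)))) > \<rho> * real n"
    and rho: "\<rho> > 0" and e1: "e1 > 0" "e1 * real (wm * L) \<le> \<rho>" "e1 \<le> 1 / 4"
    and K: "wm * (K + 1) \<le> n" "4 * K \<le> n"
    and low: "\<And>t1. t0 \<le> t1 \<Longrightarrow> t1 \<le> t0 + L * n \<Longrightarrow> \<exists>t2\<in>{t1..<t1 + k}. \<epsilon> \<le> delta (stage \<pi> t2)"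
    and h: "h + k \<le> K" "real h \<le> e1 / 2 * real n"
    and eps: "\<epsilon> \<le> e1 / 2" "\<epsilon> + 1 / real n \<le> 1 - e1"
  shows "h \<le> card {t \<in> {t0..<t0 + (L + 1) * n}. balanced \<epsilon> (stage \<pi> t)}"
proof -
  have Kn: "K < n" using K n_pos by linarith
  have nL: "n \<le> L * n" using L by simp
  have "\<exists>t1. t0 \<le> t1 \<and> t1 \<le> t0 + L * n \<and> delta (stage \<pi> t1) \<le> 1 - e1 \<and>
      lev (stage \<pi> (t1 + K)) = lev (stage \<pi> t1)"
  proof (cases "delta (stage \<pi> t0) \<ge> 1 / 2")
    case True
    have "t0 + L * n \<le> T" using L by simp
    from crossing_with_under[OF \<pi> this L(2) many[OF True] rho e1(1,2)]
    obtain s where s: "s\<in>{t0..<t0 + L * n}" "lev (stage \<pi> s) < lev (stage \<pi> (Suc s))"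
      "delta (stage \<pi> (Suc s)) \<le> 1 - e1" by auto
    moreover have "lev (stage \<pi> (Suc s + K)) = lev (stage \<pi> (Suc s))"
      using s L Kn by (intro lev_after_crossing[OF \<pi> _ K(1)]) auto
    ultimately show ?thesis by (intro exI[of _ "Suc s"]) auto
  next
    case False
    \<comment> \<open>No spared bins are needed here: a stretch without crossing starts at
      \<open>t0\<close> itself or right after a crossing within \<open>K\<close> rounds. By then
      \<open>delta\<close> is at most 1/2 + 1/4, which is why \<open>e1 \<le> 1 / 4\<close> and
      \<open>4 * K \<le> n\<close> are required.\<close>
    show ?thesis
    proof (cases "lev (stage \<pi> (t0 + K)) = lev (stage \<pi> t0)")
      case True
      then show ?thesis using False e1 by (intro exI[of _ t0]) auto
    next
      case lev: False
      have "lev (stage \<pi> t0) \<le> lev (stage \<pi> (t0 + K))"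
        using L Kn nL by (intro lev_stage_mono[OF \<pi>]) auto
      then have "\<exists>s\<in>{t0..<t0 + K}. lev (stage \<pi> s) < lev (stage \<pi> (Suc s))"
        using lev L Kn nL by (intro crossing_exists[OF \<pi>]) auto
      then obtain s where s: "s\<in>{t0..<t0 + K}" "lev (stage \<pi> s) < lev (stage \<pi> (Suc s))" by auto
      have "delta (stage \<pi> (Suc s)) \<le> delta (stage \<pi> t0) + real (Suc s - t0) / real n"
        using s L Kn nL by (intro delta_stage_le[OF \<pi>]) auto
      also have "real (Suc s - t0) / real n \<le> real K / real n"
        using s by (intro divide_right_mono) auto
      also have "\<dots> \<le> 1 / 4" using K by (simp add: divide_le_eq)
      finally have "delta (stage \<pi> (Suc s)) \<le> 1 - e1" using False e1 by simp
      moreover have "lev (stage \<pi> (Suc s + K)) = lev (stage \<pi> (Suc s))"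
        using s L K n_pos nL by (intro lev_after_crossing[OF \<pi> _ K(1)]) auto
      moreover have "s < t0 + K" "t0 \<le> Suc s" using s by simp_all
      moreover from this have "Suc s \<le> t0 + L * n" using Kn nL by linarith
      ultimately show ?thesis by blast
    qed
  qed
  then obtain t1 where t1: "t0 \<le> t1" "t1 \<le> t0 + L * n" "delta (stage \<pi> t1) \<le> 1 - e1"
      "lev (stage \<pi> (t1 + K)) = lev (stage \<pi> t1)" by auto
  obtain t2 where t2: "t1 \<le> t2" "t2 < t1 + k" "\<epsilon> \<le> delta (stage \<pi> t2)"
    using low[OF t1(1,2)] by auto
  have "h \<le> card {t \<in> {t1..<t1 + K}. balanced \<epsilon> (stage \<pi> t)}"
    using t1 L Kn by (intro balanced_from_quiet[OF \<pi> _ t1(4,3) t2 h eps]) auto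
  also have "\<dots> \<le> card {t \<in> {t0..<t0 + (L + 1) * n}. balanced \<epsilon> (stage \<pi> t)}"
    using t1 Kn by (intro card_mono) auto
  finally show ?thesis .
qed

lemma card_small_absdev:
  assumes "(\<Sum>t<T. absdev (stage \<pi> t)) \<le> D / 2 * real n * real T" "D > 0"
  shows "real T / 2 \<le> real (card {t. t < T \<and> absdev (stage \<pi> t) \<le> D * real n})"
proof -
  let ?A = "{t. t < T \<and> absdev (stage \<pi> t) \<le> D * real n}"
  let ?B = "{t. t < T \<and> absdev (stage \<pi> t) > D * real n}"
  have "D * real n * real (card ?B) = (\<Sum>t\<in>?B. D * real n)" by simp
  also have "\<dots> \<le> (\<Sum>t\<in>?B. absdev (stage \<pi> t))" by (intro sum_mono) auto
  also have "\<dots> \<le> (\<Sum>t<T. absdev (stage \<pi> t))" by (intro sum_mono2) (auto simp: absdev_nonneg)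
  also have "\<dots> \<le> D * real n * (real T / 2)" using assms by simp
  finally have B: "real (card ?B) \<le> real T / 2"
    using assms(2) by (subst (asm) mult_le_cancel_left_pos) auto
  have "{..<T} = ?A \<union> ?B" by auto
  then have "T = card (?A \<union> ?B)" by (metis card_lessThan)
  moreover have "card (?A \<union> ?B) = card ?A + card ?B" by (intro card_Un_disjoint) auto
  ultimately show ?thesis using B by linarith
qed

end

text \<open>Double counting of the pairs of a window start in \<open>A\<close> and an element of
  \<open>G\<close> in its window: each element of \<open>G\<close> lies in at most \<open>V\<close>
  windows.\<close>

lemma card_window_bound:
  fixes A G :: "nat set"
  assumes A: "\<And>t0. t0 \<in> A \<Longrightarrow> h \<le> card {t \<in> {t0..<t0 + V}. t \<in> G}" "finite A"
    and G: "finite G"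
  shows "h * card A \<le> V * card G"
proof -
  have "h * card A \<le> (\<Sum>t0\<in>A. card {t \<in> {t0..<t0 + V}. t \<in> G})"
    using sum_mono[of A "\<lambda>_. h", OF A(1)] by (simp add: mult.commute)
  also have "\<dots> = (\<Sum>t0\<in>A. \<Sum>t\<in>G. if t0 \<le> t \<and> t < t0 + V then 1 else 0)"
    using G by (intro sum.cong refl) (simp add: sum.If_cases, intro arg_cong[of _ _ card], auto)
  also have "\<dots> = (\<Sum>t\<in>G. \<Sum>t0\<in>A. if t0 \<le> t \<and> t < t0 + V then 1 else 0)" by (rule sum.swap)
  also have "\<dots> \<le> (\<Sum>t\<in>G. V)"
  proof (rule sum_mono)
    fix t
    have "(\<Sum>t0\<in>A. if t0 \<le> t \<and> t < t0 + V then 1 else 0) = card {t0 \<in> A. t0 \<le> t \<and> t < t0 + V}"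
      using A(2) by (simp add: sum.If_cases Int_def)
    also have "\<dots> \<le> card {t + 1 - V..<t + 1}" by (intro card_mono) auto
    finally show "(\<Sum>t0\<in>A. if t0 \<le> t \<and> t < t0 + V then 1 else 0) \<le> V" by simp
  qed
  finally show ?thesis by (simp add: mult.commute)
qed

section \<open>The maximum load\<close>

context alloc_tree
begin

lemma pr_not: "pr t (\<lambda>\<pi>. \<not> Q \<pi>) = 1 - pr t Q"
proof -
  have "pr t (\<lambda>\<pi>. \<not> Q \<pi>) + pr t Q = Ex t (\<lambda>_. 1)"
    unfolding pr_def Ex_def sum.distrib[symmetric] by (intro sum.cong) auto
  then show ?thesis by (simp add: Ex_const)
qed

text \<open>The five terms bound, in order: a large normalized load, a large sum of deviations, too
  few spared bins, too few overloaded bins for \<open>k\<close> rounds, and small loads despite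
  \<open>g\<close> balanced rounds. Outside the first four events there are deterministically at
  least \<open>g\<close> balanced rounds.\<close>

lemma pr_max_load:
  assumes M: "M \<ge> 0" and R: "R \<ge> real wm * (1 + M)" "R \<ge> real wm * real T / real n"
    and D: "D = 3 * (real wm)\<^sup>2 / c0" and L: "real L \<ge> 2 * D + 1" "L \<ge> 1"
    and rho: "\<rho> > 0" "\<rho> * real n \<ge> 2" and e1: "e1 > 0" "e1 * real (wm * L) \<le> \<rho>" "e1 \<le> 1 / 4"
    and D': "D' = D + 2 * real wm * real L"
    and B: "B > 1" and zeta: "\<zeta> = B powr (- 2 * (2 * D' + 1)) / 2" "\<zeta> * real n \<ge> 1"
    and eps: "\<epsilon> \<le> \<zeta> / 2" "\<epsilon> \<le> e1 / 2" "\<epsilon> + 1 / real n \<le> 1 - e1"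
    and k: "real wm * real k \<le> real n / 2" and K: "wm * (K + 1) \<le> n" "4 * K \<le> n"
    and h: "h + k \<le> K" "real h \<le> e1 / 2 * real n"
    and V: "V = (L + 1) * n" "4 * real V \<le> real T"
    and k5: "0 \<le> k5" and good: "\<And>t \<pi> j. \<pi> \<in> paths n t \<Longrightarrow> balanced \<epsilon> \<pi> \<Longrightarrow> j < n \<Longrightarrow>
      P (j # \<pi>) \<ge> k5 / real n * P \<pi>"
    and B2: "B2 > 1" and s: "s \<ge> 1" "s * ((B2 - 1) * B2 powr H / real n) \<le> 1"
    and g: "g = real h * real T / (4 * real V)"
  shows "pr T (\<lambda>\<pi>. \<exists>j<n. real (ld \<pi> j) \<ge> H) \<ge> 1 -
    (real T * real n * (exp (k1 * real T / real n) * 2 powr (- M))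
     + exp (- (real wm)\<^sup>2 * real T / (16 * R\<^sup>2))
     + real T * exp (\<rho> / 4 * (real n * ln (4 * \<rho>) + 4 * k1 * real (L * n)))
     + real T * exp (\<zeta> * (real n * ln (1 / \<zeta>) - k2 * (B - 1) * real k / 8))
     + exp (s * (H * ln B2 - k5 * (B2 - 1) * g / (4 * real n))))"
    (is "_ \<ge> 1 - (?b1 + ?b2 + ?b3 + ?b4 + ?b5)")
proof -
  have wm1: "real wm \<ge> 1" using wm_pos by simp
  have D0: "D > 0" unfolding D using wm1 c0 by (intro divide_pos_pos) auto
  have D'0: "D' > 0" using D0 by (simp add: D' add_pos_nonneg)
  have kn: "k \<le> n" using h K by linarith
  have "real V \<le> real T" using V(2) by linarith
  then have TV: "V \<le> T" "n \<le> V" "L * n + n = V" by (simp, simp_all add: V(1))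
  define E1 where "E1 \<pi> \<longleftrightarrow> \<not> bounded_until R T \<pi>" for \<pi>
  define E2 where "E2 \<pi> \<longleftrightarrow> bounded_until R T \<pi> \<and>
      (\<Sum>t<T. absdev (stage \<pi> t)) \<ge> 3 * (real wm)\<^sup>2 / (2 * c0) * real n * real T" for \<pi>
  define F3 where "F3 t0 \<pi> \<longleftrightarrow> absdev (stage \<pi> t0) \<le> D * real n \<and> delta (stage \<pi> t0) \<ge> 1 / 2 \<and>
      real (card (spared t0 D \<pi>)) \<le> \<rho> * real n" for t0 \<pi>
  define E3 where "E3 \<pi> \<longleftrightarrow> (\<exists>t0\<in>{..<T - V}. F3 t0 (stage \<pi> (t0 + L * n)))" for \<pi>
  define F4 where "F4 t1 \<pi> \<longleftrightarrow> absdev (stage \<pi> t1) \<le> D' * real n \<and>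
      (\<forall>t\<in>{t1..<t1 + k}. delta (stage \<pi> t) < \<epsilon>)" for t1 \<pi>
  define E4 where "E4 \<pi> \<longleftrightarrow> (\<exists>t1\<in>{..<T - k}. F4 t1 (stage \<pi> (t1 + k)))" for \<pi>
  define E5 where "E5 \<pi> \<longleftrightarrow> (\<forall>j<n. real (ld \<pi> j) < H) \<and>
      real (card {t. t < T \<and> balanced \<epsilon> (stage \<pi> t)}) \<ge> g" for \<pi>
  have p1: "pr T E1 \<le> ?b1" unfolding E1_def by (rule pr_unbounded[OF M R])
  have "R \<ge> real wm" using R(1) M mult_left_mono[of 1 "1 + M" "real wm"] by simp
  then have p2: "pr T E2 \<le> ?b2" unfolding E2_def by (rule pr_absdev_sum)
  have p3: "pr T E3 \<le> ?b3"
  proof -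
    have "pr T E3 \<le> real (card {..<T - V}) * exp (\<rho> / 4 * (real n * ln (4 * \<rho>) + 4 * k1 * real (L * n)))"
      unfolding E3_def
    proof (rule pr_Bex)
      fix t0 assume "t0 \<in> {..<T - V}"
      then have "pr T (\<lambda>\<pi>. F3 t0 (stage \<pi> (t0 + L * n))) = pr (t0 + L * n) (F3 t0)"
        using TV by (intro pr_stage) auto
      also have "\<dots> \<le> exp (\<rho> / 4 * (real n * ln (4 * \<rho>) + 4 * k1 * real (L * n)))"
        unfolding F3_def by (rule pr_few_spared[OF D0 rho])
      finally show "pr T (\<lambda>\<pi>. F3 t0 (stage \<pi> (t0 + L * n)))
        \<le> exp (\<rho> / 4 * (real n * ln (4 * \<rho>) + 4 * k1 * real (L * n)))" .
    qed simp
    also have "\<dots> \<le> ?b3" by (intro mult_right_mono) auto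
    finally show ?thesis .
  qed
  have p4: "pr T E4 \<le> ?b4"
  proof -
    have "pr T E4 \<le> real (card {..<T - k}) * exp (\<zeta> * (real n * ln (1 / \<zeta>) - k2 * (B - 1) * real k / 8))"
      unfolding E4_def
    proof (rule pr_Bex)
      fix t1 assume "t1 \<in> {..<T - k}"
      then have "pr T (\<lambda>\<pi>. F4 t1 (stage \<pi> (t1 + k))) = pr (t1 + k) (F4 t1)"
        by (intro pr_stage) auto
      also have "\<dots> \<le> exp (\<zeta> * (real n * ln (1 / \<zeta>) - k2 * (B - 1) * real k / 8))"
        unfolding F4_def by (rule pr_stay_low[OF B D'0 zeta eps(1) k])
      finally show "pr T (\<lambda>\<pi>. F4 t1 (stage \<pi> (t1 + k)))
        \<le> exp (\<zeta> * (real n * ln (1 / \<zeta>) - k2 * (B - 1) * real k / 8))" .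
    qed simp
    also have "\<dots> \<le> ?b4" by (intro mult_right_mono) auto
    finally show ?thesis .
  qed
  have p5: "pr T E5 \<le> ?b5" unfolding E5_def by (rule pr_loads_small[OF B2 s k5 good])
  have cover: "E1 \<pi> \<or> E2 \<pi> \<or> E3 \<pi> \<or> E4 \<pi> \<or> E5 \<pi>"
    if \<pi>: "\<pi> \<in> paths n T" and H: "\<not> (\<exists>j<n. real (ld \<pi> j) \<ge> H)" for \<pi>
  proof (rule ccontr)
    assume neg: "\<not> ?thesis"
    define A where "A = {t. t < T \<and> absdev (stage \<pi> t) \<le> D * real n}"
    \<comment> \<open>Dropping the starts of incomplete windows costs at most
      \<open>V \<le> T / 4\<close> of the at least \<open>T / 2\<close> rounds in
      \<open>A\<close>.\<close>
    define A' where "A' = A \<inter> {..<T - V}"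
    define G where "G = {t. t < T \<and> balanced \<epsilon> (stage \<pi> t)}"
    have "(\<Sum>t<T. absdev (stage \<pi> t)) \<le> D / 2 * real n * real T"
      using neg by (auto simp: E1_def E2_def D)
    then have cA: "real T / 2 \<le> real (card A)" unfolding A_def by (rule card_small_absdev[OF _ D0])
    have "card A \<le> card A' + card {T - V..<T}"
      by (rule order_trans[OF card_mono card_Un_le]) (auto simp: A'_def A_def)
    then have "real (card A) \<le> real (card A') + real V" using TV by simp
    then have cA': "real T / 4 \<le> real (card A')" using cA V(2) by linarith
    have win: "h \<le> card {t \<in> {t0..<t0 + V}. t \<in> G}" if t0: "t0 \<in> A'" for t0
    proof -
      have t0V: "t0 + V \<le> T" and ad: "absdev (stage \<pi> t0) \<le> D * real n"
        using t0 by (auto simp: A'_def A_def)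
      have stst: "stage (stage \<pi> t) s' = stage \<pi> s'" if "s' \<le> t" "t \<le> T" for s' t
        using that length_paths[OF \<pi>] by (intro stage_stage) auto
      have "h \<le> card {t \<in> {t0..<t0 + (L + 1) * n}. balanced \<epsilon> (stage \<pi> t)}"
      proof (rule balanced_in_window[OF \<pi> _ L _ rho(1) e1 K _ h eps(2,3)])
        show "t0 + (L + 1) * n \<le> T" using t0V V by simp
      next
        assume "1 / 2 \<le> delta (stage \<pi> t0)"
        moreover have "\<not> F3 t0 (stage \<pi> (t0 + L * n))"
          using neg t0 by (auto simp: E3_def A'_def)
        moreover have "stage (stage \<pi> (t0 + L * n)) t0 = stage \<pi> t0"
          using t0V TV by (intro stst) auto
        ultimately show "\<rho> * real n < real (card (spared t0 D (stage \<pi> (t0 + L * n))))"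
          using ad by (auto simp: F3_def)
      next
        fix t1 assume t1: "t0 \<le> t1" "t1 \<le> t0 + L * n"
        have n1: "1 \<le> n" by (rule n_pos)
        have "t1 < T - k" using t1 t0 kn TV n1 unfolding A'_def by auto
        then have "\<not> F4 t1 (stage \<pi> (t1 + k))" using neg by (auto simp: E4_def)
        moreover have "stage (stage \<pi> (t1 + k)) t = stage \<pi> t" if "t \<le> t1 + k" for t
          using that \<open>t1 < T - k\<close> by (intro stst) auto
        \<comment> \<open>The stretch may start up to \<open>L * n\<close> rounds after
          \<open>t0\<close>, and each round adds at most \<open>2 * wm\<close>; hence the larger
          constant \<open>D'\<close>.\<close>
        moreover have "absdev (stage \<pi> t1) \<le> D' * real n"
        proof -
          have "absdev (stage \<pi> t1) \<le> absdev (stage \<pi> t0) + 2 * real wm * real (t1 - t0)"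
            using t1 \<open>t1 < T - k\<close> by (intro absdev_stage[OF \<pi>]) auto
          also have "2 * real wm * real (t1 - t0) \<le> 2 * real wm * real (L * n)"
            using t1 by (intro mult_left_mono of_nat_mono) auto
          finally show ?thesis using ad by (simp add: D' algebra_simps)
        qed
        ultimately show "\<exists>t2\<in>{t1..<t1 + k}. \<epsilon> \<le> delta (stage \<pi> t2)"
          by (fastforce simp: F4_def not_less)
      qed
      also have "\<dots> = card {t \<in> {t0..<t0 + V}. t \<in> G}"
        using t0V by (intro arg_cong[of _ _ card]) (auto simp: G_def V)
      finally show ?thesis .
    qed
    have "h * card A' \<le> V * card G"
      by (rule card_window_bound[OF win]) (auto simp: A'_def A_def G_def)
    then have "real h * real (card A') \<le> real V * real (card G)" by (metis of_nat_le_iff of_nat_mult)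
    moreover have "real h * (real T / 4) \<le> real h * real (card A')"
      using cA' by (intro mult_left_mono) auto
    ultimately have "real h * (real T / 4) \<le> real V * real (card G)" by linarith
    moreover have "0 < real V" using TV n_pos by simp
    ultimately have "g \<le> real (card G)" by (simp add: g field_simps)
    then have "E5 \<pi>" using H by (auto simp: E5_def G_def not_le)
    then show False using neg by simp
  qed
  have "pr T (\<lambda>\<pi>. \<not> (\<exists>j<n. real (ld \<pi> j) \<ge> H))
      \<le> pr T (\<lambda>\<pi>. E1 \<pi> \<or> E2 \<pi> \<or> E3 \<pi> \<or> E4 \<pi> \<or> E5 \<pi>)"
    by (intro pr_mono cover)
  also have "\<dots> \<le> pr T E1 + (pr T E2 + (pr T E3 + (pr T E4 + pr T E5)))"
    by (intro order_trans[OF pr_disj] add_left_mono order_refl)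
  also have "\<dots> \<le> ?b1 + ?b2 + ?b3 + ?b4 + ?b5" using p1 p2 p3 p4 p5 by linarith
  finally show ?thesis unfolding pr_not by linarith
qed

end

section \<open>Choice of the constants and asymptotics\<close>

lemma ex_linear_ge_log:
  fixes a b c :: real
  assumes "a > 0" "b > 0" "c > 0"
  shows "\<exists>B>1. b * ln B + c \<le> a * (B - 1)"
proof -
  have "eventually (\<lambda>B. b * ln B + c \<le> a * (B - 1)) at_top" using assms by real_asymp
  then have "eventually (\<lambda>B. b * ln B + c \<le> a * (B - 1) \<and> B > 1) at_top"
    using eventually_gt_at_top[of 1] by eventually_elim auto
  then show ?thesis using eventually_happens'[OF trivial_limit_at_top_linorder] by blast
qed

text \<open>The scales are \<open>M = n powr (1 / 8)\<close>, \<open>R = n powr (1 / 4)\<close> and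
  \<open>s = n powr (1 / 2)\<close>. \<open>M\<close> must outgrow \<open>ln n\<close> while
  \<open>wm * (1 + M)\<close> stays below \<open>R\<close>, and the square of \<open>R\<close> must
  be small against the number of rounds.\<close>

lemma error_terms_small:
  fixes \<kappa> k1 a b :: real
  assumes "\<kappa> > 0" "k1 > 0" "a > 0" "b > 0"
  shows "eventually (\<lambda>n. \<kappa> * real n * ln (real n) * real n * (exp (k1 * (\<kappa> * ln (real n))) * 2 powr (- (real n powr (1 / 8))))
      + exp (- (\<kappa> * real n * ln (real n) / (32 * real n powr (1 / 2))))
      + \<kappa> * real n * ln (real n) * exp (- (a * real n)) + \<kappa> * real n * ln (real n) * exp (- (b * real n))
      + exp (- (real n powr (1 / 2) * (\<kappa> * ln (real n)))) \<le> real n powr (- 1 / 2)) sequentially"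
proof -
  have 1: "eventually (\<lambda>n. \<kappa> * real n * ln (real n) * real n * (exp (k1 * (\<kappa> * ln (real n))) * 2 powr (- (real n powr (1 / 8)))) \<le> real n powr (- 1 / 2) / 5) sequentially"
    using assms by real_asymp
  have 2: "eventually (\<lambda>n. exp (- (\<kappa> * real n * ln (real n) / (32 * real n powr (1 / 2)))) \<le> real n powr (- 1 / 2) / 5) sequentially"
    using assms by real_asymp
  have 3: "eventually (\<lambda>n. \<kappa> * real n * ln (real n) * exp (- (a * real n)) \<le> real n powr (- 1 / 2) / 5) sequentially"
    if "a > 0" for a using assms that by real_asymp
  have 5: "eventually (\<lambda>n. exp (- (real n powr (1 / 2) * (\<kappa> * ln (real n)))) \<le> real n powr (- 1 / 2) / 5) sequentially"
    using assms by real_asymp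
  show ?thesis using 1 2 3[OF assms(3)] 3[OF assms(4)] 5 by eventually_elim simp
qed

lemma side_conditions:
  fixes \<kappa> w a b c d m :: real
  assumes "\<kappa> > 0" "w > 0" "a > 0" "b > 0" "c > 0" "d > 0" "m > 0"
  shows "eventually (\<lambda>n. real n powr (1 / 4) \<ge> w * (1 + real n powr (1 / 8)) \<and>
    real n powr (1 / 4) \<ge> w * (\<kappa> * ln (real n)) \<and> a * real n \<ge> 2 \<and> b * real n \<ge> 1 \<and>
    real n \<ge> m \<and> c * real n \<le> \<kappa> * real n * ln (real n) \<and> \<kappa> * real n * ln (real n) \<ge> 2 \<and>
    real n powr (1 / 2) * (d * real n powr (1 / 4) / real n) \<le> 1) sequentially"
  using assms by (intro eventually_conj; real_asymp)

text \<open>Both \<open>\<kappa>\<close> and \<open>N\<close> are found before n and the tree are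
  given. \<open>k5\<close> is a function because the \<open>\<epsilon>\<close> at which it is needed
  results from the other constants.\<close>

lemma max_load_lower_bound:
  fixes wp wm :: nat and k1 k2 c0 :: real and k5 :: "real \<Rightarrow> real"
  assumes w: "1 \<le> wp" "wp \<le> wm" and k: "k1 \<ge> 1" "0 < k2" "0 < c0"
    and k5: "\<forall>\<epsilon>. 0 < \<epsilon> \<and> \<epsilon> < 1 / 2 \<longrightarrow> 0 < k5 \<epsilon>"
  shows "\<exists>\<kappa>>0. \<exists>N. \<forall>n\<ge>N. \<forall>P. alloc_tree n wp wm P k1 k2 c0 \<longrightarrow>
    (\<forall>\<epsilon> t \<pi> j. 0 < \<epsilon> \<longrightarrow> \<epsilon> < 1 / 2 \<longrightarrow> \<pi> \<in> paths n t \<longrightarrow> bins.balanced n wp wm \<epsilon> \<pi> \<longrightarrow> j < n \<longrightarrow>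
      k5 \<epsilon> / real n * P \<pi> \<le> P (j # \<pi>)) \<longrightarrow>
    1 - real n powr (- 1 / 2) \<le> alloc_tree.pr n P (nat \<lfloor>\<kappa> * real n * ln (real n)\<rfloor>)
      (\<lambda>\<pi>. \<exists>j<n. real (bins.ld n wp wm \<pi> j) \<ge> \<kappa> * (1 + real wm) * ln (real n))"
proof -
  have wm1: "real wm \<ge> 1" using w by simp
  define D where "D = 3 * (real wm)\<^sup>2 / c0"
  have D0: "D > 0" using wm1 k by (auto simp: D_def)
  define L where "L = nat \<lceil>2 * D + 1\<rceil>"
  have L: "real L \<ge> 2 * D + 1" unfolding L_def by linarith
  then have L1: "L \<ge> 1" "real L \<ge> 1" using D0 by linarith+
  \<comment> \<open>Makes the exponent in \<open>pr_few_spared\<close> for \<open>L * n\<close>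
    rounds equal to \<open>- \<rho> * n / 4\<close>.\<close>
  define \<rho> where "\<rho> = exp (- 4 * k1 * real L - 1) / 4"
  have rho0: "\<rho> > 0" by (simp add: \<rho>_def)
  have ln_rho: "ln (4 * \<rho>) = - 4 * k1 * real L - 1" by (simp add: \<rho>_def)
  have wmL: "real (wm * L) \<ge> 1" using mult_mono[OF wm1 L1(2)] by simp
  define e1 where "e1 = min (1 / 4) (\<rho> / real (wm * L))"
  have e1: "e1 > 0" "e1 * real (wm * L) \<le> \<rho>" "e1 \<le> 1 / 4"
  proof -
    show "e1 > 0" "e1 \<le> 1 / 4" using rho0 wmL by (auto simp: e1_def min_def)
    have "e1 * real (wm * L) \<le> \<rho> / real (wm * L) * real (wm * L)"
      using wmL by (intro mult_right_mono) (auto simp: e1_def)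
    moreover have "real (wm * L) \<noteq> 0" using wmL by linarith
    ultimately show "e1 * real (wm * L) \<le> \<rho>"
      by (metis nonzero_eq_divide_eq)
  qed
  define D' where "D' = D + 2 * real wm * real L"
  have D'0: "D' > 0" using D0 by (simp add: D'_def add_pos_nonneg)
  \<comment> \<open>The left side is \<open>ln (1 / \<zeta>) + 1\<close>, so the exponent in
    \<open>pr_stay_low\<close> becomes at most \<open>- \<zeta> * n\<close>. The number 128 is 8
    from that exponent times 16 from \<open>kk \<ge> n / (16 * wm)\<close>.\<close>
  obtain B where B: "B > 1"
    "2 * (2 * D' + 1) * ln B + (ln 2 + 1) \<le> k2 / (128 * real wm) * (B - 1)"
    using ex_linear_ge_log[of "k2 / (128 * real wm)" "2 * (2 * D' + 1)" "ln 2 + 1"] k wm1 D'0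
    by (auto simp: add_pos_pos)
  define \<zeta> where "\<zeta> = B powr (- 2 * (2 * D' + 1)) / 2"
  have zeta0: "\<zeta> > 0" using B by (simp add: \<zeta>_def)
  have ln_zeta: "ln (1 / \<zeta>) = ln 2 + 2 * (2 * D' + 1) * ln B"
    using B by (simp add: \<zeta>_def ln_div ln_powr algebra_simps)
  define \<epsilon> where "\<epsilon> = min (\<zeta> / 2) (e1 / 2)"
  have eps: "0 < \<epsilon>" "\<epsilon> \<le> \<zeta> / 2" "\<epsilon> \<le> e1 / 2" "\<epsilon> \<le> 1 / 8"
    using zeta0 e1 by (auto simp: \<epsilon>_def)
  define q where "q = k5 \<epsilon>"
  have q0: "q > 0" unfolding q_def using eps k5 by auto
  \<comment> \<open>With \<open>h = n div H0\<close>, the first entry gives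
    \<open>h \<le> e1 / 2 * n\<close> and the second \<open>h \<le> n / (16 * wm)\<close>.\<close>
  define H0 where "H0 = max (nat \<lceil>2 / e1\<rceil>) (16 * wm)"
  have H0: "real H0 \<ge> 2 / e1" "H0 \<ge> 16 * wm" unfolding H0_def by linarith+
  have H01: "H0 \<ge> 16" using H0 w by simp
  \<comment> \<open>Lower bound for the fraction of balanced rounds: \<open>h / (4 * V)\<close> with
    \<open>h \<ge> n / (2 * H0)\<close>, and another factor 2 for rounding down the number of
    rounds.\<close>
  define \<gamma> where "\<gamma> = 1 / (16 * real H0 * real (L + 1))"
  have gam0: "\<gamma> > 0" using H01 by (simp add: \<gamma>_def)
  obtain B2 where B2: "B2 > 1" "(1 + real wm) * ln B2 + 1 \<le> q * \<gamma> / 4 * (B2 - 1)"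
    using ex_linear_ge_log[of "q * \<gamma> / 4" "1 + real wm" 1] q0 gam0 wm1 by auto
  \<comment> \<open>Makes \<open>H * ln B2\<close> equal to \<open>ln n / 4\<close>.\<close>
  define \<kappa> where "\<kappa> = 1 / (4 * (1 + real wm) * ln B2)"
  have kap0: "\<kappa> > 0" using B2 wm1 by (simp add: \<kappa>_def)
  have "eventually (\<lambda>n. (real n powr (1 / 4) \<ge> real wm * (1 + real n powr (1 / 8)) \<and>
    real n powr (1 / 4) \<ge> real wm * (\<kappa> * ln (real n)) \<and> \<rho> * real n \<ge> 2 \<and> \<zeta> * real n \<ge> 1 \<and>
    real n \<ge> 2 * real H0 \<and> 8 * real (L + 1) * real n \<le> \<kappa> * real n * ln (real n) \<and> \<kappa> * real n * ln (real n) \<ge> 2 \<and>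
    real n powr (1 / 2) * ((B2 - 1) * real n powr (1 / 4) / real n) \<le> 1) \<and>
    (\<kappa> * real n * ln (real n) * real n * (exp (k1 * (\<kappa> * ln (real n))) * 2 powr (- (real n powr (1 / 8))))
      + exp (- (\<kappa> * real n * ln (real n) / (32 * real n powr (1 / 2))))
      + \<kappa> * real n * ln (real n) * exp (- (\<rho> / 4 * real n)) + \<kappa> * real n * ln (real n) * exp (- (\<zeta> * real n))
      + exp (- (real n powr (1 / 2) * (\<kappa> * ln (real n)))) \<le> real n powr (- 1 / 2))) sequentially"
    using kap0 wm1 rho0 zeta0 B2 k H01 by (intro eventually_conj side_conditions error_terms_small) auto
  then obtain N where N: "\<And>n. n \<ge> N \<Longrightarrow> (real n powr (1 / 4) \<ge> real wm * (1 + real n powr (1 / 8)) \<and>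
    real n powr (1 / 4) \<ge> real wm * (\<kappa> * ln (real n)) \<and> \<rho> * real n \<ge> 2 \<and> \<zeta> * real n \<ge> 1 \<and>
    real n \<ge> 2 * real H0 \<and> 8 * real (L + 1) * real n \<le> \<kappa> * real n * ln (real n) \<and> \<kappa> * real n * ln (real n) \<ge> 2 \<and>
    real n powr (1 / 2) * ((B2 - 1) * real n powr (1 / 4) / real n) \<le> 1) \<and>
    (\<kappa> * real n * ln (real n) * real n * (exp (k1 * (\<kappa> * ln (real n))) * 2 powr (- (real n powr (1 / 8))))
      + exp (- (\<kappa> * real n * ln (real n) / (32 * real n powr (1 / 2))))
      + \<kappa> * real n * ln (real n) * exp (- (\<rho> / 4 * real n)) + \<kappa> * real n * ln (real n) * exp (- (\<zeta> * real n))
      + exp (- (real n powr (1 / 2) * (\<kappa> * ln (real n)))) \<le> real n powr (- 1 / 2))"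
    unfolding eventually_sequentially by blast
  show ?thesis
  proof (intro exI[of _ \<kappa>] conjI exI[of _ N] allI impI)
    show "\<kappa> > 0" by (rule kap0)
    fix n P assume n: "n \<ge> N" and tree: "alloc_tree n wp wm P k1 k2 c0"
      and good: "\<forall>\<epsilon> t \<pi> j. 0 < \<epsilon> \<longrightarrow> \<epsilon> < 1 / 2 \<longrightarrow> \<pi> \<in> paths n t \<longrightarrow> bins.balanced n wp wm \<epsilon> \<pi> \<longrightarrow> j < n \<longrightarrow>
        k5 \<epsilon> / real n * P \<pi> \<le> P (j # \<pi>)"
    interpret alloc_tree n wp wm P k1 k2 c0 by (rule tree)
    define X where "X = \<kappa> * real n * ln (real n)"
    define T where "T = nat \<lfloor>X\<rfloor>"
    define lnn where "lnn = ln (real n)"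
    from N[OF n, folded X_def] have
      n1: "real n powr (1 / 4) \<ge> real wm * (1 + real n powr (1 / 8))" and
      n2: "real n powr (1 / 4) \<ge> real wm * (\<kappa> * ln (real n))" and
      n3: "\<rho> * real n \<ge> 2" and n4: "\<zeta> * real n \<ge> 1" and n5: "real n \<ge> 2 * real H0" and
      n6: "8 * real (L + 1) * real n \<le> X" and n7: "X \<ge> 2" and
      n8: "real n powr (1 / 2) * ((B2 - 1) * real n powr (1 / 4) / real n) \<le> 1" and
      err: "X * real n * (exp (k1 * (\<kappa> * ln (real n))) * 2 powr (- (real n powr (1 / 8))))
      + exp (- (X / (32 * real n powr (1 / 2))))
      + X * exp (- (\<rho> / 4 * real n)) + X * exp (- (\<zeta> * real n))
      + exp (- (real n powr (1 / 2) * (\<kappa> * ln (real n)))) \<le> real n powr (- 1 / 2)"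
      by blast+
    have T: "real T \<le> X" "real T \<ge> X / 2" using n7 unfolding T_def by linarith+
    have Tn: "real T / real n \<le> \<kappa> * lnn"
    proof -
      have "real T / real n \<le> X / real n" using T by (intro divide_right_mono) auto
      then show ?thesis by (simp add: X_def lnn_def)
    qed
    have lnn0: "lnn \<ge> 0" using n_pos by (simp add: lnn_def)
    \<comment> \<open>In units of \<open>n / wm\<close>, a stretch of 1/4 holds 1/8 for waiting
      until \<open>delta\<close> reaches \<open>\<epsilon>\<close> and 1/16 for the balanced rounds,
      with room for rounding.\<close>
    define K where "K = n div (4 * wm)"
    define kk where "kk = n div (8 * wm)"
    define h where "h = n div H0"
    define V where "V = (L + 1) * n"
    define g where "g = real h * real T / (4 * real V)"
    define H where "H = \<kappa> * (1 + real wm) * lnn"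
    define s where "s = real n powr (1 / 2)"
    have n2H: "n \<ge> 2 * H0" using n5 by linarith
    have n32: "n \<ge> 32 * wm" using n2H H0 by linarith
    have real_div: "real n / real m - 1 \<le> real (n div m)" "real (n div m) \<le> real n / real m" if "m > 0" for m
      using floor_divide_of_nat_eq[of n m, where 'a = real] by linarith+
    have wmpos: "wm > 0" using w by simp
    have nw: "real n / real wm \<ge> 32" using n32 wm1 by (simp add: le_divide_eq)
    have kk: "real kk \<le> real n / real wm / 8" "real kk \<ge> real n / (16 * real wm)"
      using real_div[of "8 * wm"] wmpos nw by (simp_all add: kk_def)
    have KK: "real K \<le> real n / real wm / 4" "real K \<ge> real n / real wm / 4 - 1"
      using real_div[of "4 * wm"] wmpos by (simp_all add: K_def)
    have hh: "real h \<le> real n / real H0" "real h \<ge> real n / real H0 - 1"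
      using real_div[of H0] H01 by (simp_all add: h_def)
    have hK: "h + kk \<le> K"
    proof -
      have "real n / real H0 \<le> real n / (16 * real wm)"
        using H0(2) wm1 by (intro divide_left_mono) (auto simp flip: of_nat_mult)
      also have "\<dots> = real n / real wm / 16" by simp
      finally have "real n / real H0 \<le> real n / real wm / 16" .
      moreover define x where "x = real n / real wm"
      ultimately have "real h + real kk \<le> real K"
        using hh(1) kk(1) KK(2) nw unfolding x_def[symmetric] by linarith
      then show ?thesis by linarith
    qed
    have he: "real h \<le> e1 / 2 * real n"
    proof -
      have "0 < 2 / e1" using e1 by simp
      then have "real n / real H0 \<le> real n / (2 / e1)"
        using H0(1) H01 by (intro divide_left_mono mult_pos_pos) auto
      also have "real n / (2 / e1) = e1 / 2 * real n" by simp
      finally show ?thesis using hh(1) by linarith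
    qed
    have h_low: "real h \<ge> real n / (2 * real H0)"
    proof -
      have "real n / real H0 \<ge> 2" using n5 H01 by (simp add: le_divide_eq)
      then show ?thesis using hh(2) by simp
    qed
    have Kw: "wm * (K + 1) \<le> n" "4 * K \<le> n"
    proof -
      have "4 * wm * K \<le> n" unfolding K_def by simp
      then have a: "4 * (wm * K) \<le> n" by (simp add: mult.assoc)
      then show "wm * (K + 1) \<le> n" using n32 by (simp add: distrib_left)
      have "K \<le> wm * K" using wmpos by simp
      then show "4 * K \<le> n" using a by linarith
    qed
    have kn: "real wm * real kk \<le> real n / 2"
    proof -
      have "real wm * real kk \<le> real wm * (real n / real wm / 8)" using kk(1) by (intro mult_left_mono) auto
      then show ?thesis using wm1 by simp
    qed
    have main: "pr T (\<lambda>\<pi>. \<exists>j<n. real (ld \<pi> j) \<ge> H) \<ge> 1 -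
      (real T * real n * (exp (k1 * real T / real n) * 2 powr (- (real n powr (1 / 8))))
       + exp (- (real wm)\<^sup>2 * real T / (16 * (real n powr (1 / 4))\<^sup>2))
       + real T * exp (\<rho> / 4 * (real n * ln (4 * \<rho>) + 4 * k1 * real (L * n)))
       + real T * exp (\<zeta> * (real n * ln (1 / \<zeta>) - k2 * (B - 1) * real kk / 8))
       + exp (s * (H * ln B2 - q * (B2 - 1) * g / (4 * real n))))"
    proof (rule pr_max_load[OF _ n1 _ D_def L L1(1) rho0 n3 e1 D'_def B(1) \<zeta>_def n4 eps(2,3) _ kn Kw hK he V_def _ _ _ B2(1) _ _ g_def])
      have "real wm * real T / real n = real wm * (real T / real n)" by simp
      also have "\<dots> \<le> real wm * (\<kappa> * lnn)" using Tn by (intro mult_left_mono) auto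
      finally show "real wm * real T / real n \<le> real n powr (1 / 4)" using n2 by (simp add: lnn_def)
      have "1 / real n \<le> 1 / 2" using n2H H01 by (intro divide_left_mono) auto
      then show "\<epsilon> + 1 / real n \<le> 1 - e1" using eps(4) e1(3) by linarith
      show "4 * real V \<le> real T" using n6 T by (simp add: V_def algebra_simps)
      show "0 \<le> q" using q0 by simp
      show "q / real n * P \<pi> \<le> P (j # \<pi>)" if "\<pi> \<in> paths n t" "balanced \<epsilon> \<pi>" "j < n" for t \<pi> j
        using good eps that unfolding q_def by fastforce
      show "1 \<le> s" unfolding s_def using n_pos by (intro ge_one_powr_ge_zero) auto
      have "B2 powr H = exp (H * ln B2)" using B2 by (simp add: powr_def)
      also have "H * ln B2 = lnn / 4"
        using B2 wm1 by (simp add: H_def \<kappa>_def) (simp add: field_simps)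
      also have "exp (lnn / 4) = real n powr (1 / 4)" using n_pos by (simp add: powr_def lnn_def)
      finally show "s * ((B2 - 1) * B2 powr H / real n) \<le> 1" using n8 by (simp add: s_def)
    qed simp
    have b1: "real T * real n * (exp (k1 * real T / real n) * 2 powr (- (real n powr (1 / 8))))
      \<le> X * real n * (exp (k1 * (\<kappa> * ln (real n))) * 2 powr (- (real n powr (1 / 8))))"
    proof -
      have "k1 * (real T / real n) \<le> k1 * (\<kappa> * ln (real n))"
        using Tn k1 by (intro mult_left_mono) (auto simp: lnn_def)
      then have "exp (k1 * real T / real n) \<le> exp (k1 * (\<kappa> * ln (real n)))" by simp
      then show ?thesis using T n7 by (intro mult_mono) auto
    qed
    have b2: "exp (- (real wm)\<^sup>2 * real T / (16 * (real n powr (1 / 4))\<^sup>2)) \<le> exp (- (X / (32 * real n powr (1 / 2))))"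
    proof -
      have e: "(real n powr (1 / 4))\<^sup>2 = real n powr (1 / 2)"
        using n_pos by (simp add: power2_eq_square flip: powr_add)
      have "X / 2 \<le> (real wm)\<^sup>2 * real T"
        using mult_mono[of 1 "(real wm)\<^sup>2" "X / 2" "real T"] wm1 T n7 by simp
      then have "X / 2 / (16 * real n powr (1 / 2)) \<le> (real wm)\<^sup>2 * real T / (16 * real n powr (1 / 2))"
        by (intro divide_right_mono) auto
      then show ?thesis unfolding e by simp
    qed
    have b3: "real T * exp (\<rho> / 4 * (real n * ln (4 * \<rho>) + 4 * k1 * real (L * n))) \<le> X * exp (- (\<rho> / 4 * real n))"
    proof -
      have "real n * ln (4 * \<rho>) + 4 * k1 * real (L * n) = - real n"
        unfolding ln_rho by (simp add: algebra_simps)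
      then show ?thesis using T by simp
    qed
    have b4: "real T * exp (\<zeta> * (real n * ln (1 / \<zeta>) - k2 * (B - 1) * real kk / 8)) \<le> X * exp (- (\<zeta> * real n))"
    proof -
      have "real n * (2 * (2 * D' + 1) * ln B + (ln 2 + 1)) \<le> real n * (k2 / (128 * real wm) * (B - 1))"
        using B(2) by (intro mult_left_mono) auto
      also have "\<dots> = k2 * (B - 1) / 8 * (real n / (16 * real wm))" by simp
      also have "\<dots> \<le> k2 * (B - 1) / 8 * real kk"
        using kk(2) k2 B by (intro mult_left_mono) auto
      finally have "real n * ln (1 / \<zeta>) - k2 * (B - 1) * real kk / 8 \<le> - real n"
        unfolding ln_zeta by (simp add: algebra_simps)
      then have "\<zeta> * (real n * ln (1 / \<zeta>) - k2 * (B - 1) * real kk / 8) \<le> \<zeta> * - real n"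
        using zeta0 by (intro mult_left_mono) auto
      then show ?thesis using T n7 by (intro mult_mono) auto
    qed
    have b5: "exp (s * (H * ln B2 - q * (B2 - 1) * g / (4 * real n))) \<le> exp (- (real n powr (1 / 2) * (\<kappa> * ln (real n))))"
    proof -
      have "\<gamma> * X = real n / (2 * real H0) * (X / 2) / (4 * real V)"
      proof -
        have "real n \<noteq> 0" "real H0 \<noteq> 0" "real (L + 1) \<noteq> 0" using n_pos H01 by auto
        then show ?thesis unfolding \<gamma>_def V_def of_nat_mult by (simp add: divide_simps)
      qed
      also have "\<dots> \<le> g" unfolding g_def
        using h_low T n7 by (intro divide_right_mono mult_mono) auto
      finally have "\<gamma> * X / (4 * real n) \<le> g / (4 * real n)" by (intro divide_right_mono) auto
      then have g': "\<gamma> / 4 * (\<kappa> * lnn) \<le> g / (4 * real n)" by (simp add: X_def lnn_def)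
      have "\<kappa> * lnn * ((1 + real wm) * ln B2 + 1) \<le> \<kappa> * lnn * (q * \<gamma> / 4 * (B2 - 1))"
        using B2 kap0 lnn0 by (intro mult_left_mono) auto
      also have "\<dots> = q * (B2 - 1) * (\<gamma> / 4 * (\<kappa> * lnn))" by simp
      also have "\<dots> \<le> q * (B2 - 1) * (g / (4 * real n))"
        using g' q0 B2 by (intro mult_left_mono) auto
      finally have "H * ln B2 - q * (B2 - 1) * g / (4 * real n) \<le> - (\<kappa> * lnn)"
        by (simp add: H_def algebra_simps)
      then have "s * (H * ln B2 - q * (B2 - 1) * g / (4 * real n)) \<le> s * - (\<kappa> * lnn)"
        by (intro mult_left_mono) (auto simp: s_def)
      then show ?thesis by (simp add: s_def lnn_def)
    qed
    have "1 - real n powr (- 1 / 2) \<le> pr T (\<lambda>\<pi>. \<exists>j<n. real (ld \<pi> j) \<ge> H)"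
      using main b1 b2 b3 b4 b5 err by linarith
    then show "1 - real n powr (- 1 / 2) \<le> pr (nat \<lfloor>\<kappa> * real n * ln (real n)\<rfloor>)
      (\<lambda>\<pi>. \<exists>j<n. real (ld \<pi> j) \<ge> \<kappa> * (1 + real wm) * ln (real n))"
      by (simp add: T_def X_def H_def lnn_def)
  qed
qed

section \<open>Averaging an allocation process over its paths\<close>

text \<open>Abel summation: all partial sums of \<open>f - a\<close> are nonpositive and the weights
  are nonnegative and nonincreasing. This is how majorization without rearrangement acts on sorted
  loads.\<close>

lemma sum_mult_antimono_le:
  fixes f a z :: "nat \<Rightarrow> real"
  assumes z: "\<And>i. i < K \<Longrightarrow> 0 \<le> z i" "\<And>i. Suc i < K \<Longrightarrow> z (Suc i) \<le> z i"
    and f: "\<And>k. k \<le> K \<Longrightarrow> (\<Sum>i<k. f i) \<le> (\<Sum>i<k. a i)"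
  shows "(\<Sum>i<K. z i * f i) \<le> (\<Sum>i<K. z i * a i)"
proof -
  define D where "D k = (\<Sum>i<k. f i - a i)" for k
  have D: "D k \<le> 0" if "k \<le> K" for k using f[OF that] by (simp add: D_def sum_subtractf)
  have bound: "(\<Sum>i<Suc k. z i * (f i - a i)) \<le> z k * D (Suc k)" if "Suc k \<le> K" for k
    using that
  proof (induction k)
    case (Suc k)
    have "(\<Sum>i<Suc (Suc k). z i * (f i - a i)) \<le> z k * D (Suc k) + z (Suc k) * (f (Suc k) - a (Suc k))"
      using Suc by simp
    also have "z k * D (Suc k) \<le> z (Suc k) * D (Suc k)"
      using Suc z(2)[of k] D[of "Suc k"] by (intro mult_right_mono_neg) auto
    also have "z (Suc k) * D (Suc k) + z (Suc k) * (f (Suc k) - a (Suc k)) = z (Suc k) * D (Suc (Suc k))"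
      by (simp add: D_def algebra_simps)
    finally show ?case by simp
  qed (simp add: D_def)
  have "(\<Sum>i<K. z i * (f i - a i)) \<le> 0"
  proof (cases K)
    case (Suc k)
    have "z k * D (Suc k) \<le> 0" using z(1)[of k] D[of "Suc k"] Suc by (intro mult_nonneg_nonpos) auto
    with bound[of k] Suc show ?thesis by simp
  qed simp
  then show ?thesis by (simp add: algebra_simps sum_subtractf)
qed

lemma downclosed_eq_lessThan:
  assumes "S \<subseteq> {..<n::nat}" "\<And>i j. j \<in> S \<Longrightarrow> i \<le> j \<Longrightarrow> i \<in> S"
  shows "S = {..<card S}"
proof (cases "S = {}")
  case False
  have fin: "finite S" using assms(1) finite_subset by blast
  have "S = {..Max S}"
    using assms(2)[OF Max_in[OF fin False]] Max_ge[OF fin] by auto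
  then have "card S = Suc (Max S)" by (metis card_atMost)
  then show ?thesis using \<open>S = {..Max S}\<close> by (metis lessThan_Suc_atMost)
qed simp

lemma sum_list_take_map_upt:
  "k \<le> K \<Longrightarrow> sum_list (take k (map f [0..<K])) = (\<Sum>i<k. f i :: real)"
  by (simp add: take_map atLeast0LessThan interv_sum_list_conv_sum_set_nat)

lemma sum_list_take_map_rev_upt:
  assumes "k \<le> n - K"
  shows "sum_list (take k (map f (rev [K..<n]))) = (\<Sum>i<k. f (n - 1 - i) :: real)"
proof -
  have "take k (map f (rev [K..<n])) = map (\<lambda>i. f (n - 1 - i)) [0..<k]"
    using assms by (intro nth_equalityI) (auto simp: rev_nth)
  then show ?thesis by (simp add: atLeast0LessThan interv_sum_list_conv_sum_set_nat)
qed

lemma majorizes_over: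
  assumes "majorizes (replicate K a) (map f [0..<K])" "k \<le> K"
  shows "(\<Sum>i<k. f i) \<le> (\<Sum>i<k. a)"
proof -
  have "sum_list (take k (map f [0..<K])) \<le> sum_list (take k (replicate K a))"
    using assms(1) by (simp add: majorizes_def)
  then show ?thesis using assms(2) by (simp only: sum_list_take_map_upt) (simp add: sum_list_replicate)
qed

lemma majorizes_under:
  assumes "majorizes (map f (rev [K..<n])) (replicate (n - K) b)" "k \<le> n - K"
  shows "(\<Sum>i<k. b) \<le> (\<Sum>i<k. f (n - 1 - i))"
proof -
  have "sum_list (take k (replicate (n - K) b)) \<le> sum_list (take k (map f (rev [K..<n])))"
    using assms(1) by (simp add: majorizes_def)
  then show ?thesis using assms(2)
    by (simp only: sum_list_take_map_rev_upt) (simp add: sum_list_replicate)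
qed

primrec choices :: "'a process \<Rightarrow> nat \<Rightarrow> 'a \<Rightarrow> nat list" where
  "choices A 0 \<omega> = []"
| "choices A (Suc t) \<omega> = chosen A t \<omega> # choices A t \<omega>"

lemma length_choices [simp]: "length (choices A t \<omega>) = t"
  by (induction t) auto

section \<open>Path events and their probabilities\<close>

locale alloc_proc =
  fixes n :: nat and A :: "'a process"
  assumes pos: "n \<ge> 1" and process: "allocation_process n A"
begin

abbreviation "M \<equiv> sample A"

lemma prob: "prob_space M" using process by (simp add: allocation_process_def)

sublocale prob_space M by (rule prob)

lemma chosen_meas [measurable]: "chosen A t \<in> measurable M (count_space {..<n})"
  and balls_meas: "balls A t \<in> measurable M (count_space {1..})"
  and ranking_meas: "i < n \<Longrightarrow> ranking A t i \<in> measurable M (count_space {..<n})"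
  using process by (auto simp: allocation_process_def)

lemma chosen_less: "\<omega> \<in> space M \<Longrightarrow> chosen A t \<omega> < n"
  using measurable_space[OF chosen_meas] by auto

lemma ranking_bij: "\<omega> \<in> space M \<Longrightarrow> bij_betw (\<lambda>i. ranking A t i \<omega>) {..<n} {..<n}"
  and ranking_sorted: "\<omega> \<in> space M \<Longrightarrow> i \<le> j \<Longrightarrow> j < n \<Longrightarrow>
    load A t (ranking A t j \<omega>) \<omega> \<le> load A t (ranking A t i \<omega>) \<omega>"
  using process by (auto simp: allocation_process_def)

lemma ranking_less: "\<omega> \<in> space M \<Longrightarrow> i < n \<Longrightarrow> ranking A t i \<omega> < n"
  using ranking_bij[of \<omega> t] by (auto simp: bij_betw_def)

lemma level_sets:
  assumes "f \<in> measurable M (count_space S)"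
  shows "{\<omega> \<in> space M. f \<omega> = k} \<in> sets M"
proof (cases "k \<in> S")
  case True
  have "f -` {k} \<inter> space M \<in> sets M" by (rule measurable_sets[OF assms]) (use True in auto)
  then show ?thesis by (simp add: vimage_def Int_def conj_commute)
next
  case False
  then have "{\<omega> \<in> space M. f \<omega> = k} = {}" using measurable_space[OF assms] by auto
  then show ?thesis by (simp only: sets.empty_sets)
qed

lemma history_gens:
  "{{\<omega> \<in> space M. chosen A s \<omega> = k} | s k. s < t} \<union>
   {{\<omega> \<in> space M. balls A s \<omega> = k} | s k. s < t} \<union>
   {{\<omega> \<in> space M. ranking A s i \<omega> = k} | s i k. s \<le> t \<and> i < n} \<subseteq> sets M" (is "?G \<subseteq> _")
  using level_sets[OF chosen_meas] level_sets[OF balls_meas] level_sets[OF ranking_meas] by blast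

lemma history_sets: "sets (history n A t) = sigma_sets (space M)
  ({{\<omega> \<in> space M. chosen A s \<omega> = k} | s k. s < t} \<union>
   {{\<omega> \<in> space M. balls A s \<omega> = k} | s k. s < t} \<union>
   {{\<omega> \<in> space M. ranking A s i \<omega> = k} | s i k. s \<le> t \<and> i < n})"
  unfolding history_def
  by (rule sets_measure_of) (use history_gens[of t] sets.sets_into_space in blast)

lemma space_history [simp]: "space (history n A t) = space M"
  unfolding history_def
  by (rule space_measure_of) (use history_gens[of t] sets.sets_into_space in blast)

lemma history_subalgebra: "subalgebra M (history n A t)"
  unfolding subalgebra_def history_sets
  using sets.sigma_sets_subset[OF history_gens[of t]] by simp

lemma chosen_in_history: "s < t \<Longrightarrow> {\<omega> \<in> space M. chosen A s \<omega> = k} \<in> sets (history n A t)"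
  unfolding history_sets by (intro sigma_sets.Basic) blast

lemma ranking_in_history: "i < n \<Longrightarrow> {\<omega> \<in> space M. ranking A t i \<omega> = k} \<in> sets (history n A t)"
  unfolding history_sets by (intro sigma_sets.Basic) blast

definition path_event :: "nat list \<Rightarrow> 'a set" where
  "path_event \<pi> = {\<omega> \<in> space M. choices A (length \<pi>) \<omega> = \<pi>}"

definition path_prob :: "nat list \<Rightarrow> real" where
  "path_prob \<pi> = prob (path_event \<pi>)"

lemma path_event_Nil: "path_event [] = space M" by (simp add: path_event_def)

lemma path_event_Cons:
  "path_event (j # \<pi>) = path_event \<pi> \<inter> {\<omega> \<in> space M. chosen A (length \<pi>) \<omega> = j}"
  by (auto simp: path_event_def)

lemma path_event_history: "length \<pi> \<le> t \<Longrightarrow> path_event \<pi> \<in> sets (history n A t)"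
proof (induction \<pi>)
  case Nil
  then show ?case using sets.top[of "history n A t"] by (simp add: path_event_Nil)
next
  case (Cons j \<pi>)
  then show ?case unfolding path_event_Cons by (intro sets.Int chosen_in_history) auto
qed

lemma path_event_sets: "path_event \<pi> \<in> sets M"
  using path_event_history[of \<pi> "length \<pi>"] history_subalgebra by (auto simp: subalgebra_def)

lemma finite_sub: "finite_measure_subalgebra M (history n A t)"
  by unfold_locales (rule history_subalgebra)

lemma chosen_rank_sets:
  assumes "i < n"
  shows "{\<omega> \<in> space M. chosen A t \<omega> = ranking A t i \<omega>} \<in> sets M"
proof -
  have "{\<omega> \<in> space M. chosen A t \<omega> = ranking A t i \<omega>}
      = (\<Union>k<n. {\<omega> \<in> space M. chosen A t \<omega> = k} \<inter> {\<omega> \<in> space M. ranking A t i \<omega> = k})"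
    using ranking_less[OF _ assms] by auto
  also have "\<dots> \<in> sets M"
    using level_sets[OF chosen_meas] level_sets[OF ranking_meas[OF assms]]
    by (intro sets.finite_UN sets.Int) auto
  finally show ?thesis .
qed

lemma alloc_prob_integrable:
  assumes "i < n"
  shows "integrable M (alloc_prob n A t i)"
proof -
  interpret F: finite_measure_subalgebra M "history n A t" by (rule finite_sub)
  show ?thesis using chosen_rank_sets[OF assms, of t] unfolding alloc_prob_def
    by (intro F.real_cond_exp_int(1)) (auto intro!: integrable_real_indicator simp: emeasure_eq_measure)
qed

lemma alloc_prob_integral:
  assumes "i < n" and B: "B \<in> sets (history n A t)"
  shows "prob (B \<inter> {\<omega> \<in> space M. chosen A t \<omega> = ranking A t i \<omega>})
    = (\<integral>\<omega>. indicator B \<omega> * alloc_prob n A t i \<omega> \<partial>M)"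
proof -
  interpret F: finite_measure_subalgebra M "history n A t" by (rule finite_sub)
  let ?C = "{\<omega> \<in> space M. chosen A t \<omega> = ranking A t i \<omega>}"
  have C: "?C \<in> sets M" by (rule chosen_rank_sets[OF assms(1)])
  have BM: "B \<in> sets M" using B history_subalgebra by (auto simp: subalgebra_def)
  have int: "integrable M (indicator ?C :: 'a \<Rightarrow> real)"
    using C by (auto intro!: integrable_real_indicator simp: emeasure_eq_measure)
  have "(\<integral>\<omega>\<in>B. indicator ?C \<omega> \<partial>M) = (\<integral>\<omega>\<in>B. alloc_prob n A t i \<omega> \<partial>M)"
    unfolding alloc_prob_def by (rule F.real_cond_exp_intA[OF int B])
  moreover have "(\<integral>\<omega>\<in>B. (indicator ?C \<omega> :: real) \<partial>M) = (\<integral>\<omega>. indicator (B \<inter> ?C) \<omega> \<partial>M)"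
    unfolding set_lebesgue_integral_def
    by (intro Bochner_Integration.integral_cong) (auto simp: indicator_def)
  moreover have "(\<integral>\<omega>. (indicator (B \<inter> ?C) \<omega> :: real) \<partial>M) = prob (B \<inter> ?C)"
    using C BM by simp
  ultimately show ?thesis by (simp add: set_lebesgue_integral_def)
qed

text \<open>The one-step weights of the path tree are averages of \<open>alloc_prob\<close> over the path event.\<close>

lemma path_prob_Cons:
  assumes j: "j < n" and t: "t = length \<pi>"
  shows "path_prob (j # \<pi>) = (\<Sum>i<n. \<integral>\<omega>. indicator (path_event \<pi>) \<omega> *
      (of_bool (ranking A t i \<omega> = j) * alloc_prob n A t i \<omega>) \<partial>M)"
proof -
  define B where "B i = path_event \<pi> \<inter> {\<omega> \<in> space M. ranking A t i \<omega> = j}" for i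
  define C where "C i = {\<omega> \<in> space M. chosen A t \<omega> = ranking A t i \<omega>}" for i
  have B: "B i \<in> sets (history n A t)" if "i < n" for i
    unfolding B_def using that t by (intro sets.Int path_event_history ranking_in_history) auto
  have BC: "B i \<inter> C i = path_event (j # \<pi>) \<inter> {\<omega> \<in> space M. ranking A t i \<omega> = j}" for i
    unfolding path_event_Cons B_def C_def t by auto
  \<comment> \<open>Exactly one rank belongs to bin \<open>j\<close>, so the event splits by that
    rank. Each \<open>B i\<close> lies in the history because the ranking of round \<open>t\<close>
    does, which makes the conditional expectation applicable on it.\<close>
  have eq: "path_event (j # \<pi>) = (\<Union>i<n. B i \<inter> C i)"
  proof -
    have "\<omega> \<in> (\<Union>i<n. B i \<inter> C i)" if \<omega>: "\<omega> \<in> path_event (j # \<pi>)" for \<omega>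
    proof -
      have sp: "\<omega> \<in> space M" using \<omega> by (simp add: path_event_def)
      have "j \<in> (\<lambda>i. ranking A t i \<omega>) ` {..<n}"
        using ranking_bij[OF sp, of t] j by (simp add: bij_betw_def)
      then obtain i where "i < n" "ranking A t i \<omega> = j" by (metis imageE lessThan_iff)
      then have "\<omega> \<in> B i \<inter> C i" unfolding BC using \<omega> sp by simp
      with \<open>i < n\<close> show ?thesis by blast
    qed
    moreover have "B i \<inter> C i \<subseteq> path_event (j # \<pi>)" for i unfolding BC by blast
    ultimately show ?thesis by (intro equalityI UN_least subsetI[of "path_event (j # \<pi>)"])
  qed
  have disj: "disjoint_family_on (\<lambda>i. B i \<inter> C i) {..<n}"
    unfolding disjoint_family_on_def
  proof (intro ballI impI)
    fix i i' assume ii: "i \<in> {..<n}" "i' \<in> {..<n}" "i \<noteq> i'"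
    show "B i \<inter> C i \<inter> (B i' \<inter> C i') = {}"
    proof (rule equals0I)
      fix \<omega> assume "\<omega> \<in> B i \<inter> C i \<inter> (B i' \<inter> C i')"
      then have "\<omega> \<in> space M" "ranking A t i \<omega> = ranking A t i' \<omega>" unfolding BC by simp_all
      then show False using ranking_bij[of \<omega> t] ii unfolding bij_betw_def inj_on_def by blast
    qed
  qed
  have ms: "B i \<inter> C i \<in> sets M" if "i < n" for i
    unfolding BC using that path_event_sets level_sets[OF ranking_meas] by (intro sets.Int) auto
  have "path_prob (j # \<pi>) = (\<Sum>i<n. prob (B i \<inter> C i))"
    unfolding path_prob_def eq using disj ms by (intro finite_measure_finite_Union) auto
  also have "\<dots> = (\<Sum>i<n. \<integral>\<omega>. indicator (B i) \<omega> * alloc_prob n A t i \<omega> \<partial>M)"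
    unfolding C_def using B by (intro sum.cong alloc_prob_integral) auto
  also have "\<dots> = (\<Sum>i<n. \<integral>\<omega>. indicator (path_event \<pi>) \<omega> *
      (of_bool (ranking A t i \<omega> = j) * alloc_prob n A t i \<omega>) \<partial>M)"
    by (intro sum.cong Bochner_Integration.integral_cong) (auto simp: B_def indicator_def)
  finally show ?thesis .
qed

lemma integrable_ranked:
  assumes "i < n"
  shows "integrable M (\<lambda>\<omega>. indicator (path_event \<pi>) \<omega> *
    (of_bool (ranking A t i \<omega> = j) * alloc_prob n A t i \<omega>))"
proof -
  have "integrable M (\<lambda>\<omega>. indicator (path_event \<pi> \<inter> {\<omega> \<in> space M. ranking A t i \<omega> = j}) \<omega> *\<^sub>R alloc_prob n A t i \<omega>)"
    using path_event_sets level_sets[OF ranking_meas[OF assms]] alloc_prob_integrable[OF assms]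
    by (intro integrable_mult_indicator sets.Int) auto
  moreover have "indicator (path_event \<pi> \<inter> {\<omega> \<in> space M. ranking A t i \<omega> = j}) \<omega> *\<^sub>R alloc_prob n A t i \<omega>
      = indicator (path_event \<pi>) \<omega> * (of_bool (ranking A t i \<omega> = j) * alloc_prob n A t i \<omega>)"
    if "\<omega> \<in> space M" for \<omega>
    using that by (auto simp: indicator_def)
  ultimately show ?thesis by (subst (asm) Bochner_Integration.integrable_cong) auto
qed

text \<open>A linear functional of the one-step weights, with coefficients by bin name, is the
  integral of the same functional of \<open>alloc_prob\<close>, read through the ranking. In this
  form an almost sure linear hypothesis passes to the tree.\<close>

lemma sum_path_prob:
  assumes t: "t = length \<pi>"
  defines "g \<equiv> \<lambda>c \<omega>. indicator (path_event \<pi>) \<omega> * (\<Sum>i<n. c (ranking A t i \<omega>) * alloc_prob n A t i \<omega>)"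
  shows "integrable M (g c)" "(\<Sum>j<n. c j * path_prob (j # \<pi>)) = (\<integral>\<omega>. g c \<omega> \<partial>M)"
proof -
  let ?h = "\<lambda>i j \<omega>. c j * (indicator (path_event \<pi>) \<omega> * (of_bool (ranking A t i \<omega> = j) * alloc_prob n A t i \<omega>))"
  have g: "g c \<omega> = (\<Sum>j<n. \<Sum>i<n. ?h i j \<omega>)" if "\<omega> \<in> space M" for \<omega>
  proof -
    have "(\<Sum>j<n. \<Sum>i<n. ?h i j \<omega>) = (\<Sum>i<n. \<Sum>j<n. ?h i j \<omega>)" by (rule sum.swap)
    also have "\<dots> = (\<Sum>i<n. indicator (path_event \<pi>) \<omega> * (c (ranking A t i \<omega>) * alloc_prob n A t i \<omega>))"
    proof (rule sum.cong)
      fix i assume "i \<in> {..<n}"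
      then have r: "ranking A t i \<omega> < n" using ranking_less[OF that] by simp
      have "(\<Sum>j<n. ?h i j \<omega>) = (\<Sum>j<n. if j = ranking A t i \<omega>
          then c j * (indicator (path_event \<pi>) \<omega> * alloc_prob n A t i \<omega>) else 0)"
        by (intro sum.cong) auto
      then show "(\<Sum>j<n. ?h i j \<omega>) = indicator (path_event \<pi>) \<omega> * (c (ranking A t i \<omega>) * alloc_prob n A t i \<omega>)"
        using r by simp
    qed simp
    finally show ?thesis by (simp add: g_def sum_distrib_left)
  qed
  have int: "integrable M (?h i j)" if "i < n" for i j
    by (rule integrable_mult_right) (rule integrable_ranked[OF that])
  have "integrable M (\<lambda>\<omega>. \<Sum>j<n. \<Sum>i<n. ?h i j \<omega>)"
    using int by (intro Bochner_Integration.integrable_sum) auto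
  then show "integrable M (g c)"
    by (subst Bochner_Integration.integrable_cong[OF refl g]) auto
  have "(\<Sum>j<n. c j * path_prob (j # \<pi>)) = (\<Sum>j<n. \<Sum>i<n. \<integral>\<omega>. ?h i j \<omega> \<partial>M)"
    by (intro sum.cong) (auto simp: path_prob_Cons[OF _ t] sum_distrib_left)
  also have "\<dots> = (\<integral>\<omega>. (\<Sum>j<n. \<Sum>i<n. ?h i j \<omega>) \<partial>M)"
    using int by (subst Bochner_Integration.integral_sum) (auto intro!: sum.cong
      Bochner_Integration.integral_sum[symmetric] Bochner_Integration.integrable_sum)
  also have "\<dots> = (\<integral>\<omega>. g c \<omega> \<partial>M)"
    by (intro Bochner_Integration.integral_cong) (auto simp: g)
  finally show "(\<Sum>j<n. c j * path_prob (j # \<pi>)) = (\<integral>\<omega>. g c \<omega> \<partial>M)" .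
qed

lemma sum_path_prob_le:
  assumes t: "t = length \<pi>"
    and ae: "AE \<omega> in M. \<omega> \<in> path_event \<pi> \<longrightarrow> (\<Sum>i<n. c (ranking A t i \<omega>) * alloc_prob n A t i \<omega>) \<le> b"
  shows "(\<Sum>j<n. c j * path_prob (j # \<pi>)) \<le> b * path_prob \<pi>"
proof -
  let ?g = "\<lambda>\<omega>. indicator (path_event \<pi>) \<omega> * (\<Sum>i<n. c (ranking A t i \<omega>) * alloc_prob n A t i \<omega>)"
  have "(\<Sum>j<n. c j * path_prob (j # \<pi>)) = (\<integral>\<omega>. ?g \<omega> \<partial>M)" by (rule sum_path_prob(2)[OF t])
  also have "\<dots> \<le> (\<integral>\<omega>. b * indicator (path_event \<pi>) \<omega> \<partial>M)"
  proof (rule integral_mono_AE)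
    show "integrable M ?g" by (rule sum_path_prob(1)[OF t])
    show "integrable M (\<lambda>\<omega>. b * indicator (path_event \<pi>) \<omega>)"
      using path_event_sets by (auto intro!: integrable_real_indicator simp: emeasure_eq_measure)
    show "AE \<omega> in M. ?g \<omega> \<le> b * indicator (path_event \<pi>) \<omega>"
      using ae by eventually_elim (auto simp: indicator_def)
  qed
  also have "\<dots> = b * path_prob \<pi>"
    using path_event_sets by (simp add: path_prob_def)
  finally show ?thesis .
qed

lemma sum_path_prob_ge:
  assumes t: "t = length \<pi>"
    and ae: "AE \<omega> in M. \<omega> \<in> path_event \<pi> \<longrightarrow> (\<Sum>i<n. c (ranking A t i \<omega>) * alloc_prob n A t i \<omega>) \<ge> b"
  shows "(\<Sum>j<n. c j * path_prob (j # \<pi>)) \<ge> b * path_prob \<pi>"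
proof -
  have "(\<Sum>j<n. - c j * path_prob (j # \<pi>)) \<le> - b * path_prob \<pi>"
    by (rule sum_path_prob_le[OF t]) (use ae in \<open>auto simp: sum_negf\<close>)
  then show ?thesis by (simp add: sum_negf)
qed

lemma path_prob_sum:
  assumes "\<pi> \<in> paths n t"
  shows "(\<Sum>j<n. path_prob (j # \<pi>)) = path_prob \<pi>"
proof -
  have "path_event \<pi> = (\<Union>j<n. path_event (j # \<pi>))"
    using chosen_less sets.sets_into_space[OF path_event_sets[of \<pi>]] by (fastforce simp: path_event_Cons)
  moreover have "disjoint_family_on (\<lambda>j. path_event (j # \<pi>)) {..<n}"
    by (auto simp: disjoint_family_on_def path_event_Cons)
  ultimately show ?thesis unfolding path_prob_def
    using path_event_sets by (simp add: finite_measure_finite_Union image_subset_iff)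
qed

end

section \<open>Loads and drift along a path event\<close>

locale weighted_proc = alloc_proc n A + bins n wp wm
  for n wp wm :: nat and A :: "'a process" +
  assumes ae_weights: "AE \<omega> in M. balls A t \<omega> =
    (if norm_load n A t (chosen A t \<omega>) \<omega> < 0 then wm else wp)"
begin

text \<open>The rule for the number of balls holds only almost surely in each round. There are
  countably many rounds, so it holds almost surely in all of them at once, and then all loads are
  functions of the choices.\<close>

definition regular :: "'a \<Rightarrow> bool" where
  "regular \<omega> \<longleftrightarrow> (\<forall>t. balls A t \<omega> = (if norm_load n A t (chosen A t \<omega>) \<omega> < 0 then wm else wp))"

lemma AE_regular: "AE \<omega> in M. regular \<omega>"
  unfolding regular_def AE_all_countable using ae_weights by simp

lemma load_eq: "regular \<omega> \<Longrightarrow> load A t j \<omega> = ld (choices A t \<omega>) j"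
proof (induction t arbitrary: j)
  case (Suc t)
  then have IH: "load A t i \<omega> = ld (choices A t \<omega>) i" for i by simp
  have "norm_load n A t i \<omega> = y (choices A t \<omega>) i" for i
    by (simp add: norm_load_def total_load_def y_def tot_def IH)
  then show ?case using Suc.prems by (auto simp: regular_def ld_Cons wgt_def IH)
qed simp

lemma norm_load_eq: "regular \<omega> \<Longrightarrow> norm_load n A t j \<omega> = y (choices A t \<omega>) j"
  by (simp add: norm_load_def total_load_def y_def tot_def load_eq)

lemma path_eventD: "\<omega> \<in> path_event \<pi> \<Longrightarrow> \<omega> \<in> space M" "\<omega> \<in> path_event \<pi> \<Longrightarrow> choices A (length \<pi>) \<omega> = \<pi>"
  by (auto simp: path_event_def)

context
  fixes \<pi> \<omega> t
  assumes reg: "regular \<omega>" and event: "\<omega> \<in> path_event \<pi>" and t: "t = length \<pi>"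
begin

abbreviation "R i \<equiv> ranking A t i \<omega>"

lemma over_bins_eq: "over_bins n A t \<omega> = {i. i < n \<and> R i \<in> over \<pi>}"
  using path_eventD[OF event] ranking_less[of \<omega>]
  by (auto simp: over_bins_def norm_load_eq[OF reg] over_def t)

lemma R_bij: "bij_betw R {..<n} {..<n}"
  using ranking_bij path_eventD(1)[OF event] by simp

lemma R_less: "i < n \<Longrightarrow> R i < n"
  using ranking_less path_eventD(1)[OF event] by simp

lemma R_sorted: "i \<le> j \<Longrightarrow> j < n \<Longrightarrow> y \<pi> (R j) \<le> y \<pi> (R i)"
  using ranking_sorted[OF path_eventD(1)[OF event], of i j t] path_eventD(2)[OF event]
  by (simp add: load_eq[OF reg] t y_def)

lemma card_over_bins: "card (over_bins n A t \<omega>) = card (over \<pi>)"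
proof -
  have "R ` over_bins n A t \<omega> = over \<pi>"
  proof
    show "over \<pi> \<subseteq> R ` over_bins n A t \<omega>"
    proof
      fix j assume j: "j \<in> over \<pi>"
      then have "j \<in> R ` {..<n}" using R_bij over_subset by (auto simp: bij_betw_def)
      then show "j \<in> R ` over_bins n A t \<omega>" using j by (auto simp: over_bins_eq)
    qed
  qed (auto simp: over_bins_eq)
  moreover have "inj_on R (over_bins n A t \<omega>)"
    using R_bij by (auto simp: bij_betw_def inj_on_def over_bins_eq)
  ultimately show ?thesis by (metis card_image)
qed

lemma over_bins_lessThan: "over_bins n A t \<omega> = {..<card (over \<pi>)}"
  unfolding card_over_bins[symmetric]
proof (rule downclosed_eq_lessThan[of _ n])
  fix i j assume ij: "j \<in> over_bins n A t \<omega>" "i \<le> j"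
  then have "j < n" "0 \<le> y \<pi> (R j)" by (auto simp: over_bins_eq over_def)
  then show "i \<in> over_bins n A t \<omega>"
    using R_sorted[of i j] R_less[of i] ij by (auto simp: over_bins_eq over_def)
qed (auto simp: over_bins_eq)

lemma over_frac_eq: "over_frac n A t \<omega> = delta \<pi>"
  by (simp add: over_frac_def delta_def card_over_bins)

lemma sum_R: "(\<Sum>i<n. f (R i)) = (\<Sum>j<n. f j)"
  using sum.reindex_bij_betw[OF R_bij] .

text \<open>\<open>sum_mult_antimono_le\<close> applies to each half: normalized loads decrease from
  the heaviest bin down to the last overloaded one, and their absolute values decrease from the
  lightest bin up to the last underloaded one. Both halves have total absolute value
  \<open>absdev \<pi> / 2\<close>.\<close>

lemma drift_at:
  assumes maj_over: "majorizes (replicate (card (over_bins n A t \<omega>)) a) (over_vec n A t \<omega>)"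
    and maj_under: "majorizes (under_vec n A t \<omega>) (replicate (card (under_bins n A t \<omega>)) b)"
  shows "(\<Sum>i<n. (real (wgt \<pi> (R i)) * y \<pi> (R i)) * alloc_prob n A t i \<omega>)
    \<le> (real wp * a - real wm * b) * (absdev \<pi> / 2)"
proof -
  define K where "K = card (over \<pi>)"
  define f where "f i = alloc_prob n A t i \<omega>" for i
  define z where "z i = y \<pi> (R i)" for i
  have Kn: "K \<le> n" using card_mono[OF _ over_subset, of \<pi>] by (simp add: K_def)
  have overK: "R i \<in> over \<pi> \<longleftrightarrow> i < K" if "i < n" for i
    using that over_bins_lessThan by (auto simp: over_bins_eq K_def)
  have z_over: "0 \<le> z i" if "i < K" for i using overK[of i] that Kn by (auto simp: z_def over_def)
  have z_under: "z i \<le> 0" if "K \<le> i" "i < n" for i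
    using overK[of i] that R_less by (auto simp: z_def over_def)
  have z_dec: "z j \<le> z i" if "i \<le> j" "j < n" for i j using R_sorted[OF that] by (simp add: z_def)
  \<comment> \<open>The underloaded ranks are summed from the lightest bin on, matching the order of
    \<open>under_vec\<close>.\<close>
  have split: "(\<Sum>i<n. g i) = (\<Sum>i<K. g i) + (\<Sum>i<n - K. g (n - 1 - i))" for g :: "nat \<Rightarrow> real"
  proof -
    have "(\<Sum>i<n. g i) = (\<Sum>i<K. g i) + (\<Sum>i\<in>{K..<n}. g i)"
      using Kn by (metis atLeast0LessThan sum.atLeastLessThan_concat zero_le)
    also have "(\<Sum>i\<in>{K..<n}. g i) = (\<Sum>i<n - K. g (n - 1 - i))"
      using Kn by (intro sum.reindex_bij_witness[of _ "\<lambda>i. n - 1 - i" "\<lambda>i. n - 1 - i"]) auto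
    finally show ?thesis .
  qed
  have under: "K \<le> n - 1 - i" "n - 1 - i < n" if "i < n - K" for i using that n_pos by auto
  have sumz: "(\<Sum>i<K. z i) = absdev \<pi> / 2" "(\<Sum>i<n - K. - z (n - 1 - i)) = absdev \<pi> / 2"
  proof -
    have "(\<Sum>i<n. z i) = 0" using sum_R[of "y \<pi>"] sum_y by (simp add: z_def)
    then have 1: "(\<Sum>i<K. z i) + (\<Sum>i<n - K. z (n - 1 - i)) = 0" using split[of z] by simp
    have "absdev \<pi> = (\<Sum>i<n. \<bar>z i\<bar>)" using sum_R[of "\<lambda>j. \<bar>y \<pi> j\<bar>"] by (simp add: z_def absdev_def)
    also have "\<dots> = (\<Sum>i<K. \<bar>z i\<bar>) + (\<Sum>i<n - K. \<bar>z (n - 1 - i)\<bar>)" by (rule split)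
    also have "(\<Sum>i<K. \<bar>z i\<bar>) = (\<Sum>i<K. z i)" using z_over by (intro sum.cong) auto
    also have "(\<Sum>i<n - K. \<bar>z (n - 1 - i)\<bar>) = (\<Sum>i<n - K. - z (n - 1 - i))"
      using z_under under by (intro sum.cong) (auto intro!: abs_of_nonpos)
    finally have 2: "absdev \<pi> = (\<Sum>i<K. z i) - (\<Sum>i<n - K. z (n - 1 - i))"
      by (simp add: sum_negf)
    show "(\<Sum>i<K. z i) = absdev \<pi> / 2" "(\<Sum>i<n - K. - z (n - 1 - i)) = absdev \<pi> / 2"
      using 1 2 by (simp_all add: sum_negf)
  qed
  have "(\<Sum>i<K. z i * f i) \<le> (\<Sum>i<K. z i * a)"
  proof (rule sum_mult_antimono_le)
    fix k assume "k \<le> K"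
    then show "(\<Sum>i<k. f i) \<le> (\<Sum>i<k. a)"
      using maj_over unfolding over_vec_def card_over_bins K_def f_def by (intro majorizes_over)
  qed (use z_over z_dec Kn in auto)
  then have 1: "(\<Sum>i<K. z i * f i) \<le> a * (absdev \<pi> / 2)"
    by (simp only: sum_distrib_right[symmetric] sumz) (simp add: mult.commute)
  have "(\<Sum>i<n - K. - z (n - 1 - i) * - f (n - 1 - i)) \<le> (\<Sum>i<n - K. - z (n - 1 - i) * - b)"
  proof (rule sum_mult_antimono_le)
    fix k assume "k \<le> n - K"
    moreover have "card (under_bins n A t \<omega>) = n - K"
      unfolding under_bins_def using over_bins_lessThan Kn
      by (subst card_Diff_subset) (auto simp: K_def)
    ultimately have "(\<Sum>i<k. b) \<le> (\<Sum>i<k. f (n - 1 - i))"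
      using maj_under unfolding under_vec_def card_over_bins K_def f_def by (intro majorizes_under) auto
    then show "(\<Sum>i<k. - f (n - 1 - i)) \<le> (\<Sum>i<k. - b)" by (simp add: sum_negf)
  qed (use z_under under z_dec in auto)
  then have 2: "(\<Sum>i<n - K. z (n - 1 - i) * f (n - 1 - i)) \<le> - b * (absdev \<pi> / 2)"
    by (simp only: sum_distrib_right[symmetric] sumz) (simp add: mult.commute)
  have "(\<Sum>i<n. (real (wgt \<pi> (R i)) * y \<pi> (R i)) * alloc_prob n A t i \<omega>)
      = (\<Sum>i<K. real wp * (z i * f i)) + (\<Sum>i<n - K. real wm * (z (n - 1 - i) * f (n - 1 - i)))"
    unfolding split
  proof (intro arg_cong2[where f = "(+)"] sum.cong refl)
    fix i assume "i \<in> {..<K}"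
    then have "wgt \<pi> (R i) = wp" using overK[of i] Kn by (intro wgt_over) auto
    then show "(real (wgt \<pi> (R i)) * y \<pi> (R i)) * alloc_prob n A t i \<omega> = real wp * (z i * f i)"
      by (simp add: z_def f_def)
  next
    fix i assume "i \<in> {..<n - K}"
    then have "wgt \<pi> (R (n - 1 - i)) = wm"
      using overK[of "n - 1 - i"] under[of i] R_less by (intro wgt_under) auto
    then show "(real (wgt \<pi> (R (n - 1 - i))) * y \<pi> (R (n - 1 - i))) * alloc_prob n A t (n - 1 - i) \<omega>
        = real wm * (z (n - 1 - i) * f (n - 1 - i))" by (simp add: z_def f_def)
  qed
  also have "\<dots> = real wp * (\<Sum>i<K. z i * f i) + real wm * (\<Sum>i<n - K. z (n - 1 - i) * f (n - 1 - i))"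
    by (simp add: sum_distrib_left)
  also have "\<dots> \<le> real wp * (a * (absdev \<pi> / 2)) + real wm * (- b * (absdev \<pi> / 2))"
    using 1 2 by (intro add_mono mult_left_mono) auto
  finally show ?thesis by (simp add: algebra_simps)
qed

lemma sum_single_R:
  assumes "j < n"
  obtains i where "i < n" "R i = j"
    "(\<Sum>i'<n. of_bool (R i' = j) * g i') = (g i :: real)"
proof -
  have "j \<in> R ` {..<n}" using R_bij assms by (simp add: bij_betw_def)
  then obtain i where i: "i < n" "R i = j" by (metis imageE lessThan_iff)
  have "(\<Sum>i'<n. of_bool (R i' = j) * g i') = (\<Sum>i'<n. if i' = i then g i' else 0)"
  proof (rule sum.cong)
    fix i' assume "i' \<in> {..<n}"
    then have "R i' = j \<longleftrightarrow> i' = i" using i R_bij by (auto simp: bij_betw_def inj_on_def)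
    then show "of_bool (R i' = j) * g i' = (if i' = i then g i' else 0)" by simp
  qed simp
  also have "\<dots> = g i" using i by simp
  finally show ?thesis using i that by blast
qed

end

lemma path_prob_single: "j < n \<Longrightarrow> (\<Sum>i<n. of_bool (i = j) * path_prob (i # \<pi>)) = path_prob (j # \<pi>)"
  by (subst sum.cong[OF refl, of _ _ "\<lambda>i. if i = j then path_prob (i # \<pi>) else 0"]) auto

lemma path_prob_le:
  assumes j: "j < n" and ae: "AE \<omega> in M. regular \<omega> \<longrightarrow> \<omega> \<in> path_event \<pi> \<longrightarrow>
      (\<forall>i<n. ranking A (length \<pi>) i \<omega> = j \<longrightarrow> alloc_prob n A (length \<pi>) i \<omega> \<le> b)"
  shows "path_prob (j # \<pi>) \<le> b * path_prob \<pi>"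
proof -
  have "AE \<omega> in M. \<omega> \<in> path_event \<pi> \<longrightarrow>
      (\<Sum>i<n. of_bool (ranking A (length \<pi>) i \<omega> = j) * alloc_prob n A (length \<pi>) i \<omega>) \<le> b"
    using ae AE_regular
  proof eventually_elim
    case (elim \<omega>)
    show ?case
    proof
      assume ev: "\<omega> \<in> path_event \<pi>"
      from sum_single_R[OF elim(2) ev refl j, of "\<lambda>i. alloc_prob n A (length \<pi>) i \<omega>"] elim ev
      show "(\<Sum>i<n. of_bool (ranking A (length \<pi>) i \<omega> = j) * alloc_prob n A (length \<pi>) i \<omega>) \<le> b"
        by metis
    qed
  qed
  from sum_path_prob_le[OF refl this] show ?thesis using j by (simp add: path_prob_single)
qed

lemma path_prob_ge:
  assumes j: "j < n" and ae: "AE \<omega> in M. regular \<omega> \<longrightarrow> \<omega> \<in> path_event \<pi> \<longrightarrow>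
      (\<forall>i<n. ranking A (length \<pi>) i \<omega> = j \<longrightarrow> alloc_prob n A (length \<pi>) i \<omega> \<ge> b)"
  shows "path_prob (j # \<pi>) \<ge> b * path_prob \<pi>"
proof -
  have "AE \<omega> in M. \<omega> \<in> path_event \<pi> \<longrightarrow>
      (\<Sum>i<n. of_bool (ranking A (length \<pi>) i \<omega> = j) * alloc_prob n A (length \<pi>) i \<omega>) \<ge> b"
    using ae AE_regular
  proof eventually_elim
    case (elim \<omega>)
    show ?case
    proof
      assume ev: "\<omega> \<in> path_event \<pi>"
      from sum_single_R[OF elim(2) ev refl j, of "\<lambda>i. alloc_prob n A (length \<pi>) i \<omega>"] elim ev
      show "(\<Sum>i<n. of_bool (ranking A (length \<pi>) i \<omega> = j) * alloc_prob n A (length \<pi>) i \<omega>) \<ge> b"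
        by metis
    qed
  qed
  from sum_path_prob_ge[OF refl this] show ?thesis using j by (simp add: path_prob_single)
qed

text \<open>The drift follows from \<open>drift_at\<close> with the two constants of the
  majorization conditions; the 2 in the assumption \<open>drift\<close> makes up for the half of
  \<open>absdev\<close> on each side.\<close>

lemma alloc_tree_path_prob:
  fixes k1 k2 k3 k4 c0 :: real
  assumes ae: "\<And>t. AE \<omega> in M.
        (\<forall>i\<in>over_bins n A t \<omega>. alloc_prob n A t i \<omega> \<le> k1 / real n) \<and>
        majorizes (replicate (card (over_bins n A t \<omega>)) (1 / real n - k3 * (1 - over_frac n A t \<omega>) / real n))
          (over_vec n A t \<omega>) \<and>
        (\<forall>i\<in>under_bins n A t \<omega>. alloc_prob n A t i \<omega> \<ge> k2 / real n) \<and>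
        majorizes (under_vec n A t \<omega>)
          (replicate (card (under_bins n A t \<omega>)) (1 / real n + k4 * over_frac n A t \<omega> / real n))"
    and k: "k1 \<ge> 1" "0 < k2" "k2 \<le> 1" "0 < c0" "c0 \<le> 1"
    and drift: "\<And>d. 0 \<le> d \<Longrightarrow> d \<le> 1 \<Longrightarrow> real wp * (1 - k3 * (1 - d)) - real wm * (1 + k4 * d) \<le> - 2 * c0"
  shows "alloc_tree n wp wm path_prob k1 k2 c0"
proof unfold_locales
  show "path_prob [] = 1" by (simp add: path_prob_def path_event_Nil prob_space)
  show "path_prob \<pi> \<ge> 0" for \<pi> by (simp add: path_prob_def)
next
  fix \<pi> t assume "\<pi> \<in> paths n t"
  then show "(\<Sum>j<n. path_prob (j # \<pi>)) = path_prob \<pi>" by (rule path_prob_sum)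
next
  fix \<pi> t j assume j: "j \<in> over \<pi>"
  have "AE \<omega> in M. regular \<omega> \<longrightarrow> \<omega> \<in> path_event \<pi> \<longrightarrow>
      (\<forall>i<n. ranking A (length \<pi>) i \<omega> = j \<longrightarrow> alloc_prob n A (length \<pi>) i \<omega> \<le> k1 / real n)"
    using ae[of "length \<pi>"] by eventually_elim (use j in \<open>auto simp: over_bins_eq\<close>)
  then show "path_prob (j # \<pi>) \<le> k1 / real n * path_prob \<pi>"
    using j over_subset by (intro path_prob_le) auto
next
  fix \<pi> t j assume j: "j < n" "j \<notin> over \<pi>"
  have "AE \<omega> in M. regular \<omega> \<longrightarrow> \<omega> \<in> path_event \<pi> \<longrightarrow>
      (\<forall>i<n. ranking A (length \<pi>) i \<omega> = j \<longrightarrow> alloc_prob n A (length \<pi>) i \<omega> \<ge> k2 / real n)"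
    using ae[of "length \<pi>"] by eventually_elim (use j in \<open>auto simp: under_bins_def over_bins_eq\<close>)
  then show "path_prob (j # \<pi>) \<ge> k2 / real n * path_prob \<pi>"
    using j by (intro path_prob_ge) auto
next
  fix \<pi> :: "nat list" and t
  let ?t = "length \<pi>"
  have "AE \<omega> in M. \<omega> \<in> path_event \<pi> \<longrightarrow>
      (\<Sum>i<n. (real (wgt \<pi> (ranking A ?t i \<omega>)) * y \<pi> (ranking A ?t i \<omega>)) * alloc_prob n A ?t i \<omega>)
      \<le> - (c0 * absdev \<pi> / real n)"
    using ae[of ?t] AE_regular
  proof eventually_elim
    case (elim \<omega>)
    show ?case
    proof
      assume ev: "\<omega> \<in> path_event \<pi>"
      let ?d = "delta \<pi>"
      have "(\<Sum>i<n. (real (wgt \<pi> (ranking A ?t i \<omega>)) * y \<pi> (ranking A ?t i \<omega>)) * alloc_prob n A ?t i \<omega>)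
          \<le> (real wp * (1 / real n - k3 * (1 - ?d) / real n) - real wm * (1 / real n + k4 * ?d / real n)) * (absdev \<pi> / 2)"
        using elim(1) unfolding over_frac_eq[OF elim(2) ev refl]
        by (intro drift_at[OF elim(2) ev refl]) auto
      also have "\<dots> = (real wp * (1 - k3 * (1 - ?d)) - real wm * (1 + k4 * ?d)) * (absdev \<pi> / (2 * real n))"
        by (simp add: field_simps)
      also have "\<dots> \<le> - 2 * c0 * (absdev \<pi> / (2 * real n))"
        using drift[OF delta_bounds[of \<pi>]] absdev_nonneg[of \<pi>]
        by (intro mult_right_mono) auto
      finally show "(\<Sum>i<n. (real (wgt \<pi> (ranking A ?t i \<omega>)) * y \<pi> (ranking A ?t i \<omega>)) * alloc_prob n A ?t i \<omega>)
          \<le> - (c0 * absdev \<pi> / real n)" by simp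
    qed
  qed
  from sum_path_prob_le[OF refl this]
  show "(\<Sum>j<n. path_prob (j # \<pi>) * (real (wgt \<pi> j) * y \<pi> j)) \<le> - (c0 * absdev \<pi> / real n) * path_prob \<pi>"
    by (simp add: mult.commute)
qed (use k in auto)

lemma path_prob_balanced:
  assumes ae: "AE \<omega> in M. over_frac n A (length \<pi>) \<omega> \<in> {\<epsilon>..1 - \<epsilon>} \<longrightarrow>
      (\<forall>i<n. alloc_prob n A (length \<pi>) i \<omega> \<ge> b)"
    and "delta \<pi> \<in> {\<epsilon>..1 - \<epsilon>}" "j < n"
  shows "path_prob (j # \<pi>) \<ge> b * path_prob \<pi>"
proof (rule path_prob_ge)
  show "AE \<omega> in M. regular \<omega> \<longrightarrow> \<omega> \<in> path_event \<pi> \<longrightarrow>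
      (\<forall>i<n. ranking A (length \<pi>) i \<omega> = j \<longrightarrow> alloc_prob n A (length \<pi>) i \<omega> \<ge> b)"
    using ae by eventually_elim (use assms(2) in \<open>auto simp: over_frac_eq\<close>)
qed (rule assms(3))

lemma gap_sets: "{\<omega> \<in> space M. gap n A t \<omega> \<ge> c} \<in> sets M"
proof -
  have ld [measurable]: "(\<lambda>\<omega>. real (load A t i \<omega>)) \<in> borel_measurable M" for t i
  proof (induction t)
    case (Suc t)
    have [measurable]: "(\<lambda>\<omega>. real (balls A t \<omega>)) \<in> borel_measurable M"
      by (rule measurable_compose[OF balls_meas]) simp
    have "{\<omega> \<in> space M. chosen A t \<omega> = i} \<in> sets M" by (rule level_sets[OF chosen_meas])
    then have "(\<lambda>\<omega>. real (load A t i \<omega>) + (if chosen A t \<omega> = i then real (balls A t \<omega>) else 0)) \<in> borel_measurable M"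
      using Suc by (intro borel_measurable_add measurable_If) auto
    then show ?case by (rule measurable_cong[THEN iffD1, rotated]) auto
  qed simp
  have "gap n A t \<omega> \<ge> c \<longleftrightarrow>
      (\<exists>i\<in>{..<n}. real (load A t i \<omega>) - (\<Sum>i<n. real (load A t i \<omega>)) / real n \<ge> c)" for \<omega>
  proof -
    have "0 \<in> {..<n}" using pos by simp
    then have ne: "(\<lambda>i. load A t i \<omega>) ` {..<n} \<noteq> {}" by blast
    have "real (Max ((\<lambda>i. load A t i \<omega>) ` {..<n})) \<ge> r \<longleftrightarrow> (\<exists>i\<in>{..<n}. real (load A t i \<omega>) \<ge> r)" for r
    proof
      assume "real (Max ((\<lambda>i. load A t i \<omega>) ` {..<n})) \<ge> r"
      moreover have "Max ((\<lambda>i. load A t i \<omega>) ` {..<n}) \<in> (\<lambda>i. load A t i \<omega>) ` {..<n}"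
        using ne by (intro Max_in) auto
      ultimately show "\<exists>i\<in>{..<n}. real (load A t i \<omega>) \<ge> r" by auto
    next
      assume "\<exists>i\<in>{..<n}. real (load A t i \<omega>) \<ge> r"
      then obtain i where i: "i < n" "real (load A t i \<omega>) \<ge> r" by auto
      then have "load A t i \<omega> \<le> Max ((\<lambda>i. load A t i \<omega>) ` {..<n})" by (intro Max_ge) auto
      with i show "real (Max ((\<lambda>i. load A t i \<omega>) ` {..<n})) \<ge> r" by linarith
    qed
    from this[of "c + (\<Sum>i<n. real (load A t i \<omega>)) / real n"] show ?thesis
      by (simp add: gap_def total_load_def algebra_simps)
  qed
  then show ?thesis by simp
qed

text \<open>The average load after \<open>T\<close> rounds is at most
  \<open>wm * T / n \<le> b - c\<close>, so a load of at least \<open>b\<close> forces a gap of at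
  least \<open>c\<close>. The events of different paths are disjoint.\<close>

lemma prob_gap_ge:
  assumes T: "real wm * real T / real n \<le> b - c"
  shows "(\<Sum>\<pi>\<in>{\<pi> \<in> paths n T. \<exists>j<n. real (ld \<pi> j) \<ge> b}. path_prob \<pi>)
    \<le> prob {\<omega> \<in> space M. gap n A T \<omega> \<ge> c}"
proof -
  let ?S = "{\<pi> \<in> paths n T. \<exists>j<n. real (ld \<pi> j) \<ge> b}"
  have fin: "finite ?S" by simp
  have disj: "disjoint_family_on path_event ?S"
    by (auto simp: disjoint_family_on_def path_event_def length_paths)
  have "(\<Sum>\<pi>\<in>?S. path_prob \<pi>) = prob (\<Union>\<pi>\<in>?S. path_event \<pi>)"
    unfolding path_prob_def using fin disj path_event_sets
    by (intro finite_measure_finite_Union[symmetric]) auto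
  also have "\<dots> \<le> prob {\<omega> \<in> space M. gap n A T \<omega> \<ge> c}"
  proof (rule finite_measure_mono_AE)
    show "AE \<omega> in M. \<omega> \<in> (\<Union>\<pi>\<in>?S. path_event \<pi>) \<longrightarrow> \<omega> \<in> {\<omega> \<in> space M. gap n A T \<omega> \<ge> c}"
      using AE_regular
    proof eventually_elim
      case (elim \<omega>)
      show ?case
      proof
        assume "\<omega> \<in> (\<Union>\<pi>\<in>?S. path_event \<pi>)"
        then obtain \<pi> j where \<pi>: "\<pi> \<in> paths n T" "j < n" "real (ld \<pi> j) \<ge> b" "\<omega> \<in> path_event \<pi>"
          by auto
        then have ch: "choices A T \<omega> = \<pi>" using path_eventD(2) length_paths by metis
        have "ld \<pi> j \<le> Max ((\<lambda>i. load A T i \<omega>) ` {..<n})"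
          using \<pi> by (intro Max_ge) (auto simp: load_eq[OF elim] ch)
        moreover have "real (total_load n A T \<omega>) / real n \<le> b - c"
        proof -
          have "total_load n A T \<omega> = tot \<pi>" by (simp add: total_load_def tot_def load_eq[OF elim] ch)
          also have "\<dots> \<le> wm * T" by (rule tot_bounds(2)[OF \<pi>(1)])
          finally have "real (total_load n A T \<omega>) / real n \<le> real wm * real T / real n"
            by (intro divide_right_mono) (auto simp flip: of_nat_mult)
          then show ?thesis using T by linarith
        qed
        ultimately have "gap n A T \<omega> \<ge> c" using \<pi>(3) unfolding gap_def by linarith
        then show "\<omega> \<in> {\<omega> \<in> space M. gap n A T \<omega> \<ge> c}" using path_eventD(1)[OF \<pi>(4)] by simp
      qed
    qed
  qed (rule gap_sets)
  finally show ?thesis .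
qed

end

text \<open>Both \<open>P2\<close> with \<open>W1\<close> and \<open>P1\<close> with \<open>W2\<close> (take \<open>k3 = k4 = 0\<close>) are instances of the following
  hypotheses.\<close>

lemma gap_lower_bound:
  fixes A :: "nat \<Rightarrow> 'a process" and k1 k2 k3 k4 c0 :: real
  assumes process: "\<And>n. n \<ge> 1 \<Longrightarrow> allocation_process n (A n)"
    and P3: "cond_P3 A"
    and w: "1 \<le> wp" "wp \<le> wm" and weights: "weights wp wm A"
    and k: "k1 \<ge> 1" "0 < k2" "k2 \<le> 1" "0 < c0" "c0 \<le> 1"
    and drift: "\<And>d. 0 \<le> d \<Longrightarrow> d \<le> 1 \<Longrightarrow>
      real wp * (1 - k3 * (1 - d)) - real wm * (1 + k4 * d) \<le> - 2 * c0"
    and ae: "\<And>n t. n \<ge> 1 \<Longrightarrow> AE \<omega> in sample (A n).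
        (\<forall>i\<in>over_bins n (A n) t \<omega>. alloc_prob n (A n) t i \<omega> \<le> k1 / real n) \<and>
        majorizes
          (replicate (card (over_bins n (A n) t \<omega>))
             (1 / real n - k3 * (1 - over_frac n (A n) t \<omega>) / real n))
          (over_vec n (A n) t \<omega>) \<and>
        (\<forall>i\<in>under_bins n (A n) t \<omega>. alloc_prob n (A n) t i \<omega> \<ge> k2 / real n) \<and>
        majorizes (under_vec n (A n) t \<omega>)
          (replicate (card (under_bins n (A n) t \<omega>))
             (1 / real n + k4 * over_frac n (A n) t \<omega> / real n))"
  shows "\<exists>\<kappa>>0. \<exists>N. \<forall>n\<ge>N.
    measure (sample (A n))
      {\<omega> \<in> space (sample (A n)).
         gap n (A n) (nat \<lfloor>\<kappa> * real n * ln (real n)\<rfloor>) \<omega> \<ge> \<kappa> * ln (real n)}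
    \<ge> 1 - real n powr (- 1 / 2)"
proof -
  \<comment> \<open>The constant of \<open>cond_P3\<close> becomes a function of
    \<open>\<epsilon>\<close>, since \<open>\<epsilon>\<close> is determined only inside
    \<open>max_load_lower_bound\<close>.\<close>
  have "\<forall>\<epsilon>. \<exists>k5::real. 0 < \<epsilon> \<longrightarrow> \<epsilon> < 1 / 2 \<longrightarrow> 0 < k5 \<and> (\<forall>n\<ge>1. \<forall>t. AE \<omega> in sample (A n).
      over_frac n (A n) t \<omega> \<in> {\<epsilon>..1 - \<epsilon>} \<longrightarrow> (\<forall>i<n. alloc_prob n (A n) t i \<omega> \<ge> k5 / real n))"
    using P3 unfolding cond_P3_def by blast
  from choice[OF this] obtain k5 :: "real \<Rightarrow> real" where
    k5: "\<forall>\<epsilon>. 0 < \<epsilon> \<and> \<epsilon> < 1 / 2 \<longrightarrow> 0 < k5 \<epsilon>" and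
    ae5: "\<And>\<epsilon> n t. 0 < \<epsilon> \<Longrightarrow> \<epsilon> < 1 / 2 \<Longrightarrow> n \<ge> 1 \<Longrightarrow> AE \<omega> in sample (A n).
      over_frac n (A n) t \<omega> \<in> {\<epsilon>..1 - \<epsilon>} \<longrightarrow> (\<forall>i<n. alloc_prob n (A n) t i \<omega> \<ge> k5 \<epsilon> / real n)"
    by blast
  from max_load_lower_bound[OF w k(1,2,4) k5] obtain \<kappa> N where kappa: "\<kappa> > 0" and
    low: "\<forall>n\<ge>N. \<forall>P. alloc_tree n wp wm P k1 k2 c0 \<longrightarrow>
    (\<forall>\<epsilon> t \<pi> j. 0 < \<epsilon> \<longrightarrow> \<epsilon> < 1 / 2 \<longrightarrow> \<pi> \<in> paths n t \<longrightarrow> bins.balanced n wp wm \<epsilon> \<pi> \<longrightarrow> j < n \<longrightarrow>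
      k5 \<epsilon> / real n * P \<pi> \<le> P (j # \<pi>)) \<longrightarrow>
    1 - real n powr (- 1 / 2) \<le> alloc_tree.pr n P (nat \<lfloor>\<kappa> * real n * ln (real n)\<rfloor>)
      (\<lambda>\<pi>. \<exists>j<n. real (bins.ld n wp wm \<pi> j) \<ge> \<kappa> * (1 + real wm) * ln (real n))"
    by (elim exE conjE)
  show ?thesis
  proof (intro exI[of _ \<kappa>] conjI exI[of _ "max N 1"] allI impI)
    show "\<kappa> > 0" by (rule kappa)
    fix n assume "n \<ge> max N 1"
    then have n: "n \<ge> N" "n \<ge> 1" by auto
    let ?T = "nat \<lfloor>\<kappa> * real n * ln (real n)\<rfloor>"
    interpret weighted_proc n wp wm "A n"
      using n w process weights by unfold_locales (auto simp: weights_def)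
    interpret tree: alloc_tree n wp wm path_prob k1 k2 c0
      by (rule alloc_tree_path_prob[OF ae[OF n(2)] k drift])
    have "1 - real n powr (- 1 / 2) \<le> tree.pr ?T (\<lambda>\<pi>. \<exists>j<n. real (ld \<pi> j) \<ge> \<kappa> * (1 + real wm) * ln (real n))"
    proof (rule low[rule_format, OF n(1) tree.alloc_tree_axioms])
      fix \<epsilon> t \<pi> j assume "0 < \<epsilon>" "\<epsilon> < 1 / 2" "balanced \<epsilon> \<pi>" "j < n"
      then show "k5 \<epsilon> / real n * path_prob \<pi> \<le> path_prob (j # \<pi>)"
        using ae5[OF _ _ n(2), of \<epsilon> "length \<pi>"] by (intro path_prob_balanced) (auto simp: balanced_def)
    qed
    also have "\<dots> = (\<Sum>\<pi>\<in>{\<pi> \<in> paths n ?T. \<exists>j<n. real (ld \<pi> j) \<ge> \<kappa> * (1 + real wm) * ln (real n)}. path_prob \<pi>)"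
      unfolding tree.pr_def tree.Ex_def by (intro sum.mono_neutral_cong_right) auto
    also have "\<dots> \<le> prob {\<omega> \<in> space (sample (A n)). gap n (A n) ?T \<omega> \<ge> \<kappa> * ln (real n)}"
    proof (rule prob_gap_ge)
      have "real ?T \<le> \<kappa> * real n * ln (real n)" using kappa n by simp
      then have "real ?T / real n \<le> \<kappa> * real n * ln (real n) / real n" by (intro divide_right_mono) auto
      then have "real wm * (real ?T / real n) \<le> real wm * (\<kappa> * ln (real n))"
        using n by (intro mult_left_mono) auto
      then show "real wm * real ?T / real n \<le> \<kappa> * (1 + real wm) * ln (real n) - \<kappa> * ln (real n)"
        by (simp add: algebra_simps)
    qed
    finally show "1 - real n powr (- 1 / 2) \<le> prob {\<omega> \<in> space (sample (A n)). gap n (A n) ?T \<omega> \<ge> \<kappa> * ln (real n)}" .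
  qed
qed

theorem theorem3p2:
  fixes A :: "nat \<Rightarrow> 'a process"
  assumes process: "\<And>n. n \<ge> 1 \<Longrightarrow> allocation_process n (A n)"
    and conditions: "(cond_P2 A \<and> cond_W1 A) \<or> (cond_P1 A \<and> cond_W2 A)"
    and P3: "cond_P3 A"
  shows "\<exists>\<kappa>>0. \<exists>N. \<forall>n\<ge>N.
    measure (sample (A n))
      {\<omega> \<in> space (sample (A n)).
         gap n (A n) (nat \<lfloor>\<kappa> * real n * ln (real n)\<rfloor>) \<omega> \<ge> \<kappa> * ln (real n)}
    \<ge> 1 - real n powr (- 1 / 2)"
  using conditions
proof
  assume c: "cond_P2 A \<and> cond_W1 A"
  then obtain k1 :: nat and k2 k3 k4 :: real
    where k: "k1 \<ge> 1" "0 < k2" "k2 \<le> 1" "0 < k3" "k3 \<le> 1" "0 < k4" "k4 \<le> 1"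
      and ae: "\<forall>n\<ge>1. \<forall>t. AE \<omega> in sample (A n).
        (\<forall>i\<in>over_bins n (A n) t \<omega>. alloc_prob n (A n) t i \<omega> \<le> real k1 / real n) \<and>
        majorizes
          (replicate (card (over_bins n (A n) t \<omega>))
             (1 / real n - k3 * (1 - over_frac n (A n) t \<omega>) / real n))
          (over_vec n (A n) t \<omega>) \<and>
        (\<forall>i\<in>under_bins n (A n) t \<omega>. alloc_prob n (A n) t i \<omega> \<ge> k2 / real n) \<and>
        majorizes (under_vec n (A n) t \<omega>)
          (replicate (card (under_bins n (A n) t \<omega>))
             (1 / real n + k4 * over_frac n (A n) t \<omega> / real n))"
    unfolding cond_P2_def by blast
  from c obtain wp wm where w: "1 \<le> wp" "wp \<le> wm" "weights wp wm A" unfolding cond_W1_def by blast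
  show ?thesis
  proof (rule gap_lower_bound[OF process P3 w, of "real k1" k2 "min k3 k4 / 2" k3 k4])
    fix d :: real assume d: "0 \<le> d" "d \<le> 1"
    have "real wp * (1 + k4 * d) \<le> real wm * (1 + k4 * d)"
      using w k d by (intro mult_right_mono) auto
    \<comment> \<open>The convex combination of \<open>k3\<close> and \<open>k4\<close> is at least
      their minimum, whatever the fraction \<open>d\<close> of overloaded bins; this is the uniform
      drift, halved to give \<open>c0\<close>.\<close>
    moreover have "min k3 k4 * (1 - d) \<le> k3 * (1 - d)" "min k3 k4 * d \<le> k4 * d"
      using d by (auto intro!: mult_right_mono)
    then have "min k3 k4 \<le> k3 * (1 - d) + k4 * d" by (simp add: algebra_simps)
    then have "1 * min k3 k4 \<le> real wp * (k3 * (1 - d) + k4 * d)"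
      using w k by (intro mult_mono) auto
    ultimately show "real wp * (1 - k3 * (1 - d)) - real wm * (1 + k4 * d) \<le> - 2 * (min k3 k4 / 2)"
      by (simp add: algebra_simps)
  qed (use k ae in simp_all)
next
  assume c: "cond_P1 A \<and> cond_W2 A"
  then obtain k1 :: nat and k2 :: real where k: "k1 \<ge> 1" "0 < k2" "k2 \<le> 1"
    and ae: "\<forall>n\<ge>1. \<forall>t. AE \<omega> in sample (A n).
        (\<forall>i\<in>over_bins n (A n) t \<omega>. alloc_prob n (A n) t i \<omega> \<le> real k1 / real n) \<and>
        majorizes (replicate (card (over_bins n (A n) t \<omega>)) (1 / real n)) (over_vec n (A n) t \<omega>) \<and>
        (\<forall>i\<in>under_bins n (A n) t \<omega>. alloc_prob n (A n) t i \<omega> \<ge> k2 / real n) \<and>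
        majorizes (under_vec n (A n) t \<omega>) (replicate (card (under_bins n (A n) t \<omega>)) (1 / real n))"
    unfolding cond_P1_def by blast
  from c obtain wp wm where w: "1 \<le> wp" "wp < wm" "weights wp wm A" unfolding cond_W2_def by blast
  from w have "wp \<le> wm" by simp
  \<comment> \<open>For \<open>k3 = k4 = 0\<close> the drift condition reads
    \<open>wp - wm \<le> - 1\<close>, which holds for integers with \<open>wp < wm\<close>; hence
    \<open>c0 = 1 / 2\<close>.\<close>
  show ?thesis
    by (rule gap_lower_bound[OF process P3 w(1) \<open>wp \<le> wm\<close> w(3), of "real k1" k2 "1 / 2" 0 0])
      (use k w ae in simp_all)
qed

end
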